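(* Let $(W,J),(W_i,J_i)_{i\in\mathbb N}$ be i.i.d. $\mathbb R_+\times\mathbb R$-valued random vectors and suppose that there exist $a_n,b_n>0$ and $d_n\in\mathbb R$ such that $\big(a_n\sum_{i=1}^nW_i,\ b_n(\max_{1\le i\le n}J_i-d_n)\big)\Longrightarrow(D,A)$ in distribution as $n\to\infty$, where $D$ is strictly $\beta$-stable with $0<\beta<1$ and $A$ has an extreme value distribution with distribution function $F_A$. Let $\{(D(t),A(t))\}_{t>0}$ be the associated sum-max process, $E(t)=\inf\{s:D(s)>t\}$, and let $\Psi,\Psi_D,\Phi,\Phi_D,x_0,x_F$ be as in the context. (a) For every fixed $t>0$ and $x\in\mathbb R$, the distribution function of the CTRM limit $A(E(t)-)^+$ is $$P\big(A(E(t)-)^+\le x\big)=\int_{s=0}^\infty\int_{u\in\mathbb R}\int_{\tau=0}^t\mathbf 1_{[-\infty,x]}(u)\,\Phi_D(t-\tau,\infty)\,P_{(D(s),A(s))}(d\tau,du)\,ds.$$ Furthermore, for every $\xi>0$ and all $x_0<x<x_F$, $$\int_0^\infty e^{-\xi t}P\big(A(E(t)-)^+\le x\big)\,dt=\frac1\xi\,\frac{\Psi_D(\xi)}{\Psi(\xi,x)}.$$ (b) For every fixed $t>0$ and $x\in\mathbb R$, the distribution function of the OCTRM limit $A(E(t))$ is $$P\big(A(E(t))\le x\big)=\int_{s=0}^\infty\int_{u\in\mathbb R}\int_{\tau=0}^t\mathbf 1_{[-\infty,x]}(u)\,\Phi\big((t-\tau,\infty)\times[-\infty,x]\big)\,P_{(D(s),A(s))}(d\tau,du)\,ds.$$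 Furthermore, for every $\xi>0$ and all $x_0<x<x_F$, $$\int_0^\infty e^{-\xi t}P\big(A(E(t))\le x\big)\,dt=\frac1\xi\,\frac{\Psi(\xi,x)+\log F_A(x)}{\Psi(\xi,x)}.$$
   Context: $\mathbb R_+=[0,\infty)$. An extreme value distribution is a (nondegenerate) Fréchet, Weibull or Gumbel type distribution. $P_X$ denotes the law of $X$. C-L transform: for a probability measure $\rho$ on $\mathbb R_+\times\mathbb R$, $\mathcal L(\rho)(s,y)=\int_{\mathbb R_+\times\mathbb R}e^{-st}\mathbf 1_{[-\infty,y]}(x)\,\rho(dt,dx)$, $s\ge0$, $y\in\mathbb R$. Endpoints: $x_0=\inf\{y:F_A(y)>0\}\in[-\infty,\infty)$ and $x_F=\sup\{x:F_A(x)<1\}$. C-L exponent and Lévy-exponent measure: it is known that $\mathcal L(P_{(D,A)})(s,y)=\exp(-\Psi(s,y))$ for $s\ge0$, $y>x_0$, where $$\Psi(s,y)=\int\big(1-e^{-st}\mathbf 1_{[x_0,y]}(x)\big)\,\Phi(dt,dx)$$ for a (unique) $\sigma$-finite measure $\Phi$ on $(\mathbb R_+\times[x_0,\infty))\setminus\{(0,x_0)\}$, called the Lévy-exponent measure of $(D,A)$; $\Psi$ is called the C-L exponent. $\Phi((r,\infty)\times[-\infty,x])$ means $\Phi((r,\infty)\times[x_0,x])$ (zero if $x<x_0$). $\Phi_D(B)=\Phi(B\times[x_0,\infty))$, $B\subseteq(0,\infty)$ Borel, is the Lévy measure of $D$, and $\Phi_D(r,\infty)=\Phi_D((r,\infty))$.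 $\Psi_D(s)=\Psi(s,\infty)$, so $\mathbb E(e^{-sD})=e^{-\Psi_D(s)}$; and $\Psi(0,y)=-\log F_A(y)$. Sum-max process: $\{(D(t),A(t))\}_{t>0}$ is the process with càdlàg paths such that for $0=t_0<t_1<\dots<t_m$, $s_j\ge0$, $y_j\in\mathbb R$, $$\mathbb E\Big[e^{-\sum_{j=1}^m s_jD(t_j)}\mathbf 1\{A(t_j)\le y_j,\ 1\le j\le m\}\Big]=\prod_{j=1}^m\mathcal L(P_{(D,A)})\Big(\sum_{k=j}^ms_k,\ \min_{j\le k\le m}y_k\Big)^{t_j-t_{j-1}}.$$ Thus $\{D(t)\}$ is a $\beta$-stable subordinator and $P(A(t)\le x)=F_A(x)^t$. $A(E(t)-)^+=\lim_{r\downarrow t}A^-(E(r))$, where $A^-(s)=\lim_{r\uparrow s}A(r)$ (the right-continuous version of $t\mapsto A^-(E(t))$). The processes $A(E(t)-)^+$ and $A(E(t))$ are the $J_1$ scaling limits of the CTRM process $V(t)=\max_{1\le i\le N(t)}J_i$ and the OCTRM process $U(t)=\max_{1\le i\le N(t)+1}J_i$, where $N(t)=\max\{n\ge0:W_1+\dots+W_n\le t\}$. *)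

theory Defs
  imports "HOL-Probability.Probability"
begin

section \<open>Laws\<close>

definition iid :: "'a measure \<Rightarrow> (nat \<Rightarrow> 'a \<Rightarrow> 'b::topological_space) \<Rightarrow> bool" where
  "iid M X \<longleftrightarrow> prob_space.indep_vars M (\<lambda>_. borel) X UNIV \<and>
     (\<forall>i. distr M borel (X i) = distr M borel (X 0))"

text \<open>Convergence in distribution on a general topological space; \<^const>\<open>weak_conv_m\<close> only
  covers laws on the real line.\<close>

definition converges_weakly :: "(nat \<Rightarrow> 'b::topological_space measure) \<Rightarrow> 'b measure \<Rightarrow> bool" where
  "converges_weakly \<mu> \<nu> \<longleftrightarrow>
     (\<forall>f::'b \<Rightarrow> real. continuous_on UNIV f \<and> bounded (range f) \<longrightarrow>
        (\<lambda>n. integral\<^sup>L (\<mu> n) f) \<longlonglongrightarrow> integral\<^sup>L \<nu> f)"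

text \<open>A sum of \<open>n\<close> independent copies is distributed like \<open>n\<^bsup>1/\<beta>\<^esup>\<close> times one copy.
  As usual, point masses are not counted as stable laws.\<close>

definition strictly_stable :: "real \<Rightarrow> real measure \<Rightarrow> bool" where
  "strictly_stable \<beta> \<nu> \<longleftrightarrow>
     (\<forall>c. \<nu> \<noteq> return borel c) \<and>
     (\<forall>n\<ge>1. distr (Pi\<^sub>M {..<n} (\<lambda>_. \<nu>)) borel (\<lambda>x. \<Sum>i<n. x i) =
             distr \<nu> borel (\<lambda>x. real n powr (1 / \<beta>) * x))"

definition frechet_cdf :: "real \<Rightarrow> real \<Rightarrow> real" where
  "frechet_cdf \<alpha> x = (if x \<le> 0 then 0 else exp (- (x powr (- \<alpha>))))"

definition weibull_cdf :: "real \<Rightarrow> real \<Rightarrow> real" where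
  "weibull_cdf \<alpha> x = (if x < 0 then exp (- ((- x) powr \<alpha>)) else 1)"

definition gumbel_cdf :: "real \<Rightarrow> real" where
  "gumbel_cdf x = exp (- exp (- x))"

text \<open>The extreme value distributions are the types (positive affine classes) of the three
  standard families.\<close>

definition extreme_value_cdf :: "(real \<Rightarrow> real) \<Rightarrow> bool" where
  "extreme_value_cdf F \<longleftrightarrow>
     (\<exists>G c d. ((\<exists>\<alpha>>0. G = frechet_cdf \<alpha>) \<or> (\<exists>\<alpha>>0. G = weibull_cdf \<alpha>) \<or> G = gumbel_cdf) \<and>
        0 < c \<and> F = (\<lambda>x. G (c * x + d)))"

definition left_endpoint :: "(real \<Rightarrow> real) \<Rightarrow> ereal" where
  "left_endpoint F = Inf {ereal y |y. F y > 0}"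

definition right_endpoint :: "(real \<Rightarrow> real) \<Rightarrow> ereal" where
  "right_endpoint F = Sup {ereal x |x. F x < 1}"


section \<open>C-L transform, C-L exponent and Levy-exponent measure\<close>

definition CL_transform :: "(real \<times> real) measure \<Rightarrow> real \<Rightarrow> real \<Rightarrow> real" where
  "CL_transform \<rho> s y = (\<integral>(t, x). exp (- s * t) * indicator {..y} x \<partial>\<rho>)"

text \<open>The second coordinate is extended real because \<open>[x\<^sub>0, \<infinity>)\<close> contains the point
  \<open>x\<^sub>0 = -\<infinity>\<close> for Gumbel and Weibull types, and \<open>(0, \<infinity>) \<times> {x\<^sub>0}\<close> may carry mass.\<close>

definition CL_space :: "ereal \<Rightarrow> (real \<times> ereal) set" where
  "CL_space x0 = ({0..} \<times> {x0..<\<infinity>}) - {(0, x0)}"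

definition CL_integrand :: "ereal \<Rightarrow> real \<Rightarrow> ereal \<Rightarrow> real \<times> ereal \<Rightarrow> real" where
  "CL_integrand x0 s y = (\<lambda>(t, x). 1 - exp (- s * t) * indicator {x0..y} x)"

definition CL_exponent :: "ereal \<Rightarrow> (real \<times> ereal) measure \<Rightarrow> real \<Rightarrow> ereal \<Rightarrow> real" where
  "CL_exponent x0 \<Phi> s y = integral\<^sup>L \<Phi> (CL_integrand x0 s y)"

text \<open>The Laplace exponent of the first coordinate.\<close>

definition CL_exponent_D :: "ereal \<Rightarrow> (real \<times> ereal) measure \<Rightarrow> real \<Rightarrow> real" where
  "CL_exponent_D x0 \<Phi> s = CL_exponent x0 \<Phi> s \<infinity>"

text \<open>Integrability is part of the definition, since a divergent integral would have the
  value 0.\<close>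

definition levy_exponent_measure ::
    "(real \<times> real) measure \<Rightarrow> ereal \<Rightarrow> (real \<times> ereal) measure \<Rightarrow> bool" where
  "levy_exponent_measure \<rho> x0 \<Phi> \<longleftrightarrow>
     sets \<Phi> = sets (restrict_space borel (CL_space x0)) \<and>
     sigma_finite_measure \<Phi> \<and>
     (\<forall>s\<ge>0. \<forall>y. x0 < ereal y \<longrightarrow>
        integrable \<Phi> (CL_integrand x0 s (ereal y)) \<and>
        CL_transform \<rho> s y = exp (- CL_exponent x0 \<Phi> s (ereal y)))"

definition levy_measure_D :: "ereal \<Rightarrow> (real \<times> ereal) measure \<Rightarrow> real set \<Rightarrow> ennreal" where
  "levy_measure_D x0 \<Phi> B = emeasure \<Phi> (B \<times> {x0..<\<infinity>})"


section \<open>The sum-max process and the limits of CTRM and OCTRM\<close>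

definition cadlag :: "(real \<Rightarrow> 'b::topological_space) \<Rightarrow> bool" where
  "cadlag f \<longleftrightarrow> (\<forall>t>0. (f \<longlongrightarrow> f t) (at_right t) \<and> (\<exists>l. (f \<longlongrightarrow> l) (at_left t)))"

text \<open>Only the values at times \<open>t > 0\<close> matter; those at \<open>t \<le> 0\<close> are unconstrained.\<close>

definition sum_max_process ::
    "'c measure \<Rightarrow> (real \<times> real) measure \<Rightarrow> (real \<Rightarrow> 'c \<Rightarrow> real) \<Rightarrow> (real \<Rightarrow> 'c \<Rightarrow> real) \<Rightarrow> bool" where
  "sum_max_process N \<rho> D A \<longleftrightarrow>
     (\<forall>t>0. D t \<in> borel_measurable N \<and> A t \<in> borel_measurable N) \<and>
     (\<forall>t>0. \<forall>\<omega>\<in>space N. 0 \<le> D t \<omega>) \<and>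
     (\<forall>\<omega>\<in>space N. cadlag (\<lambda>t. (D t \<omega>, A t \<omega>))) \<and>
     (\<forall>m\<ge>1. \<forall>t s y :: nat \<Rightarrow> real.
        t 0 = 0 \<and> (\<forall>j<m. t j < t (Suc j)) \<and> (\<forall>j\<in>{1..m}. 0 \<le> s j) \<longrightarrow>
        (\<integral>\<omega>. exp (- (\<Sum>j=1..m. s j * D (t j) \<omega>)) *
              indicator {\<omega>. \<forall>j\<in>{1..m}. A (t j) \<omega> \<le> y j} \<omega> \<partial>N) =
        (\<Prod>j=1..m. CL_transform \<rho> (\<Sum>k=j..m. s k) (Min (y ` {j..m})) powr (t j - t (j - 1))))"

text \<open>Almost surely the set below is nonempty and its infimum is positive.\<close>

definition first_passage :: "(real \<Rightarrow> 'c \<Rightarrow> real) \<Rightarrow> real \<Rightarrow> 'c \<Rightarrow> real" where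
  "first_passage D t \<omega> = Inf {s. 0 < s \<and> D s \<omega> > t}"

definition left_limit :: "(real \<Rightarrow> 'c \<Rightarrow> real) \<Rightarrow> real \<Rightarrow> 'c \<Rightarrow> real" where
  "left_limit A s \<omega> = Lim (at_left s) (\<lambda>r. A r \<omega>)"

text \<open>\<open>A(E(t)-)\<^sup>+\<close>\<close>

definition CTRM_limit :: "(real \<Rightarrow> 'c \<Rightarrow> real) \<Rightarrow> (real \<Rightarrow> 'c \<Rightarrow> real) \<Rightarrow> real \<Rightarrow> 'c \<Rightarrow> real" where
  "CTRM_limit D A t \<omega> = Lim (at_right t) (\<lambda>r. left_limit A (first_passage D r \<omega>) \<omega>)"

text \<open>\<open>A(E(t))\<close>\<close>

definition OCTRM_limit :: "(real \<Rightarrow> 'c \<Rightarrow> real) \<Rightarrow> (real \<Rightarrow> 'c \<Rightarrow> real) \<Rightarrow> real \<Rightarrow> 'c \<Rightarrow> real" where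
  "OCTRM_limit D A t \<omega> = A (first_passage D t \<omega>) \<omega>"

text \<open>The distribution function of a random variable that is only determined up to null sets.
  The two limits above depend on the unconstrained values \<open>A 0 \<omega>\<close>, or on limits that fail to
  exist, for \<open>\<omega>\<close> in a null set; without the completion this could destroy measurability.\<close>

definition dist_fun :: "'c measure \<Rightarrow> ('c \<Rightarrow> real) \<Rightarrow> real \<Rightarrow> real" where
  "dist_fun N X x = measure (completion N) {\<omega> \<in> space N. X \<omega> \<le> x}"

end

theory Submission
  imports Defs
begin

text \<open>
  Put \<open>\<Lambda> = ds \<otimes> P \<otimes> \<Phi>\<close> and attach to a point \<open>(s, \<omega>, (z, a))\<close> the interval
  \<open>[D(s), D(s) + z)\<close>: the stretch of real time that is skipped if the process jumps by \<open>(z, a)\<close>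
  at operational time \<open>s\<close>. Integrating out the jump first shows that the two right-hand sides are
  the \<open>\<Lambda>\<close>-masses of the intervals that cover \<open>t\<close> and satisfy \<open>A(s) \<le> x\<close>, respectively
  \<open>A(s) \<le> x\<close> and \<open>a \<le> x\<close>. So the claim is the compensation formula for the jump across the level
  \<open>t\<close>: before that jump the maximum is \<open>A(E(t)-)\<close>, and \<open>A(E(t))\<close> also takes the jump
  itself into account.

  The proof compares Laplace transforms in \<open>t\<close>.

  \<^item> For the masses, Fubini gives \<open>\<xi>\<^bsup>-1\<^esup>\<close> times the transform
    \<open>\<integral> e\<^bsup>-s\<Psi>(\<xi>,x)\<^esup> ds = 1/\<Psi>(\<xi>,x)\<close> of the starting points times
    \<open>\<integral> (1 - e\<^bsup>-\<xi>z\<^esup>) d\<Phi> = \<Psi>\<^sub>D(\<xi>)\<close>, or \<open>\<Psi>(\<xi>,x) - \<Psi>(0,x)\<close> if \<open>\<Phi>\<close> is restricted to \<open>a \<le> x\<close>.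

  \<^item> For the probabilities, replace operational time by a dyadic grid of mesh \<open>h\<close>. The path crosses
    \<open>t\<close> in exactly one grid cell, and the transforms of the probabilities of the single cells form a
    geometric series of ratio \<open>e\<^bsup>-h\<Psi>(\<xi>,x)\<^esup>\<close>; letting \<open>h\<close> tend to 0 gives the same values.

  Uniqueness of Laplace transforms yields equality for almost every \<open>t\<close> only. Every \<open>t\<close> is reached as
  follows. The total mass of the intervals that cover \<open>t\<close> is 1 for all \<open>t > 0\<close>, because it is 1
  almost everywhere and stability makes the law of the starting points self-similar. As
  \<open>\<Phi>\<close> has infinitely many jumps, this also forbids a positive mass of intervals that start at \<open>t\<close>.
  Hence the mass of covering intervals with a given property is lower semicontinuous in \<open>t\<close>
  from both sides, and so is that of the intervals without the property; the two add up to 1. A monotone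
  function that agrees with such a mass almost everywhere agrees with it everywhere
  (\<open>antimono_eq_covers\<close>).

  Finally, the events described on the grid have to be compared with the limit processes themselves,
  path by path. They agree up to boundary cases, in which a level is reached but not exceeded, and continuity in \<open>t\<close> of the
  mass, respectively right continuity of the exponents in \<open>x\<close>, removes the difference.
\<close>

section \<open>Uniqueness of Laplace transforms\<close>

text \<open>On \<open>[0, 1]\<close> all moments are bounded by 1, so the Taylor polynomials of the characteristic
  function converge to it and the moments determine it.\<close>

lemma moments_determine_law:
  fixes P Q :: "real measure"
  assumes P: "real_distribution P" and Q: "real_distribution Q"
    and supp: "AE x in P. x \<in> {0..1}" "AE x in Q. x \<in> {0..1}"
    and moments: "\<And>n. (\<integral>x. x ^ n \<partial>P) = (\<integral>x. x ^ n \<partial>Q)"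
  shows "P = Q"
proof -
  have approx: "(\<lambda>n. \<Sum>k\<le>n. ((\<i> * complex_of_real t) ^ k / fact k) * complex_of_real (\<integral>x. x ^ k \<partial>R)) \<longlonglongrightarrow> char R t"
    if R: "real_distribution R" "AE x in R. x \<in> {0..1}" for R :: "real measure" and t
  proof -
    interpret real_distribution R by fact
    have ae: "AE x in R. norm (x ^ k) \<le> 1" for k
      using R(2) by eventually_elim (auto intro: power_le_one)
    have int: "integrable R (\<lambda>x. x ^ k)" for k
      by (rule integrable_const_bound[OF ae]) auto
    have abs_le: "expectation (\<lambda>x. \<bar>x\<bar> ^ k) \<le> 1" for k
    proof -
      have "expectation (\<lambda>x. \<bar>x\<bar> ^ k) \<le> expectation (\<lambda>x. 1)"
        using int[of k] ae[of k]
        by (intro integral_mono_AE) (auto simp: power_abs[symmetric])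
      then show ?thesis using prob_space by (simp add: space_eq_univ)
    qed
    have bound: "cmod (char R t - (\<Sum>k\<le>n. ((\<i> * complex_of_real t) ^ k / fact k) * complex_of_real (\<integral>x. x ^ k \<partial>R)))
        \<le> 2 * \<bar>t\<bar> ^ n / fact n" for n
    proof -
      have "cmod (char R t - (\<Sum>k\<le>n. ((\<i> * complex_of_real t) ^ k / fact k) * complex_of_real (\<integral>x. x ^ k \<partial>R)))
          \<le> (2 * \<bar>t\<bar> ^ n / fact n) * expectation (\<lambda>x. \<bar>x\<bar> ^ n)"
        using char_approx1[of n t] int by auto
      also have "\<dots> \<le> (2 * \<bar>t\<bar> ^ n / fact n) * 1"
        by (intro mult_left_mono abs_le) auto
      finally show ?thesis by simp
    qed
    have "(\<lambda>n. 2 * (\<bar>t\<bar> ^ n / fact n)) \<longlonglongrightarrow> 2 * 0"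
      using summable_LIMSEQ_zero[OF summable_exp[of "\<bar>t\<bar>"]]
      by (intro tendsto_mult tendsto_const) (simp add: field_simps)
    then have lim0: "(\<lambda>n. 2 * \<bar>t\<bar> ^ n / fact n) \<longlonglongrightarrow> 0" by simp
    have "(\<lambda>n. char R t - (\<Sum>k\<le>n. ((\<i> * complex_of_real t) ^ k / fact k) * complex_of_real (\<integral>x. x ^ k \<partial>R))) \<longlonglongrightarrow> 0"
      by (rule Lim_null_comparison[OF _ lim0]) (use bound in auto)
    then show ?thesis
      using tendsto_diff[OF tendsto_const[of "char R t"]] by fastforce
  qed
  have "char P t = char Q t" for t
    using approx[OF P supp(1), of t] approx[OF Q supp(2), of t]
    by (simp add: moments LIMSEQ_unique)
  then show ?thesis
    by (intro Levy_uniqueness P Q) auto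
qed

text \<open>The tilted law with density \<open>e\<^bsup>-x\<^esup>\<close>, normalised and pushed forward by \<open>x \<mapsto> e\<^bsup>-x\<^esup>\<close>, lives on
  \<open>[0, 1]\<close>, and its \<open>n\<close>-th moment is the Laplace transform at \<open>n + 1\<close>. Undoing the tilt recovers the measure, which
  need not be finite.\<close>

lemma laplace_determines_measure:
  fixes P Q :: "real measure"
  assumes sets: "sets P = sets borel" "sets Q = sets borel"
    and supp: "AE x in P. 0 \<le> x" "AE x in Q. 0 \<le> x"
    and eq: "\<And>\<xi>. 0 < \<xi> \<Longrightarrow> (\<integral>\<^sup>+x. exp (- \<xi> * x) \<partial>P) = (\<integral>\<^sup>+x. exp (- \<xi> * x) \<partial>Q)"
    and fin: "(\<integral>\<^sup>+x. exp (- x) \<partial>P) < \<infinity>"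
  shows "P = Q"
proof -
  note [measurable_cong] = sets
  define c where "c = (\<integral>\<^sup>+x. ennreal (exp (- x)) \<partial>P)"
  have cQ: "c = (\<integral>\<^sup>+x. ennreal (exp (- x)) \<partial>Q)" using eq[of 1] by (simp add: c_def)
  have c_fin: "c \<noteq> \<infinity>" using fin by (simp add: c_def)
  show ?thesis
  proof (cases "c = 0")
    case True
    have null: "emeasure R UNIV = 0" if "sets R = sets borel" "(\<integral>\<^sup>+x. ennreal (exp (- x)) \<partial>R) = 0" for R :: "real measure"
    proof -
      note [measurable_cong] = that(1)
      have "AE x in R. ennreal (exp (- x)) = 0"
        using that(2) by (subst (asm) nn_integral_0_iff_AE) auto
      then have "AE x in R. False" by eventually_elim (simp add: ennreal_eq_0_iff not_le)
      then show ?thesis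
        using that(1) sets_eq_imp_space_eq[OF that(1)] by (simp add: AE_iff_measurable[OF _ refl])
    qed
    show ?thesis
    proof (rule measure_eqI)
      show "sets P = sets Q" using sets by simp
      fix B assume "B \<in> sets P"
      have "emeasure P B \<le> emeasure P UNIV" "emeasure Q B \<le> emeasure Q UNIV"
        using sets by (auto intro!: emeasure_mono)
      with null[OF sets(1)] null[OF sets(2)] True cQ show "emeasure P B = emeasure Q B"
        by (simp add: c_def)
    qed
  next
    case False
    define tilt where "tilt R = distr (density R (\<lambda>x. ennreal (exp (- x)) / c)) borel (\<lambda>x. exp (- x))" for R :: "real measure"
    have untilt: "R = density (distr (tilt R) borel (\<lambda>y. - ln y)) (\<lambda>x. c * ennreal (exp x))"
      if R: "sets R = sets borel" for R
    proof -
      note [measurable_cong] = R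
      have "distr (tilt R) borel (\<lambda>y. - ln y) = distr (density R (\<lambda>x. ennreal (exp (- x)) / c)) borel (\<lambda>x. x)"
        unfolding tilt_def by (subst distr_distr) (auto simp: comp_def)
      also have "\<dots> = density R (\<lambda>x. ennreal (exp (- x)) / c)"
        by (rule distr_id2) (simp add: R)
      finally have eq: "distr (tilt R) borel (\<lambda>y. - ln y) = density R (\<lambda>x. ennreal (exp (- x)) / c)" .
      have "density (density R (\<lambda>x. ennreal (exp (- x)) / c)) (\<lambda>x. c * ennreal (exp x)) = density R (\<lambda>x. 1)"
      proof (subst density_density_eq)
        have "ennreal (exp (- x)) / c * (c * ennreal (exp x)) = 1" for x
        proof -
          have "ennreal (exp (- x)) / c * (c * ennreal (exp x)) = (ennreal (exp (- x)) * ennreal (exp x)) * (c / c)"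
            by (simp add: ennreal_times_divide mult.commute mult.left_commute divide_ennreal_def mult.assoc)
          also have "\<dots> = 1"
            using False c_fin by (simp add: ennreal_mult[symmetric] exp_add[symmetric] ennreal_divide_self top.not_eq_extremum)
          finally show ?thesis .
        qed
        then show "density R (\<lambda>x. ennreal (exp (- x)) / c * (c * ennreal (exp x))) = density R (\<lambda>x. 1)" by simp
      qed auto
      then show ?thesis by (simp add: density_1 eq)
    qed
    have mom: "real_distribution (tilt R)" "AE x in tilt R. x \<in> {0..1}"
        "(\<integral>x. x ^ n \<partial>tilt R) = enn2real ((\<integral>\<^sup>+x. exp (- real (Suc n) * x) \<partial>R) / c)"
      if R: "sets R = sets borel" "AE x in R. 0 \<le> x" "c = (\<integral>\<^sup>+x. ennreal (exp (- x)) \<partial>R)" for R n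
    proof -
      note [measurable_cong] = R(1)
      have spR: "space R = UNIV" using sets_eq_imp_space_eq[OF R(1)] by simp
      have "emeasure (density R (\<lambda>x. ennreal (exp (- x)) / c)) UNIV = (\<integral>\<^sup>+x. ennreal (exp (- x)) / c \<partial>R)"
        by (subst emeasure_density) (auto simp: R(1) spR)
      also have "\<dots> = c / c" unfolding R(3) by (simp add: nn_integral_divide)
      also have "\<dots> = 1" using False c_fin by (simp add: ennreal_divide_self top.not_eq_extremum)
      finally have "prob_space (density R (\<lambda>x. ennreal (exp (- x)) / c))"
        by (intro prob_spaceI) (simp add: spR)
      then interpret T: prob_space "tilt R"
        unfolding tilt_def by (rule prob_space.prob_space_distr) auto
      show "real_distribution (tilt R)"
        by unfold_locales (auto simp: tilt_def)
      show ae: "AE x in tilt R. x \<in> {0..1}"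
        unfolding tilt_def using R(2) by (auto simp: AE_distr_iff AE_density)
      have "(\<integral>x. x ^ n \<partial>tilt R) = enn2real (\<integral>\<^sup>+x. ennreal (x ^ n) \<partial>tilt R)"
        using ae by (intro integral_eq_nn_integral) (auto simp: tilt_def)
      also have "(\<integral>\<^sup>+x. ennreal (x ^ n) \<partial>tilt R) = (\<integral>\<^sup>+x. ennreal (exp (- real (Suc n) * x)) / c \<partial>R)"
        unfolding tilt_def
      proof (subst nn_integral_distr, simp, simp, subst nn_integral_density, simp, simp, intro nn_integral_cong)
        fix x :: real
        have "exp (- x) * exp (- x) ^ n = exp (- real (Suc n) * x)"
          by (simp add: exp_add[symmetric] exp_of_nat_mult[symmetric] algebra_simps)
        then have "ennreal (exp (- x)) * ennreal (exp (- x) ^ n) = ennreal (exp (- real (Suc n) * x))"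
          by (simp add: ennreal_mult[symmetric])
        then show "ennreal (exp (- x)) / c * ennreal (exp (- x) ^ n) = ennreal (exp (- real (Suc n) * x)) / c"
          by (metis ennreal_times_divide mult.commute)
      qed
      also have "\<dots> = (\<integral>\<^sup>+x. ennreal (exp (- real (Suc n) * x)) \<partial>R) / c"
        by (rule nn_integral_divide) auto
      finally show "(\<integral>x. x ^ n \<partial>tilt R) = enn2real ((\<integral>\<^sup>+x. exp (- real (Suc n) * x) \<partial>R) / c)" .
    qed
    have "tilt P = tilt Q"
    proof (intro moments_determine_law mom[OF sets(1) supp(1) c_def] mom[OF sets(2) supp(2) cQ])
      fix n
      show "(\<integral>x. x ^ n \<partial>tilt P) = (\<integral>x. x ^ n \<partial>tilt Q)"
        unfolding mom(3)[OF sets(1) supp(1) c_def] mom(3)[OF sets(2) supp(2) cQ]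
        by (subst eq) auto
    qed
    then show ?thesis using untilt[OF sets(1)] untilt[OF sets(2)] by simp
  qed
qed

abbreviation laplace_nn :: "real \<Rightarrow> (real \<Rightarrow> ennreal) \<Rightarrow> ennreal" where
  "laplace_nn \<xi> f \<equiv> (\<integral>\<^sup>+t\<in>{0<..}. ennreal (exp (- \<xi> * t)) * f t \<partial>lborel)"

lemma laplace_determines_function:
  fixes f g :: "real \<Rightarrow> ennreal"
  assumes [measurable]: "f \<in> borel_measurable borel" "g \<in> borel_measurable borel"
    and eq: "\<And>\<xi>. 0 < \<xi> \<Longrightarrow>
      laplace_nn \<xi> f = laplace_nn \<xi> g"
    and fin: "\<And>\<xi>. 0 < \<xi> \<Longrightarrow> laplace_nn \<xi> f < \<infinity>"
  shows "AE t in lborel. 0 < t \<longrightarrow> f t = g t"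
proof -
  define F G where "F = (\<lambda>t. f t * indicator {0<..} t)" and "G = (\<lambda>t. g t * indicator {0<..} t)"
  have [measurable]: "F \<in> borel_measurable lborel" "G \<in> borel_measurable lborel"
    by (auto simp: F_def G_def)
  have int: "(\<integral>\<^sup>+t. exp (- \<xi> * t) \<partial>density lborel (\<lambda>t. h t * indicator {0<..} t)) = laplace_nn \<xi> h"
    if [measurable]: "h \<in> borel_measurable borel" for h \<xi>
    by (subst nn_integral_density) (auto intro!: nn_integral_cong simp: mult_ac)
  have supp: "AE t in density lborel (\<lambda>t. h t * indicator {0<..} t). 0 \<le> t"
    if [measurable]: "h \<in> borel_measurable borel" for h :: "real \<Rightarrow> ennreal"
    by (subst AE_density) (auto split: split_indicator)
  have "density lborel F = density lborel G"
  proof (rule laplace_determines_measure)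
    show "(\<integral>\<^sup>+x. exp (- x) \<partial>density lborel F) < \<infinity>"
      using fin[of 1] int[of f 1] by (simp add: F_def)
    show "AE t in density lborel F. 0 \<le> t" "AE t in density lborel G. 0 \<le> t"
      unfolding F_def G_def by (intro supp; simp)+
  qed (use int eq in \<open>auto simp: F_def G_def\<close>)
  then have "AE t in lborel. F t = G t"
    by (intro sigma_finite_measure.density_unique) (auto intro: lborel.sigma_finite_measure_axioms)
  then show ?thesis
    by eventually_elim (auto simp: F_def G_def split: split_indicator_asm)
qed

section \<open>Random intervals covering a point\<close>

lemma nn_integral_exp_interval:
  fixes \<xi> x z :: real
  assumes "0 < \<xi>" "0 \<le> x" "0 \<le> z"
  shows "(\<integral>\<^sup>+t. ennreal (exp (- \<xi> * t)) * indicator {t. 0 < t \<and> x \<le> t \<and> t < x + z} t \<partial>lborel)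
    = ennreal (exp (- \<xi> * x) * (1 - exp (- \<xi> * z)) / \<xi>)"
proof -
  have "(\<integral>\<^sup>+t. ennreal (exp (- \<xi> * t)) * indicator {t. 0 < t \<and> x \<le> t \<and> t < x + z} t \<partial>lborel)
      = (\<integral>\<^sup>+t. ennreal (exp (- \<xi> * t)) * indicator {x..x + z} t \<partial>lborel)"
  proof (rule nn_integral_cong_AE)
    have "AE t in lborel. t \<noteq> x \<and> t \<noteq> x + z"
      using AE_lborel_singleton[of x] AE_lborel_singleton[of "x + z"] by eventually_elim auto
    then show "AE t in lborel. ennreal (exp (- \<xi> * t)) * indicator {t. 0 < t \<and> x \<le> t \<and> t < x + z} t
        = ennreal (exp (- \<xi> * t)) * indicator {x..x + z} t"
      by eventually_elim (use assms in \<open>auto split: split_indicator\<close>)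
  qed
  also have "\<dots> = ennreal ((- exp (- \<xi> * (x + z)) / \<xi>) - (- exp (- \<xi> * x) / \<xi>))"
    using assms by (intro nn_integral_FTC_Icc[where F = "\<lambda>t. - exp (- \<xi> * t) / \<xi>"])
      (auto intro!: derivative_eq_intros simp: has_real_derivative_iff_has_vector_derivative[symmetric])
  also have "(- exp (- \<xi> * (x + z)) / \<xi>) - (- exp (- \<xi> * x) / \<xi>) = exp (- \<xi> * x) * (1 - exp (- \<xi> * z)) / \<xi>"
    using assms by (simp add: field_simps exp_add[symmetric])
  finally show ?thesis .
qed

lemma nn_integral_exp_halfline:
  assumes "0 < \<xi>"
  shows "(\<integral>\<^sup>+t\<in>{0<..}. ennreal (exp (- \<xi> * t)) \<partial>lborel) = ennreal (1 / \<xi>)"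
proof -
  have "(\<integral>\<^sup>+t\<in>{0<..}. ennreal (exp (- \<xi> * t)) \<partial>lborel) = (\<integral>\<^sup>+t. ennreal (exp (- \<xi> * t)) * indicator {0..} t \<partial>lborel)"
  proof (rule nn_integral_cong_AE)
    have "AE t in lborel. t \<noteq> (0::real)"
      by (intro AE_lborel_singleton)
    then show "AE t in lborel. ennreal (exp (- \<xi> * t)) * indicator {0<..} t
        = ennreal (exp (- \<xi> * t)) * indicator {0..} t"
      by eventually_elim (auto split: split_indicator)
  qed
  also have "\<dots> = ennreal (0 - (- exp (- \<xi> * 0) / \<xi>))"
  proof (rule nn_integral_FTC_atLeast[where F = "\<lambda>t. - exp (- \<xi> * t) / \<xi>"])
    show "((\<lambda>t. - exp (- \<xi> * t) / \<xi>) \<longlongrightarrow> 0) at_top"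
      using assms by real_asymp
  qed (use assms in \<open>auto intro!: derivative_eq_intros\<close>)
  finally show ?thesis by simp
qed

text \<open>The half-open interval matters: intervals that follow one another without a gap cover every
  point exactly once.\<close>

definition covers :: "('a \<Rightarrow> real) \<Rightarrow> ('a \<Rightarrow> real) \<Rightarrow> real \<Rightarrow> 'a \<Rightarrow> bool" where
  "covers X Z t p \<longleftrightarrow> X p \<le> t \<and> t < X p + Z p"

lemma measurable_covers [measurable]:
  assumes [measurable]: "X \<in> borel_measurable \<Lambda>" "Z \<in> borel_measurable \<Lambda>"
  shows "Measurable.pred \<Lambda> (covers X Z t)"
  unfolding covers_def by measurable

abbreviation cover_mass ::
    "'a measure \<Rightarrow> ('a \<Rightarrow> real) \<Rightarrow> ('a \<Rightarrow> real) \<Rightarrow> ('a \<Rightarrow> bool) \<Rightarrow> real \<Rightarrow> ennreal" where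
  "cover_mass \<Lambda> X Z C t \<equiv> emeasure \<Lambda> {p \<in> space \<Lambda>. covers X Z t p \<and> C p}"

lemma measurable_emeasure_covers:
  assumes "sigma_finite_measure \<Lambda>"
    and [measurable]: "X \<in> borel_measurable \<Lambda>" "Z \<in> borel_measurable \<Lambda>" "Measurable.pred \<Lambda> C"
  shows "(\<lambda>t. cover_mass \<Lambda> X Z C t) \<in> borel_measurable borel"
proof -
  interpret sigma_finite_measure \<Lambda> by fact
  have "(\<lambda>t. \<integral>\<^sup>+p. indicator {p \<in> space \<Lambda>. covers X Z t p \<and> C p} p \<partial>\<Lambda>) \<in> borel_measurable borel"
    unfolding covers_def by measurable
  also have "(\<lambda>t. \<integral>\<^sup>+p. indicator {p \<in> space \<Lambda>. covers X Z t p \<and> C p} p \<partial>\<Lambda>)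
      = (\<lambda>t. cover_mass \<Lambda> X Z C t)"
    by (intro ext nn_integral_indicator) measurable
  finally show ?thesis .
qed

abbreviation interval_transform ::
    "'a measure \<Rightarrow> ('a \<Rightarrow> real) \<Rightarrow> ('a \<Rightarrow> real) \<Rightarrow> ('a \<Rightarrow> bool) \<Rightarrow> real \<Rightarrow> ennreal" where
  "interval_transform \<Lambda> X Z C \<xi> \<equiv>
     (\<integral>\<^sup>+p. ennreal (exp (- \<xi> * X p) * (1 - exp (- \<xi> * Z p)) / \<xi>) * indicator {p. C p} p \<partial>\<Lambda>)"

text \<open>By Fubini the integral over \<open>t\<close> can be taken first, over the interval itself.\<close>

lemma laplace_covers:
  assumes "sigma_finite_measure \<Lambda>"
    and [measurable]: "X \<in> borel_measurable \<Lambda>" "Z \<in> borel_measurable \<Lambda>" "Measurable.pred \<Lambda> C"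
    and nonneg: "AE p in \<Lambda>. 0 \<le> X p \<and> 0 \<le> Z p"
    and \<xi>: "0 < \<xi>"
  shows "laplace_nn \<xi> (\<lambda>t. cover_mass \<Lambda> X Z C t)
    = interval_transform \<Lambda> X Z C \<xi>"
proof -
  interpret sigma_finite_measure \<Lambda> by fact
  interpret pair_sigma_finite lborel \<Lambda> ..
  have "laplace_nn \<xi> (\<lambda>t. cover_mass \<Lambda> X Z C t)
      = (\<integral>\<^sup>+t. (\<integral>\<^sup>+p. ennreal (exp (- \<xi> * t)) * indicator {0<..} t * indicator {p \<in> space \<Lambda>. covers X Z t p \<and> C p} p \<partial>\<Lambda>) \<partial>lborel)"
    by (intro nn_integral_cong) (simp add: nn_integral_cmult mult_ac)
  also have "\<dots> = (\<integral>\<^sup>+p. (\<integral>\<^sup>+t. ennreal (exp (- \<xi> * t)) * indicator {0<..} t * indicator {p \<in> space \<Lambda>. covers X Z t p \<and> C p} p \<partial>lborel) \<partial>\<Lambda>)"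
    unfolding covers_def by (rule Fubini'[symmetric]) measurable
  also have "\<dots> = interval_transform \<Lambda> X Z C \<xi>"
  proof (rule nn_integral_cong_AE)
    show "AE p in \<Lambda>. (\<integral>\<^sup>+t. ennreal (exp (- \<xi> * t)) * indicator {0<..} t * indicator {p \<in> space \<Lambda>. covers X Z t p \<and> C p} p \<partial>lborel)
        = ennreal (exp (- \<xi> * X p) * (1 - exp (- \<xi> * Z p)) / \<xi>) * indicator {p. C p} p"
      using nonneg AE_space
    proof eventually_elim
      case (elim p)
      have "(\<integral>\<^sup>+t. ennreal (exp (- \<xi> * t)) * indicator {0<..} t * indicator {p \<in> space \<Lambda>. covers X Z t p \<and> C p} p \<partial>lborel)
          = (\<integral>\<^sup>+t. (ennreal (exp (- \<xi> * t)) * indicator {t. 0 < t \<and> X p \<le> t \<and> t < X p + Z p} t) * indicator {p. C p} p \<partial>lborel)"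
        using elim by (intro nn_integral_cong) (auto simp: covers_def split: split_indicator)
      also have "\<dots> = (\<integral>\<^sup>+t. ennreal (exp (- \<xi> * t)) * indicator {t. 0 < t \<and> X p \<le> t \<and> t < X p + Z p} t \<partial>lborel) * indicator {p. C p} p"
        by (rule nn_integral_multc) measurable
      also have "(\<integral>\<^sup>+t. ennreal (exp (- \<xi> * t)) * indicator {t. 0 < t \<and> X p \<le> t \<and> t < X p + Z p} t \<partial>lborel)
          = ennreal (exp (- \<xi> * X p) * (1 - exp (- \<xi> * Z p)) / \<xi>)"
        using elim \<xi> by (intro nn_integral_exp_interval) auto
      finally show ?case .
    qed
  qed
  finally show ?thesis .
qed

text \<open>Turns a statement for almost every \<open>t\<close> into one about points arbitrarily close to a given one.\<close>

lemma AE_lborel_point_in_interval: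
  fixes u v :: real
  assumes "AE t in lborel. P t" "u < v"
  obtains t where "u < t" "t < v" "P t"
proof -
  have "\<exists>t. u < t \<and> t < v \<and> P t"
  proof (rule ccontr)
    assume "\<not> ?thesis"
    with assms(1) have "AE t in lborel. t \<notin> {u<..<v}" by (auto elim: eventually_mono)
    then have "emeasure lborel {u<..<v} = 0"
      by (subst (asm) AE_iff_measurable[where N="{u<..<v}"]) auto
    with \<open>u < v\<close> show False by simp
  qed
  then show ?thesis using that by blast
qed

text \<open>Lower semicontinuity from the right: a half-open interval that covers \<open>t\<close> also covers a right
  neighbourhood of \<open>t\<close>, so the covering intervals exhaust those that cover all of \<open>[t, t + 1/(m+1)]\<close>.\<close>

lemma covers_le_from_right:
  assumes [measurable]: "X \<in> borel_measurable \<Lambda>" "Z \<in> borel_measurable \<Lambda>" "Measurable.pred \<Lambda> C"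
    and bound: "\<And>v. t < v \<Longrightarrow> \<exists>u. t < u \<and> u < v \<and> cover_mass \<Lambda> X Z C u \<le> B"
  shows "cover_mass \<Lambda> X Z C t \<le> B"
proof -
  define S where "S m = {p \<in> space \<Lambda>. X p \<le> t \<and> t + 1 / real (Suc m) < X p + Z p \<and> C p}" for m
  have "cover_mass \<Lambda> X Z C t = (SUP m. emeasure \<Lambda> (S m))"
  proof (subst SUP_emeasure_incseq)
    show "range S \<subseteq> sets \<Lambda>" unfolding S_def by auto
    show "incseq S"
    proof (rule incseq_SucI)
      fix m
      have "1 / real (Suc (Suc m)) \<le> 1 / real (Suc m)" by (simp add: frac_le)
      then show "S m \<subseteq> S (Suc m)" unfolding S_def by auto
    qed
    have "p \<in> (\<Union>m. S m)" if "p \<in> space \<Lambda>" "covers X Z t p" "C p" for p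
    proof -
      have "0 < X p + Z p - t" using that(2) by (simp add: covers_def)
      then obtain m where "1 / real (Suc m) < X p + Z p - t" using nat_approx_posE by blast
      then show ?thesis using that by (auto simp: S_def covers_def intro!: exI[of _ m])
    qed
    moreover have "S m \<subseteq> {p \<in> space \<Lambda>. covers X Z t p \<and> C p}" for m
      by (auto simp: S_def covers_def intro: less_trans[rotated] order.strict_trans1[rotated])
    ultimately show "cover_mass \<Lambda> X Z C t = emeasure \<Lambda> (\<Union>m. S m)"
      by (intro arg_cong[where f = "emeasure \<Lambda>"]) blast
  qed
  also have "\<dots> \<le> B"
  proof (rule SUP_least)
    fix m
    obtain u where u: "t < u" "u < t + 1 / real (Suc m)" "cover_mass \<Lambda> X Z C u \<le> B"
      using bound[of "t + 1 / real (Suc m)"] by auto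
    have "emeasure \<Lambda> (S m) \<le> cover_mass \<Lambda> X Z C u"
      unfolding S_def using u by (intro emeasure_mono) (auto simp: covers_def)
    then show "emeasure \<Lambda> (S m) \<le> B" using u(3) by (rule order_trans)
  qed
  finally show ?thesis .
qed

text \<open>The mirror image of the previous lemma. Only the intervals that start exactly at \<open>t\<close> cover \<open>t\<close> without covering a left
  neighbourhood.\<close>

lemma covers_le_from_left:
  assumes [measurable]: "X \<in> borel_measurable \<Lambda>" "Z \<in> borel_measurable \<Lambda>" "Measurable.pred \<Lambda> C"
    and no_start: "emeasure \<Lambda> {p \<in> space \<Lambda>. X p = t \<and> 0 < Z p} = 0"
    and bound: "\<And>v. v < t \<Longrightarrow> \<exists>u. v < u \<and> u < t \<and> cover_mass \<Lambda> X Z C u \<le> B"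
  shows "cover_mass \<Lambda> X Z C t \<le> B"
proof -
  define S where "S m = {p \<in> space \<Lambda>. X p \<le> t - 1 / real (Suc m) \<and> t < X p + Z p \<and> C p}" for m
  have "cover_mass \<Lambda> X Z C t
      \<le> emeasure \<Lambda> ((\<Union>m. S m) \<union> {p \<in> space \<Lambda>. X p = t \<and> 0 < Z p})"
  proof (rule emeasure_mono)
    show "{p \<in> space \<Lambda>. covers X Z t p \<and> C p} \<subseteq> (\<Union>m. S m) \<union> {p \<in> space \<Lambda>. X p = t \<and> 0 < Z p}"
    proof
      fix p assume p: "p \<in> {p \<in> space \<Lambda>. covers X Z t p \<and> C p}"
      show "p \<in> (\<Union>m. S m) \<union> {p \<in> space \<Lambda>. X p = t \<and> 0 < Z p}"
      proof (cases "X p = t")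
        case True
        with p show ?thesis by (auto simp: covers_def)
      next
        case False
        with p have "0 < t - X p" by (simp add: covers_def)
        then obtain m where "1 / real (Suc m) < t - X p" using nat_approx_posE by blast
        then have "p \<in> S m" using p by (auto simp: S_def covers_def)
        then show ?thesis by blast
      qed
    qed
    show "(\<Union>m. S m) \<union> {p \<in> space \<Lambda>. X p = t \<and> 0 < Z p} \<in> sets \<Lambda>"
      unfolding S_def by measurable
  qed
  also have "\<dots> \<le> emeasure \<Lambda> (\<Union>m. S m) + emeasure \<Lambda> {p \<in> space \<Lambda>. X p = t \<and> 0 < Z p}"
    by (rule emeasure_subadditive) (auto simp: S_def)
  also have "\<dots> = (SUP m. emeasure \<Lambda> (S m))"
  proof (subst SUP_emeasure_incseq)
    show "range S \<subseteq> sets \<Lambda>" unfolding S_def by auto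
    show "incseq S"
    proof (rule incseq_SucI)
      fix m
      have "1 / real (Suc (Suc m)) \<le> 1 / real (Suc m)" by (simp add: frac_le)
      then show "S m \<subseteq> S (Suc m)" unfolding S_def by auto
    qed
  qed (use no_start in auto)
  also have "\<dots> \<le> B"
  proof (rule SUP_least)
    fix m
    obtain u where u: "t - 1 / real (Suc m) < u" "u < t" "cover_mass \<Lambda> X Z C u \<le> B"
      using bound[of "t - 1 / real (Suc m)"] by auto
    have "emeasure \<Lambda> (S m) \<le> cover_mass \<Lambda> X Z C u"
      unfolding S_def using u by (intro emeasure_mono) (auto simp: covers_def)
    then show "emeasure \<Lambda> (S m) \<le> B" using u(3) by (rule order_trans)
  qed
  finally show ?thesis .
qed

lemma covers_complement:
  assumes [measurable]: "X \<in> borel_measurable \<Lambda>" "Z \<in> borel_measurable \<Lambda>" "Measurable.pred \<Lambda> C"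
    and one: "emeasure \<Lambda> {p \<in> space \<Lambda>. covers X Z t p} = 1"
    and r: "cover_mass \<Lambda> X Z C t = ennreal c" "0 \<le> c"
  shows "cover_mass \<Lambda> X Z (\<lambda>p. \<not> C p) t = ennreal (1 - c)"
proof -
  have "ennreal c + cover_mass \<Lambda> X Z (\<lambda>p. \<not> C p) t
      = emeasure \<Lambda> ({p \<in> space \<Lambda>. covers X Z t p \<and> C p} \<union> {p \<in> space \<Lambda>. covers X Z t p \<and> \<not> C p})"
    unfolding r(1)[symmetric] by (intro plus_emeasure) auto
  also have "\<dots> = 1" unfolding one[symmetric] by (intro arg_cong[where f = "emeasure \<Lambda>"]) auto
  finally have "cover_mass \<Lambda> X Z (\<lambda>p. \<not> C p) t = 1 - ennreal c"
    by (metis ennreal_add_diff_cancel_left ennreal_neq_top)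
  then show ?thesis using r(2) by (simp add: ennreal_minus[symmetric])
qed

lemma borel_measurable_antimono_halfline:
  fixes g :: "real \<Rightarrow> real"
  assumes "\<And>s t. 0 < s \<Longrightarrow> s \<le> t \<Longrightarrow> g t \<le> g s"
  shows "(\<lambda>t. g t * indicator {0<..} t) \<in> borel_measurable borel"
proof -
  have "(\<lambda>t. - g t) \<in> borel_measurable (restrict_space borel {0<..})"
    by (rule borel_measurable_mono_on_fnc) (auto simp: mono_on_def intro: assms)
  then have "(\<lambda>t. - (- g t)) \<in> borel_measurable (restrict_space borel {0<..})"
    by (rule borel_measurable_uminus)
  then show ?thesis by (simp add: borel_measurable_restrict_space_iff mult.commute)
qed

text \<open>Equality holds almost everywhere by uniqueness of Laplace transforms. As \<open>g\<close> decreases, points slightly to the right of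
  \<open>t\<close> show that the mass at \<open>t\<close> is at most \<open>g t\<close>; the complementary
  mass is treated with points slightly to the left, which gives the reverse inequality.\<close>

lemma antimono_eq_covers:
  fixes g :: "real \<Rightarrow> real"
  assumes \<Lambda>: "sigma_finite_measure \<Lambda>"
    and [measurable]: "X \<in> borel_measurable \<Lambda>" "Z \<in> borel_measurable \<Lambda>" "Measurable.pred \<Lambda> C"
    and nonneg: "AE p in \<Lambda>. 0 \<le> X p \<and> 0 \<le> Z p"
    and one: "\<And>t. 0 < t \<Longrightarrow> emeasure \<Lambda> {p \<in> space \<Lambda>. covers X Z t p} = 1"
    and no_start: "\<And>t. 0 < t \<Longrightarrow> emeasure \<Lambda> {p \<in> space \<Lambda>. X p = t \<and> 0 < Z p} = 0"
    and g: "\<And>s t. 0 < s \<Longrightarrow> s \<le> t \<Longrightarrow> g t \<le> g s" "\<And>t. 0 < t \<Longrightarrow> 0 \<le> g t" "\<And>t. 0 < t \<Longrightarrow> g t \<le> 1"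
    and laplace: "\<And>\<xi>. 0 < \<xi> \<Longrightarrow> laplace_nn \<xi> (\<lambda>t. ennreal (g t))
      = interval_transform \<Lambda> X Z C \<xi>"
    and "0 < t"
  shows "ennreal (g t) = cover_mass \<Lambda> X Z C t"
proof -
  define r where "r t = cover_mass \<Lambda> X Z C t" for t
  have [measurable]: "(\<lambda>t. g t * indicator {0<..} t) \<in> borel_measurable borel"
    using g(1) by (rule borel_measurable_antimono_halfline)
  have ae: "AE t in lborel. 0 < t \<longrightarrow> ennreal (g t) = r t"
  proof -
    have "AE t in lborel. 0 < t \<longrightarrow> ennreal (g t * indicator {0<..} t) = r t"
    proof (rule laplace_determines_function)
      show "r \<in> borel_measurable borel"
        using measurable_emeasure_covers[OF \<Lambda>, of X Z C] unfolding r_def by simp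
      fix \<xi> :: real assume \<xi>: "0 < \<xi>"
      have eq: "laplace_nn \<xi> (\<lambda>t. ennreal (g t * indicator {0<..} t))
          = laplace_nn \<xi> (\<lambda>t. ennreal (g t))"
        by (intro nn_integral_cong) (auto split: split_indicator)
      show "laplace_nn \<xi> (\<lambda>t. ennreal (g t * indicator {0<..} t))
          = laplace_nn \<xi> r"
        unfolding eq laplace[OF \<xi>] r_def using laplace_covers[OF \<Lambda> _ _ _ nonneg \<xi>, of C] by simp
      have "laplace_nn \<xi> (\<lambda>t. ennreal (g t)) \<le> (\<integral>\<^sup>+t\<in>{0<..}. exp (- \<xi> * t) \<partial>lborel)"
        using g by (intro nn_integral_mono)
          (auto split: split_indicator simp: ennreal_mult[symmetric] mult_left_le)
      also have "\<dots> < \<infinity>" using \<xi> by (subst nn_integral_exp_halfline) auto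
      finally show "laplace_nn \<xi> (\<lambda>t. ennreal (g t * indicator {0<..} t)) < \<infinity>"
        unfolding eq .
    qed simp
    then show ?thesis by eventually_elim auto
  qed
  have upper: "r t \<le> ennreal (g t)"
    unfolding r_def
  proof (rule covers_le_from_right)
    fix v assume "t < v"
    then obtain u where u: "t < u" "u < v" "0 < u \<longrightarrow> ennreal (g u) = r u"
      using AE_lborel_point_in_interval[OF ae] by blast
    have "r u = ennreal (g u)" using u \<open>0 < t\<close> by simp
    also have "\<dots> \<le> ennreal (g t)" using u \<open>0 < t\<close> by (intro ennreal_leI g) auto
    finally have "r u \<le> ennreal (g t)" .
    with u show "\<exists>u. t < u \<and> u < v \<and> cover_mass \<Lambda> X Z C u \<le> ennreal (g t)"
      unfolding r_def by blast
  qed auto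
  then obtain c where c: "r t = ennreal c" "0 \<le> c" by (cases "r t") (auto simp: top_unique)
  have "cover_mass \<Lambda> X Z (\<lambda>p. \<not> C p) t \<le> ennreal (1 - g t)"
  proof (rule covers_le_from_left)
    fix v assume "v < t"
    then obtain u where u: "max v 0 < u" "u < t" "0 < u \<longrightarrow> ennreal (g u) = r u"
      using AE_lborel_point_in_interval[OF ae, of "max v 0" t] \<open>0 < t\<close> by auto
    then have "0 < u" by simp
    then have "cover_mass \<Lambda> X Z (\<lambda>p. \<not> C p) u = ennreal (1 - g u)"
      using u g(2) by (intro covers_complement one) (auto simp: r_def)
    also have "\<dots> \<le> ennreal (1 - g t)" using u \<open>0 < u\<close> by (intro ennreal_leI) (auto intro: g)
    finally show "\<exists>u. v < u \<and> u < t \<and> cover_mass \<Lambda> X Z (\<lambda>p. \<not> C p) u \<le> ennreal (1 - g t)"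
      using u by auto
  qed (use no_start \<open>0 < t\<close> in auto)
  then have "ennreal (1 - c) \<le> ennreal (1 - g t)"
    using covers_complement[OF assms(2-4) one[OF \<open>0 < t\<close>] c[unfolded r_def]] by simp
  then have "g t \<le> c"
    using g(3)[OF \<open>0 < t\<close>] by (auto simp: ennreal_le_iff2)
  moreover have "c \<le> g t" using upper c g(2)[OF \<open>0 < t\<close>] by simp
  ultimately show ?thesis using c unfolding r_def by simp
qed

text \<open>The same semicontinuity, now for a function that equals the mass everywhere: it cannot jump
  down at \<open>t\<close> on either side.\<close>

lemma antimono_covers_continuous:
  fixes g :: "real \<Rightarrow> real"
  assumes [measurable]: "X \<in> borel_measurable \<Lambda>" "Z \<in> borel_measurable \<Lambda>" "Measurable.pred \<Lambda> C"
    and one: "\<And>t. 0 < t \<Longrightarrow> emeasure \<Lambda> {p \<in> space \<Lambda>. covers X Z t p} = 1"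
    and no_start: "\<And>t. 0 < t \<Longrightarrow> emeasure \<Lambda> {p \<in> space \<Lambda>. X p = t \<and> 0 < Z p} = 0"
    and g: "\<And>t. 0 < t \<Longrightarrow> 0 \<le> g t" "\<And>t. 0 < t \<Longrightarrow> g t \<le> 1"
    and eq: "\<And>t. 0 < t \<Longrightarrow> ennreal (g t) = cover_mass \<Lambda> X Z C t"
    and "0 < t"
  shows "(\<And>u. t < u \<Longrightarrow> g u \<le> b) \<Longrightarrow> g t \<le> b"
    and "(\<And>u. 0 < u \<Longrightarrow> u < t \<Longrightarrow> b \<le> g u) \<Longrightarrow> b \<le> g t"
proof -
  assume b: "\<And>u. t < u \<Longrightarrow> g u \<le> b"
  have "ennreal (g t) \<le> ennreal b"
    unfolding eq[OF \<open>0 < t\<close>]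
  proof (rule covers_le_from_right)
    fix v assume "t < v"
    then obtain u where u: "t < u" "u < v" using dense by blast
    then show "\<exists>u. t < u \<and> u < v \<and> cover_mass \<Lambda> X Z C u \<le> ennreal b"
      using b[of u] \<open>0 < t\<close> by (intro exI[of _ u]) (auto simp: eq[symmetric] ennreal_leI)
  qed auto
  moreover have "0 \<le> b" using b[of "t + 1"] g(1)[of "t + 1"] \<open>0 < t\<close> by linarith
  ultimately show "g t \<le> b" by simp
next
  assume b: "\<And>u. 0 < u \<Longrightarrow> u < t \<Longrightarrow> b \<le> g u"
  have "ennreal (1 - g t) = cover_mass \<Lambda> X Z (\<lambda>p. \<not> C p) t"
    using eq[OF \<open>0 < t\<close>] g \<open>0 < t\<close> by (intro covers_complement[symmetric] one) auto
  also have "\<dots> \<le> ennreal (1 - b)"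
  proof (rule covers_le_from_left)
    fix v assume "v < t"
    then obtain u where u: "max v 0 < u" "u < t" using dense[of "max v 0" t] \<open>0 < t\<close> by auto
    then have "0 < u" by simp
    then have "cover_mass \<Lambda> X Z (\<lambda>p. \<not> C p) u = ennreal (1 - g u)"
      using eq g by (intro covers_complement one) auto
    also have "\<dots> \<le> ennreal (1 - b)" using b[OF \<open>0 < u\<close> u(2)] by (intro ennreal_leI) auto
    finally show "\<exists>u. v < u \<and> u < t \<and> cover_mass \<Lambda> X Z (\<lambda>p. \<not> C p) u \<le> ennreal (1 - b)"
      using u by auto
  qed (use no_start \<open>0 < t\<close> in auto)
  finally show "b \<le> g t"
    using g(2)[OF \<open>0 < t\<close>] b[of "t / 2"] g(2)[of "t / 2"] \<open>0 < t\<close> by (auto simp: ennreal_le_iff2)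
qed

section \<open>Sum-max processes\<close>

lemma (in prob_space) expectation_level_limit:
  fixes f Y :: "'a \<Rightarrow> real"
  assumes [measurable]: "f \<in> borel_measurable M" "Y \<in> borel_measurable M"
    and bound: "AE \<omega> in M. \<bar>f \<omega>\<bar> \<le> 1"
  shows "(\<lambda>j. expectation (\<lambda>\<omega>. f \<omega> * indicator {..real j} (Y \<omega>))) \<longlonglongrightarrow> expectation f"
proof (rule integral_dominated_convergence[where w = "\<lambda>_. 1"])
  show "AE \<omega> in M. (\<lambda>j. f \<omega> * indicator {..real j} (Y \<omega>)) \<longlonglongrightarrow> f \<omega>"
  proof (intro AE_I2 tendsto_eventually)
    fix \<omega>
    show "\<forall>\<^sub>F j in sequentially. f \<omega> * indicator {..real j} (Y \<omega>) = f \<omega>"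
      using eventually_ge_at_top[of "nat \<lceil>Y \<omega>\<rceil>"]
      by eventually_elim (auto split: split_indicator simp: nat_le_iff ceiling_le_iff)
  qed
  show "AE \<omega> in M. norm (f \<omega> * indicator {..real j} (Y \<omega>)) \<le> 1" for j
    using bound by eventually_elim (auto split: split_indicator)
qed auto

definition laplace_D :: "(real \<times> real) measure \<Rightarrow> real \<Rightarrow> real" where
  "laplace_D \<rho> s = (\<integral>p. exp (- s * fst p) \<partial>\<rho>)"

definition monotone_path :: "(real \<Rightarrow> real) \<Rightarrow> bool" where
  "monotone_path f \<longleftrightarrow> (\<forall>u t. 0 < u \<longrightarrow> u \<le> t \<longrightarrow> f u \<le> f t)"

text \<open>Monotonicity can only be read off the finite-dimensional laws for countably many pairs of times;
  right continuity extends it to all times.\<close>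

lemma monotone_path_if_monotone_on_rationals:
  fixes f :: "real \<Rightarrow> real"
  assumes mono: "\<And>u t. u \<in> \<rat> \<Longrightarrow> t \<in> \<rat> \<Longrightarrow> 0 < u \<Longrightarrow> u < t \<Longrightarrow> f u \<le> f t"
    and cont: "\<And>t. 0 < t \<Longrightarrow> (f \<longlongrightarrow> f t) (at_right t)"
  shows "monotone_path f"
  unfolding monotone_path_def
proof (intro allI impI, rule ccontr)
  fix u t :: real assume ut: "0 < u" "u \<le> t" and "\<not> f u \<le> f t"
  then have less: "f t < f u" "u < t" by (auto simp: less_le)
  define c where "c = (f t + f u) / 2"
  have "eventually (\<lambda>r. c < f r) (at_right u)" "eventually (\<lambda>r. f r < c) (at_right t)"
    using order_tendstoD(1)[OF cont[of u], of c] order_tendstoD(2)[OF cont[of t], of c] ut less by (auto simp: c_def)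
  then obtain u' t' where u': "u < u'" "\<And>r. u < r \<Longrightarrow> r < u' \<Longrightarrow> c < f r"
      and t': "t < t'" "\<And>r. t < r \<Longrightarrow> r < t' \<Longrightarrow> f r < c"
    unfolding eventually_at_right_field by auto
  obtain p where p: "p \<in> \<rat>" "u < p" "p < min u' t" using Rats_dense_in_real[of u "min u' t"] u' less by auto
  obtain q where q: "q \<in> \<rat>" "t < q" "q < t'" using Rats_dense_in_real[of t t'] t' by auto
  have "f p \<le> f q" using p q ut less by (intro mono) auto
  moreover have "c < f p" "f q < c" using p q u' t' by auto
  ultimately show False by simp
qed

locale sum_max_setting = prob_space N for N :: "'c measure" +
  fixes \<rho> :: "(real \<times> real) measure" and D A :: "real \<Rightarrow> 'c \<Rightarrow> real"
  assumes prob_rho: "prob_space \<rho>" and sets_rho: "sets \<rho> = sets borel"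
    and rho_nonneg: "AE p in \<rho>. 0 \<le> fst p"
    and process: "sum_max_process N \<rho> D A"
begin

sublocale rho: prob_space \<rho> by (rule prob_rho)

lemma measurable_D [measurable]: "0 < t \<Longrightarrow> D t \<in> borel_measurable N"
  and measurable_A [measurable]: "0 < t \<Longrightarrow> A t \<in> borel_measurable N"
  using process by (auto simp: sum_max_process_def)

lemma D_nonneg: "0 < t \<Longrightarrow> \<omega> \<in> space N \<Longrightarrow> 0 \<le> D t \<omega>"
  using process by (auto simp: sum_max_process_def)

lemma path_cadlag: "\<omega> \<in> space N \<Longrightarrow> cadlag (\<lambda>t. (D t \<omega>, A t \<omega>))"
  using process by (auto simp: sum_max_process_def)

lemma D_right_continuous: "\<omega> \<in> space N \<Longrightarrow> 0 < t \<Longrightarrow> ((\<lambda>t. D t \<omega>) \<longlongrightarrow> D t \<omega>) (at_right t)"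
  using tendsto_fst[of "\<lambda>t. (D t \<omega>, A t \<omega>)"] path_cadlag[of \<omega>] unfolding cadlag_def by fastforce

lemma A_right_continuous: "\<omega> \<in> space N \<Longrightarrow> 0 < t \<Longrightarrow> ((\<lambda>t. A t \<omega>) \<longlongrightarrow> A t \<omega>) (at_right t)"
  using tendsto_snd[of "\<lambda>t. (D t \<omega>, A t \<omega>)"] path_cadlag[of \<omega>] unfolding cadlag_def by fastforce

subsection \<open>Transforms\<close>

lemma CL_eq: "CL_transform \<rho> s y = (\<integral>p. exp (- s * fst p) * indicator {..y} (snd p) \<partial>\<rho>)"
  by (simp add: CL_transform_def case_prod_beta')

lemma measurable_rho_fst_snd [measurable]:
  "fst \<in> borel_measurable \<rho>" "snd \<in> borel_measurable \<rho>"
  by (simp_all add: measurable_cong_sets[OF sets_rho refl] borel_prod[symmetric])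

lemma AE_rho_bound: "0 \<le> s \<Longrightarrow> AE p in \<rho>. norm (exp (- s * fst p) * indicator B (snd p)) \<le> 1"
  using rho_nonneg by eventually_elim (auto split: split_indicator)

lemma integrable_rho: "0 \<le> s \<Longrightarrow> integrable \<rho> (\<lambda>p. exp (- s * fst p))"
  using AE_rho_bound[of s UNIV] by (intro rho.integrable_const_bound[where B = 1]) auto

lemma laplace_D_pos: "0 \<le> s \<Longrightarrow> 0 < laplace_D \<rho> s"
proof -
  assume s: "0 \<le> s"
  have "0 \<le> laplace_D \<rho> s" unfolding laplace_D_def by (rule integral_nonneg_AE) auto
  moreover have "laplace_D \<rho> s \<noteq> 0"
  proof
    assume "laplace_D \<rho> s = 0"
    then have "AE p in \<rho>. exp (- s * fst p) = 0"
      unfolding laplace_D_def by (subst (asm) integral_nonneg_eq_0_iff_AE[OF integrable_rho[OF s]]) auto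
    then show False by simp
  qed
  ultimately show ?thesis by simp
qed

lemma CL_tendsto_laplace_D:
  assumes "0 \<le> s"
  shows "(\<lambda>j. CL_transform \<rho> s (real j)) \<longlonglongrightarrow> laplace_D \<rho> s"
  unfolding CL_eq laplace_D_def using AE_rho_bound[OF assms, of UNIV]
  by (intro rho.expectation_level_limit) auto

lemma CL_right_continuous:
  assumes "0 \<le> s"
  shows "(\<lambda>j. CL_transform \<rho> s (y + 1 / real (Suc j))) \<longlonglongrightarrow> CL_transform \<rho> s y"
  unfolding CL_eq
proof (rule integral_dominated_convergence[where w = "\<lambda>_. 1"])
  show "AE p in \<rho>. (\<lambda>j. exp (- s * fst p) * indicator {..y + 1 / real (Suc j)} (snd p)) \<longlonglongrightarrow> exp (- s * fst p) * indicator {..y} (snd p)"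
  proof (intro AE_I2 tendsto_eventually)
    fix p :: "real \<times> real"
    show "\<forall>\<^sub>F j in sequentially. exp (- s * fst p) * indicator {..y + 1 / real (Suc j)} (snd p) = exp (- s * fst p) * indicator {..y} (snd p)"
    proof (cases "snd p \<le> y")
      case True
      then show ?thesis by (intro always_eventually) (auto split: split_indicator intro: order_trans)
    next
      case False
      then have "0 < snd p - y" by simp
      from order_tendstoD(2)[OF LIMSEQ_inverse_real_of_nat this]
      show ?thesis by eventually_elim (use False in \<open>auto split: split_indicator simp: inverse_eq_divide\<close>)
    qed
  qed
qed (use AE_rho_bound[OF assms] in auto)

lemmas process_transform =
  conjunct2[OF conjunct2[OF conjunct2[OF process[unfolded sum_max_process_def]]], rule_format]

lemma transform_1:
  assumes "0 < t" "0 \<le> s"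
  shows "(\<integral>\<omega>. exp (- (s * D t \<omega>)) * indicator {\<omega>. A t \<omega> \<le> y} \<omega> \<partial>N) = CL_transform \<rho> s y powr t"
  using process_transform[of 1 "\<lambda>j. if j = 0 then 0 else t" "\<lambda>_. s" "\<lambda>_. y"] assms by simp

lemma transform_2:
  assumes "0 < u" "u < t" "0 \<le> s1" "0 \<le> s2"
  shows "(\<integral>\<omega>. exp (- (s1 * D u \<omega> + s2 * D t \<omega>)) * indicator {\<omega>. A u \<omega> \<le> y1 \<and> A t \<omega> \<le> y2} \<omega> \<partial>N)
    = CL_transform \<rho> (s1 + s2) (min y1 y2) powr u * CL_transform \<rho> s2 y2 powr (t - u)"
proof -
  note * = process_transform[of 2 "\<lambda>j. if j = 0 then 0 else if j = 1 then u else t"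
      "\<lambda>j. if j = 1 then s1 else s2" "\<lambda>j. if j = 1 then y1 else y2"]
  have 12: "{Suc 0..2} = {Suc 0, 2}" by auto
  have less2: "(\<forall>j<2. P j) \<longleftrightarrow> P 0 \<and> P (1::nat)" for P by (auto simp: less_2_cases_iff)
  show ?thesis using * assms by (simp add: 12 less2 min_def)
qed

lemma AE_N_bound:
  assumes "0 < t" "0 \<le> s" "0 < u" "0 \<le> s'"
  shows "AE \<omega> in N. norm (exp (- (s' * D u \<omega> + s * D t \<omega>)) * indicator (B \<omega>) \<omega>) \<le> 1"
proof (rule AE_I2)
  fix \<omega> assume "\<omega> \<in> space N"
  then have "0 \<le> s' * D u \<omega> + s * D t \<omega>" using D_nonneg assms by simp
  then show "norm (exp (- (s' * D u \<omega> + s * D t \<omega>)) * indicator (B \<omega>) \<omega>) \<le> 1"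
    by (auto split: split_indicator)
qed

text \<open>The transforms of the process constrain \<open>A\<close> at every time that occurs; letting the second level tend to
  infinity removes one of the constraints.\<close>

lemma transform_2_marginal:
  assumes "0 < u" "u < t" "0 \<le> s1" "0 \<le> s2"
  shows "(\<integral>\<omega>. exp (- (s1 * D u \<omega> + s2 * D t \<omega>)) * indicator {\<omega>. A u \<omega> \<le> y} \<omega> \<partial>N)
    = CL_transform \<rho> (s1 + s2) y powr u * laplace_D \<rho> s2 powr (t - u)"
proof (rule LIMSEQ_unique)
  note [measurable] = measurable_D[OF assms(1)] measurable_A[OF assms(1)]
    measurable_D[OF order.strict_trans[OF assms(1,2)]] measurable_A[OF order.strict_trans[OF assms(1,2)]]
  have "(\<lambda>j. CL_transform \<rho> (s1 + s2) (min y (real j)) powr u * CL_transform \<rho> s2 (real j) powr (t - u))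
      \<longlonglongrightarrow> CL_transform \<rho> (s1 + s2) y powr u * laplace_D \<rho> s2 powr (t - u)"
  proof (rule tendsto_mult)
    have "\<forall>\<^sub>F j in sequentially. CL_transform \<rho> (s1 + s2) (min y (real j)) powr u = CL_transform \<rho> (s1 + s2) y powr u"
      using eventually_ge_at_top[of "nat \<lceil>y\<rceil>"]
      by eventually_elim (auto simp: nat_le_iff ceiling_le_iff min_def)
    then show "(\<lambda>j. CL_transform \<rho> (s1 + s2) (min y (real j)) powr u) \<longlonglongrightarrow> CL_transform \<rho> (s1 + s2) y powr u"
      by (rule tendsto_eventually)
    show "(\<lambda>j. CL_transform \<rho> s2 (real j) powr (t - u)) \<longlonglongrightarrow> laplace_D \<rho> s2 powr (t - u)"
      using laplace_D_pos[OF assms(4)] by (intro tendsto_powr CL_tendsto_laplace_D assms tendsto_const) auto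
  qed
  moreover have "CL_transform \<rho> (s1 + s2) (min y (real j)) powr u * CL_transform \<rho> s2 (real j) powr (t - u)
      = (\<integral>\<omega>. (exp (- (s1 * D u \<omega> + s2 * D t \<omega>)) * indicator {\<omega>. A u \<omega> \<le> y} \<omega>) * indicator {..real j} (A t \<omega>) \<partial>N)" for j
    unfolding transform_2[OF assms, symmetric]
    by (intro Bochner_Integration.integral_cong) (auto split: split_indicator)
  ultimately show "(\<lambda>j. \<integral>\<omega>. (exp (- (s1 * D u \<omega> + s2 * D t \<omega>)) * indicator {\<omega>. A u \<omega> \<le> y} \<omega>) * indicator {..real j} (A t \<omega>) \<partial>N)
      \<longlonglongrightarrow> CL_transform \<rho> (s1 + s2) y powr u * laplace_D \<rho> s2 powr (t - u)"
    by simp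
  show "(\<lambda>j. \<integral>\<omega>. (exp (- (s1 * D u \<omega> + s2 * D t \<omega>)) * indicator {\<omega>. A u \<omega> \<le> y} \<omega>) * indicator {..real j} (A t \<omega>) \<partial>N)
      \<longlonglongrightarrow> (\<integral>\<omega>. exp (- (s1 * D u \<omega> + s2 * D t \<omega>)) * indicator {\<omega>. A u \<omega> \<le> y} \<omega> \<partial>N)"
    using AE_N_bound[of t s2 u s1 "\<lambda>_. {\<omega>. A u \<omega> \<le> y}"] assms by (intro expectation_level_limit) auto
qed

lemma transform_D_2:
  assumes "0 < u" "u < t" "0 \<le> s1" "0 \<le> s2"
  shows "(\<integral>\<omega>. exp (- (s1 * D u \<omega> + s2 * D t \<omega>)) \<partial>N)
    = laplace_D \<rho> (s1 + s2) powr u * laplace_D \<rho> s2 powr (t - u)"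
proof (rule LIMSEQ_unique)
  note [measurable] = measurable_D[OF assms(1)] measurable_A[OF assms(1)]
    measurable_D[OF order.strict_trans[OF assms(1,2)]]
  have "(\<lambda>j. CL_transform \<rho> (s1 + s2) (real j) powr u * laplace_D \<rho> s2 powr (t - u))
      \<longlonglongrightarrow> laplace_D \<rho> (s1 + s2) powr u * laplace_D \<rho> s2 powr (t - u)"
    using laplace_D_pos[of "s1 + s2"] assms
    by (intro tendsto_mult tendsto_powr CL_tendsto_laplace_D tendsto_const) auto
  moreover have "CL_transform \<rho> (s1 + s2) (real j) powr u * laplace_D \<rho> s2 powr (t - u)
      = (\<integral>\<omega>. exp (- (s1 * D u \<omega> + s2 * D t \<omega>)) * indicator {..real j} (A u \<omega>) \<partial>N)" for j
    unfolding transform_2_marginal[OF assms, symmetric]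
    by (intro Bochner_Integration.integral_cong) (auto split: split_indicator)
  ultimately show "(\<lambda>j. \<integral>\<omega>. exp (- (s1 * D u \<omega> + s2 * D t \<omega>)) * indicator {..real j} (A u \<omega>) \<partial>N)
      \<longlonglongrightarrow> laplace_D \<rho> (s1 + s2) powr u * laplace_D \<rho> s2 powr (t - u)"
    by simp
  show "(\<lambda>j. \<integral>\<omega>. exp (- (s1 * D u \<omega> + s2 * D t \<omega>)) * indicator {..real j} (A u \<omega>) \<partial>N)
      \<longlonglongrightarrow> (\<integral>\<omega>. exp (- (s1 * D u \<omega> + s2 * D t \<omega>)) \<partial>N)"
    using AE_N_bound[of t s2 u s1 "\<lambda>_. UNIV"] assms by (intro expectation_level_limit) auto
qed

lemma transform_D_1:
  assumes "0 < t" "0 \<le> s"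
  shows "(\<integral>\<omega>. exp (- (s * D t \<omega>)) \<partial>N) = laplace_D \<rho> s powr t"
  using transform_D_2[of "t / 2" t 0 s] assms laplace_D_pos[of s]
  by (simp add: powr_add[symmetric])

lemma prob_A_le:
  assumes "0 < t"
  shows "prob {\<omega> \<in> space N. A t \<omega> \<le> y} = CL_transform \<rho> 0 y powr t"
proof -
  note [measurable] = measurable_A[OF assms]
  have "prob {\<omega> \<in> space N. A t \<omega> \<le> y} = (\<integral>\<omega>. indicator {\<omega> \<in> space N. A t \<omega> \<le> y} \<omega> \<partial>N)"
    by simp
  also have "\<dots> = (\<integral>\<omega>. exp (- (0 * D t \<omega>)) * indicator {\<omega>. A t \<omega> \<le> y} \<omega> \<partial>N)"
    by (intro Bochner_Integration.integral_cong) (auto split: split_indicator)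
  finally show ?thesis using assms by (subst (asm) transform_1) auto
qed

subsection \<open>Monotone paths\<close>

text \<open>For each level \<open>y\<close> the events \<open>{A(u) \<le> y, A(t) \<le> y}\<close> and \<open>{A(t) \<le> y}\<close> have the same
  probability, since \<open>F(y)\<^bsup>u\<^esup> F(y)\<^bsup>t-u\<^esup> = F(y)\<^bsup>t\<^esup>\<close>.\<close>

lemma AE_A_mono:
  assumes "0 < u" "u < t"
  shows "AE \<omega> in N. A u \<omega> \<le> A t \<omega>"
proof -
  have [simp]: "0 < t" using assms by simp
  note [measurable] = measurable_A[OF assms(1)] measurable_A[OF \<open>0 < t\<close>]
  have "AE \<omega> in N. A t \<omega> \<le> y \<longrightarrow> A u \<omega> \<le> y" for y
  proof -
    let ?B = "{\<omega> \<in> space N. A t \<omega> \<le> y}" and ?C = "{\<omega> \<in> space N. A u \<omega> \<le> y \<and> A t \<omega> \<le> y}"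
    have "prob ?C = (\<integral>\<omega>. indicator ?C \<omega> \<partial>N)" by simp
    also have "\<dots> = (\<integral>\<omega>. exp (- (0 * D u \<omega> + 0 * D t \<omega>)) * indicator {\<omega>. A u \<omega> \<le> y \<and> A t \<omega> \<le> y} \<omega> \<partial>N)"
      by (intro Bochner_Integration.integral_cong) (auto split: split_indicator)
    also have "\<dots> = prob ?B"
      unfolding prob_A_le[OF \<open>0 < t\<close>] using assms by (subst transform_2) (auto simp: powr_add[symmetric])
    finally have "prob (?B - ?C) = 0"
      by (subst finite_measure_Diff) auto
    then have null: "emeasure N (?B - ?C) = 0" by (simp add: emeasure_eq_measure)
    show ?thesis
      by (subst AE_iff_measurable[where N = "?B - ?C"]) (use null in auto)
  qed
  then have "AE \<omega> in N. \<forall>y\<in>\<rat>. A t \<omega> \<le> y \<longrightarrow> A u \<omega> \<le> y"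
    by (simp add: AE_ball_countable countable_rat)
  then show ?thesis
  proof eventually_elim
    case (elim \<omega>)
    show ?case
    proof (rule ccontr)
      assume "\<not> ?thesis"
      then obtain y where "y \<in> \<rat>" "A t \<omega> < y" "y < A u \<omega>" using Rats_dense_in_real[of "A t \<omega>" "A u \<omega>"] by auto
      with elim show False by fastforce
    qed
  qed
qed

lemma nn_transform_bounded:
  assumes "f \<in> borel_measurable N" "\<And>\<omega>. \<omega> \<in> space N \<Longrightarrow> 0 \<le> f \<omega> \<and> f \<omega> \<le> 1"
  shows "(\<integral>\<^sup>+\<omega>. ennreal (f \<omega>) \<partial>N) = ennreal (\<integral>\<omega>. f \<omega> \<partial>N)"
  using assms by (intro nn_integral_eq_integral integrable_const_bound[where B = 1]) auto

text \<open>Independence of increments, with a weight on the later value. As measures in \<open>D(u)\<close>, both sides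
  have the Laplace transform \<open>\<xi> \<mapsto> L(\<xi> + s)\<^bsup>u\<^esup> L(s)\<^bsup>t-u\<^esup>\<close>, where \<open>L\<close> is the transform of \<open>D\<close> under \<open>\<rho>\<close>.\<close>

lemma exp_D_tilt:
  assumes "0 < u" "u < t" "0 \<le> s" and [measurable]: "B \<in> sets borel"
  shows "(\<integral>\<^sup>+\<omega>. ennreal (exp (- (s * D t \<omega>))) * indicator (D u -` B \<inter> space N) \<omega> \<partial>N)
    = laplace_D \<rho> s powr (t - u) * (\<integral>\<^sup>+\<omega>. ennreal (exp (- (s * D u \<omega>))) * indicator (D u -` B \<inter> space N) \<omega> \<partial>N)"
proof -
  have [simp]: "0 < t" using assms by simp
  note [measurable] = measurable_D[OF assms(1)] measurable_D[OF \<open>0 < t\<close>]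
  define c where "c = laplace_D \<rho> s powr (t - u)"
  define P where "P = distr (density N (\<lambda>\<omega>. ennreal (exp (- (s * D t \<omega>))))) borel (D u)"
  define Q where "Q = distr (density N (\<lambda>\<omega>. c * ennreal (exp (- (s * D u \<omega>))))) borel (D u)"
  have int_P: "(\<integral>\<^sup>+x. exp (- \<xi> * x) \<partial>P) = ennreal (laplace_D \<rho> (\<xi> + s) powr u * c)" if "0 < \<xi>" for \<xi>
  proof -
    have "(\<integral>\<^sup>+x. exp (- \<xi> * x) \<partial>P) = (\<integral>\<^sup>+\<omega>. ennreal (exp (- (\<xi> * D u \<omega> + s * D t \<omega>))) \<partial>N)"
      unfolding P_def by (subst nn_integral_distr, simp, simp, subst nn_integral_density)
        (auto simp: ennreal_mult[symmetric] exp_add[symmetric] algebra_simps)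
    also have "\<dots> = ennreal (\<integral>\<omega>. exp (- (\<xi> * D u \<omega> + s * D t \<omega>)) \<partial>N)"
    proof (intro nn_transform_bounded)
      fix \<omega> assume "\<omega> \<in> space N"
      then have "0 \<le> \<xi> * D u \<omega> + s * D t \<omega>" using that D_nonneg assms by simp
      then show "0 \<le> exp (- (\<xi> * D u \<omega> + s * D t \<omega>)) \<and> exp (- (\<xi> * D u \<omega> + s * D t \<omega>)) \<le> 1" by simp
    qed simp
    also have "\<dots> = ennreal (laplace_D \<rho> (\<xi> + s) powr u * c)"
      using assms that unfolding c_def by (subst transform_D_2) auto
    finally show ?thesis .
  qed
  have int_Q: "(\<integral>\<^sup>+x. exp (- \<xi> * x) \<partial>Q) = ennreal (laplace_D \<rho> (\<xi> + s) powr u * c)" if "0 < \<xi>" for \<xi>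
  proof -
    have "(\<integral>\<^sup>+x. exp (- \<xi> * x) \<partial>Q) = (\<integral>\<^sup>+\<omega>. c * ennreal (exp (- ((\<xi> + s) * D u \<omega>))) \<partial>N)"
    proof -
      have "exp (- (s * x)) * exp (- \<xi> * x) = exp (- ((\<xi> + s) * x))" for x
        by (simp add: exp_add[symmetric] algebra_simps)
      then show ?thesis
        unfolding Q_def by (subst nn_integral_distr, simp, simp, subst nn_integral_density)
          (auto simp: mult.assoc ennreal_mult[symmetric] simp del: ennreal_mult'')
    qed
    also have "\<dots> = c * (\<integral>\<^sup>+\<omega>. ennreal (exp (- ((\<xi> + s) * D u \<omega>))) \<partial>N)"
      by (rule nn_integral_cmult) auto
    also have "\<dots> = c * ennreal (\<integral>\<omega>. exp (- ((\<xi> + s) * D u \<omega>)) \<partial>N)"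
      using that D_nonneg assms by (subst nn_transform_bounded) auto
    also have "\<dots> = ennreal (laplace_D \<rho> (\<xi> + s) powr u * c)"
      using assms that by (subst transform_D_1) (auto simp: c_def ennreal_mult[symmetric] mult.commute)
    finally show ?thesis .
  qed
  have "P = Q"
  proof (rule laplace_determines_measure)
    show "(\<integral>\<^sup>+x. exp (- x) \<partial>P) < \<infinity>" using int_P[of 1] by simp
    show "AE x in P. 0 \<le> x" "AE x in Q. 0 \<le> x"
      using D_nonneg assms unfolding P_def Q_def
      by (subst AE_distr_iff, simp, simp, subst AE_density, simp, intro AE_I2, simp)+
    show "(\<integral>\<^sup>+x. exp (- \<xi> * x) \<partial>P) = (\<integral>\<^sup>+x. exp (- \<xi> * x) \<partial>Q)" if "0 < \<xi>" for \<xi>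
      using int_P[OF that] int_Q[OF that] by simp
  qed (auto simp: P_def Q_def)
  then have "emeasure P B = emeasure Q B" by simp
  then show ?thesis
    unfolding P_def Q_def c_def
    by (simp add: emeasure_distr emeasure_density nn_integral_cmult mult.assoc)
qed

lemma laplace_D_le_1: "0 \<le> s \<Longrightarrow> laplace_D \<rho> s \<le> 1"
proof -
  assume s: "0 \<le> s"
  have "laplace_D \<rho> s \<le> (\<integral>p. 1 \<partial>\<rho>)"
    unfolding laplace_D_def using AE_rho_bound[OF s, of UNIV] s
    by (intro integral_mono_AE integrable_rho) auto
  then show ?thesis by (simp add: rho.prob_space)
qed

text \<open>For \<open>b < a\<close> Markov's inequality and the tilting formula bound the probability of
  \<open>{D(u) > a, D(t) \<le> b}\<close> by \<open>e\<^bsup>s(b - a)\<^esup>\<close> for every \<open>s \<ge> 0\<close>.\<close>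

lemma AE_D_mono:
  assumes "0 < u" "u < t"
  shows "AE \<omega> in N. D u \<omega> \<le> D t \<omega>"
proof -
  have [simp]: "0 < t" using assms by simp
  note [measurable] = measurable_D[OF assms(1)] measurable_D[OF \<open>0 < t\<close>]
  have null: "AE \<omega> in N. \<not> (a < D u \<omega> \<and> D t \<omega> \<le> b)" if "b < a" for a b
  proof -
    let ?B = "{\<omega> \<in> space N. a < D u \<omega> \<and> D t \<omega> \<le> b}" and ?U = "D u -` {a<..} \<inter> space N"
    have bound: "emeasure N ?B \<le> ennreal (exp (s * (b - a)))" if "0 \<le> s" for s
    proof -
      have "emeasure N ?B = (\<integral>\<^sup>+\<omega>. indicator ?B \<omega> \<partial>N)" by simp
      also have "\<dots> \<le> (\<integral>\<^sup>+\<omega>. ennreal (exp (s * b)) * (ennreal (exp (- (s * D t \<omega>))) * indicator ?U \<omega>) \<partial>N)"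
        using that by (intro nn_integral_mono)
          (auto split: split_indicator simp: ennreal_mult[symmetric] exp_add[symmetric] mult_left_mono)
      also have "\<dots> = ennreal (exp (s * b)) * (laplace_D \<rho> s powr (t - u) * (\<integral>\<^sup>+\<omega>. ennreal (exp (- (s * D u \<omega>))) * indicator ?U \<omega> \<partial>N))"
        using assms that by (subst nn_integral_cmult) (auto simp: exp_D_tilt)
      also have "\<dots> \<le> ennreal (exp (s * b)) * (1 * (\<integral>\<^sup>+\<omega>. ennreal (exp (- (s * a))) \<partial>N))"
      proof (intro mult_left_mono mult_mono nn_integral_mono)
        have "laplace_D \<rho> s powr (t - u) \<le> 1"
          using laplace_D_le_1[OF that] laplace_D_pos[OF that] assms by (intro powr_le1) auto
        then show "ennreal (laplace_D \<rho> s powr (t - u)) \<le> 1" by simp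
        show "ennreal (exp (- (s * D u \<omega>))) * indicator ?U \<omega> \<le> ennreal (exp (- (s * a)))" for \<omega>
          using that by (auto split: split_indicator simp: mult_left_mono)
      qed auto
      also have "\<dots> = ennreal (exp (s * (b - a)))"
        by (simp add: emeasure_space_1 ennreal_mult[symmetric] exp_add[symmetric] algebra_simps)
      finally show ?thesis .
    qed
    have "((\<lambda>s. ennreal (exp (s * (b - a)))) \<longlongrightarrow> ennreal 0) at_top"
    proof (rule tendsto_ennrealI)
      have "b - a < 0" using that by simp
      then show "((\<lambda>s. exp (s * (b - a))) \<longlongrightarrow> 0) at_top"
        by real_asymp
    qed
    then have "emeasure N ?B \<le> ennreal 0"
      using bound by (intro tendsto_lowerbound[where F = at_top])
        (auto intro: eventually_mono[OF eventually_ge_at_top[of 0]])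
    then show ?thesis by (subst AE_iff_measurable[OF _ refl]) auto
  qed
  have "AE \<omega> in N. \<forall>a\<in>\<rat>. \<forall>b\<in>\<rat>. b < a \<longrightarrow> \<not> (a < D u \<omega> \<and> D t \<omega> \<le> b)"
    using null by (auto simp: AE_ball_countable countable_rat)
  then show ?thesis
  proof eventually_elim
    case (elim \<omega>)
    show ?case
    proof (rule ccontr)
      assume "\<not> ?thesis"
      then obtain b where b: "b \<in> \<rat>" "D t \<omega> < b" "b < D u \<omega>" using Rats_dense_in_real[of "D t \<omega>" "D u \<omega>"] by auto
      then obtain a where "a \<in> \<rat>" "b < a" "a < D u \<omega>" using Rats_dense_in_real[of b "D u \<omega>"] by auto
      with elim b show False by force
    qed
  qed
qed

lemma AE_monotone_path:
  assumes "\<And>u t. 0 < u \<Longrightarrow> u < t \<Longrightarrow> AE \<omega> in N. X u \<omega> \<le> X t \<omega>"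
    and "\<And>\<omega> t. \<omega> \<in> space N \<Longrightarrow> 0 < t \<Longrightarrow> ((\<lambda>t. X t \<omega>) \<longlongrightarrow> (X t \<omega> :: real)) (at_right t)"
  shows "AE \<omega> in N. monotone_path (\<lambda>t. X t \<omega>)"
proof -
  have "AE \<omega> in N. \<forall>u\<in>\<rat>. \<forall>t\<in>\<rat>. 0 < u \<longrightarrow> u < t \<longrightarrow> X u \<omega> \<le> X t \<omega>"
    using assms(1) by (simp add: AE_ball_countable countable_rat)
  with AE_space show ?thesis
    by eventually_elim (auto intro!: monotone_path_if_monotone_on_rationals assms(2))
qed

lemma AE_monotone_D: "AE \<omega> in N. monotone_path (\<lambda>t. D t \<omega>)"
  by (intro AE_monotone_path AE_D_mono D_right_continuous)

lemma AE_monotone_A: "AE \<omega> in N. monotone_path (\<lambda>t. A t \<omega>)"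
  by (intro AE_monotone_path AE_A_mono A_right_continuous)

lemma AE_D_unbounded:
  assumes "laplace_D \<rho> 1 < 1"
  shows "AE \<omega> in N. \<forall>t. \<exists>k. t < D (real (Suc k)) \<omega>"
proof -
  have null: "AE \<omega> in N. \<exists>k. real j < D (real (Suc k)) \<omega>" for j :: nat
  proof -
    let ?B = "{\<omega> \<in> space N. \<forall>k. D (real (Suc k)) \<omega> \<le> real j}"
    have bound: "emeasure N ?B \<le> ennreal (exp j * laplace_D \<rho> 1 ^ Suc k)" for k
    proof -
      have "emeasure N ?B = (\<integral>\<^sup>+\<omega>. indicator ?B \<omega> \<partial>N)" by simp
      also have "\<dots> \<le> (\<integral>\<^sup>+\<omega>. ennreal (exp j) * (ennreal (exp (- (1 * D (real (Suc k)) \<omega>)))) \<partial>N)"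
        by (intro nn_integral_mono)
          (auto split: split_indicator simp del: of_nat_Suc simp: ennreal_mult[symmetric] exp_add[symmetric] mult_left_mono)
      also have "\<dots> = ennreal (exp j) * (\<integral>\<^sup>+\<omega>. ennreal (exp (- (1 * D (real (Suc k)) \<omega>))) \<partial>N)"
        by (rule nn_integral_cmult) simp
      also have "(\<integral>\<^sup>+\<omega>. ennreal (exp (- (1 * D (real (Suc k)) \<omega>))) \<partial>N) = ennreal (laplace_D \<rho> 1 powr real (Suc k))"
        by (subst nn_transform_bounded, simp, use D_nonneg in simp, subst transform_D_1) auto
      finally show ?thesis using laplace_D_pos[of 1]
        by (simp add: ennreal_mult[symmetric] powr_realpow[symmetric] del: of_nat_Suc power_Suc)
    qed
    have lim: "(\<lambda>k. exp j * laplace_D \<rho> 1 ^ Suc k) \<longlonglongrightarrow> 0"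
      using laplace_D_pos[of 1] assms by (intro tendsto_mult_right_zero LIMSEQ_Suc LIMSEQ_realpow_zero) auto
    have "emeasure N ?B \<le> ennreal 0"
      by (rule LIMSEQ_le_const[OF tendsto_ennrealI[OF lim]]) (intro exI allI impI bound)
    then show ?thesis by (subst AE_iff_measurable[OF _ refl]) (auto simp: not_less)
  qed
  then have "AE \<omega> in N. \<forall>j. \<exists>k. real j < D (real (Suc k)) \<omega>"
    by (simp add: AE_all_countable)
  then show ?thesis
    by eventually_elim (meson order.strict_trans2 less_imp_le reals_Archimedean2 order.strict_trans)
qed

lemma AE_D_small:
  shows "AE \<omega> in N. \<forall>t>0. \<exists>n. D (1 / 2 ^ n) \<omega> < t"
proof -
  have null: "AE \<omega> in N. \<exists>n. D (1 / 2 ^ n) \<omega> < 1 / real (Suc j)" for j :: nat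
  proof -
    define c where "c = 1 - exp (- (1 / real (Suc j)))"
    have c: "0 < c" by (simp add: c_def)
    let ?B = "{\<omega> \<in> space N. \<forall>n. 1 / real (Suc j) \<le> D (1 / 2 ^ n) \<omega>}"
    have bound: "prob ?B * c \<le> 1 - laplace_D \<rho> 1 powr (1 / 2 ^ n)" for n
    proof -
      have int: "integrable N (\<lambda>\<omega>. exp (- (1 * D (1 / 2 ^ n) \<omega>)))"
        using D_nonneg by (intro integrable_const_bound[where B = 1]) auto
      have int_B: "integrable N (\<lambda>\<omega>. indicator ?B \<omega> * c)"
        by (intro integrable_mult_left integrable_real_indicator) (auto simp: emeasure_eq_measure)
      have "prob ?B * c = (\<integral>\<omega>. indicator ?B \<omega> * c \<partial>N)" by simp
      also have "\<dots> \<le> (\<integral>\<omega>. 1 - exp (- (1 * D (1 / 2 ^ n) \<omega>)) \<partial>N)"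
      proof (rule integral_mono[OF int_B])
        show "integrable N (\<lambda>\<omega>. 1 - exp (- (1 * D (1 / 2 ^ n) \<omega>)))" using int by simp
        show "indicator ?B \<omega> * c \<le> 1 - exp (- (1 * D (1 / 2 ^ n) \<omega>))" if "\<omega> \<in> space N" for \<omega>
          using that D_nonneg[of "1 / 2 ^ n" \<omega>] by (auto split: split_indicator simp: c_def)
      qed
      also have "\<dots> = 1 - (\<integral>\<omega>. exp (- (1 * D (1 / 2 ^ n) \<omega>)) \<partial>N)"
        using int by (subst Bochner_Integration.integral_diff) (auto simp: prob_space)
      finally show ?thesis by (subst (asm) transform_D_1) auto
    qed
    have "(\<lambda>n. 1 - laplace_D \<rho> 1 powr (1 / 2 ^ n)) \<longlonglongrightarrow> 1 - laplace_D \<rho> 1 powr 0"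
    proof (intro tendsto_diff tendsto_const tendsto_powr)
      show "(\<lambda>n. 1 / 2 ^ n :: real) \<longlonglongrightarrow> 0"
        by real_asymp
      show "laplace_D \<rho> 1 \<noteq> 0" using laplace_D_pos[of 1] by simp
    qed
    then have "prob ?B * c \<le> 1 - laplace_D \<rho> 1 powr 0"
      using bound by (intro LIMSEQ_le_const) auto
    then have "prob ?B = 0" using c laplace_D_pos[of 1]
      by (simp add: mult_le_0_iff measure_le_0_iff)
    then have "emeasure N ?B = 0" by (simp add: emeasure_eq_measure)
    then show ?thesis by (subst AE_iff_measurable[OF _ refl]) (auto simp: not_less)
  qed
  then have "AE \<omega> in N. \<forall>j. \<exists>n. D (1 / 2 ^ n) \<omega> < 1 / real (Suc j)"
    by (simp add: AE_all_countable)
  then show ?thesis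
    by eventually_elim (meson nat_approx_posE order.strict_trans)
qed

end

section \<open>The jump measure of a stable sum-max process\<close>

lemma nn_integral_powr_halfline:
  fixes c :: real
  assumes "0 < c" "c < 1"
  shows "(\<integral>\<^sup>+s. ennreal (c powr s) \<partial>restrict_space lborel {0<..}) = ennreal (1 / (- ln c))"
proof -
  have "(\<integral>\<^sup>+s. ennreal (c powr s) \<partial>restrict_space lborel {0<..}) = (\<integral>\<^sup>+s\<in>{0<..}. ennreal (exp (- (- ln c) * s)) \<partial>lborel)"
    using assms by (subst nn_integral_restrict_space) (auto simp: powr_def mult.commute)
  also have "\<dots> = ennreal (1 / (- ln c))"
    using assms by (intro nn_integral_exp_halfline) (auto simp: ln_less_zero)
  finally show ?thesis .
qed

text \<open>The last two assumptions are what stability of the first coordinate provides: its Laplace transform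
  is self-similar, and the law is not concentrated at 0.\<close>

locale stable_sum_max_setting = sum_max_setting N \<rho> D A
  for N :: "'c measure" and \<rho> D A +
  fixes x\<^sub>0 :: ereal and \<Phi> :: "(real \<times> ereal) measure" and \<beta> :: real
  assumes levy: "levy_exponent_measure \<rho> x\<^sub>0 \<Phi>"
    and x0_finite: "x\<^sub>0 < \<infinity>"
    and beta_pos: "0 < \<beta>"
    and self_similar: "\<And>a \<xi>. 0 < a \<Longrightarrow> 0 < \<xi> \<Longrightarrow> laplace_D \<rho> (a * \<xi>) = laplace_D \<rho> \<xi> powr (a powr \<beta>)"
    and nondegenerate: "laplace_D \<rho> 1 < 1"
begin

abbreviation \<Psi> :: "real \<Rightarrow> real \<Rightarrow> real" where
  "\<Psi> \<xi> y \<equiv> CL_exponent x\<^sub>0 \<Phi> \<xi> (ereal y)"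

abbreviation \<Psi>\<^sub>D :: "real \<Rightarrow> real" where
  "\<Psi>\<^sub>D \<equiv> CL_exponent_D x\<^sub>0 \<Phi>"

subsection \<open>Exponents\<close>

lemma sets_Phi: "sets \<Phi> = sets (restrict_space borel (CL_space x\<^sub>0))"
  using levy by (simp add: levy_exponent_measure_def)

sublocale Phi: sigma_finite_measure \<Phi>
  using levy by (simp add: levy_exponent_measure_def)

lemma space_Phi: "space \<Phi> = CL_space x\<^sub>0"
  using sets_eq_imp_space_eq[OF sets_Phi] by (simp add: space_restrict_space)

lemma space_PhiD: "p \<in> space \<Phi> \<Longrightarrow> 0 \<le> fst p \<and> x\<^sub>0 \<le> snd p \<and> snd p < \<infinity>"
  unfolding space_Phi CL_space_def by auto

lemma measurable_Phi_fst_snd [measurable]: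
  "fst \<in> borel_measurable \<Phi>" "snd \<in> borel_measurable \<Phi>"
  by (simp_all add: measurable_cong_sets[OF sets_Phi refl] measurable_restrict_space1 borel_prod[symmetric])

lemma CL_transform_eq_exp:
  assumes "0 \<le> \<xi>" "x\<^sub>0 < ereal y"
  shows "CL_transform \<rho> \<xi> y = exp (- \<Psi> \<xi> y)" "integrable \<Phi> (CL_integrand x\<^sub>0 \<xi> (ereal y))"
  using levy assms by (auto simp: levy_exponent_measure_def)

lemma CL_integrand_eq:
  "p \<in> space \<Phi> \<Longrightarrow> CL_integrand x\<^sub>0 \<xi> y p = 1 - exp (- \<xi> * fst p) * indicator {p. snd p \<le> y} p"
  using space_PhiD[of p] by (auto simp: CL_integrand_def case_prod_beta' split: split_indicator)

lemma Psi_D_eq: "\<Psi>\<^sub>D \<xi> = (\<integral>p. 1 - exp (- \<xi> * fst p) \<partial>\<Phi>)"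
  unfolding CL_exponent_D_def CL_exponent_def
  by (intro Bochner_Integration.integral_cong) (auto simp: CL_integrand_eq)

lemma obtain_above_x0:
  obtains y where "x\<^sub>0 < ereal y" "0 \<le> y"
proof -
  obtain z where "x\<^sub>0 < ereal z" using ereal_dense2[OF x0_finite] by auto
  moreover have "ereal z \<le> ereal (max z 0)" by simp
  ultimately have "x\<^sub>0 < ereal (max z 0)" by (rule less_le_trans)
  then show ?thesis by (rule that) simp
qed

lemma integrable_Phi_D:
  assumes "0 \<le> \<xi>"
  shows "integrable \<Phi> (\<lambda>p. 1 - exp (- \<xi> * fst p))"
proof -
  obtain y where "x\<^sub>0 < ereal y" using obtain_above_x0 by blast
  show ?thesis
  proof (rule Bochner_Integration.integrable_bound[OF CL_transform_eq_exp(2)[OF assms \<open>x\<^sub>0 < ereal y\<close>]])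
    show "AE p in \<Phi>. norm (1 - exp (- \<xi> * fst p)) \<le> norm (CL_integrand x\<^sub>0 \<xi> (ereal y) p)"
      using assms space_PhiD by (intro AE_I2) (auto simp: CL_integrand_eq split: split_indicator)
  qed simp
qed

text \<open>The exponent with the level \<open>\<infinity>\<close> is the limit of those with finite levels, by dominated convergence.\<close>

lemma laplace_D_eq_exp:
  assumes "0 \<le> \<xi>"
  shows "laplace_D \<rho> \<xi> = exp (- \<Psi>\<^sub>D \<xi>)"
proof -
  obtain y where y: "x\<^sub>0 < ereal y" "0 \<le> y" using obtain_above_x0 by blast
  \<comment> \<open>The levels \<open>j + m\<close> lie above \<open>x\<^sub>0\<close>, where the exponents are defined.\<close>
  define m where "m = nat \<lceil>y\<rceil>"
  have m: "y \<le> real (j + m)" for j using y by (simp add: m_def) linarith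
  then have x0m: "x\<^sub>0 < ereal (real (j + m))" for j using y by (meson ereal_less_eq(3) order.strict_trans2)
  have "(\<lambda>j. \<Psi> \<xi> (real (j + m))) \<longlonglongrightarrow> \<Psi>\<^sub>D \<xi>"
    unfolding Psi_D_eq CL_exponent_def
  proof (rule integral_dominated_convergence[OF _ _ CL_transform_eq_exp(2)[OF assms y(1)]])
    show "CL_integrand x\<^sub>0 \<xi> (ereal (real (j + m))) \<in> borel_measurable \<Phi>" for j
      using CL_transform_eq_exp(2)[OF assms x0m] by simp
    show "AE p in \<Phi>. (\<lambda>j. CL_integrand x\<^sub>0 \<xi> (ereal (real (j + m))) p) \<longlonglongrightarrow> 1 - exp (- \<xi> * fst p)"
    proof (rule AE_I2)
      fix p assume p: "p \<in> space \<Phi>"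
      then obtain n :: nat where n: "snd p < ereal (real n)"
        using space_PhiD[OF p] less_PInf_Ex_of_nat by auto
      have "\<forall>\<^sub>F j in sequentially. CL_integrand x\<^sub>0 \<xi> (ereal (real (j + m))) p = 1 - exp (- \<xi> * fst p)"
        using eventually_ge_at_top[of n]
      proof eventually_elim
        case (elim j)
        then have "ereal (real n) \<le> ereal (real (j + m))" by simp
        with n have "snd p \<le> ereal (real (j + m))" by order
        then show ?case using p by (simp add: CL_integrand_eq)
      qed
      then show "(\<lambda>j. CL_integrand x\<^sub>0 \<xi> (ereal (real (j + m))) p) \<longlonglongrightarrow> 1 - exp (- \<xi> * fst p)"
        by (rule tendsto_eventually)
    qed
    show "AE p in \<Phi>. norm (CL_integrand x\<^sub>0 \<xi> (ereal (real (j + m))) p) \<le> CL_integrand x\<^sub>0 \<xi> (ereal y) p" for j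
    proof (rule AE_I2)
      fix p assume p: "p \<in> space \<Phi>"
      have "snd p \<le> ereal y \<Longrightarrow> snd p \<le> ereal (real (j + m))"
        using m[of j] by (meson ereal_less_eq(3) order_trans)
      then show "norm (CL_integrand x\<^sub>0 \<xi> (ereal (real (j + m))) p) \<le> CL_integrand x\<^sub>0 \<xi> (ereal y) p"
        using p space_PhiD[OF p] assms by (auto simp: CL_integrand_eq split: split_indicator)
    qed
  qed simp
  then have "(\<lambda>j. exp (- \<Psi> \<xi> (real (j + m)))) \<longlonglongrightarrow> exp (- \<Psi>\<^sub>D \<xi>)"
    by (intro tendsto_intros)
  moreover have "(\<lambda>j. CL_transform \<rho> \<xi> (real (j + m))) \<longlonglongrightarrow> laplace_D \<rho> \<xi>"
    using CL_tendsto_laplace_D[OF assms] by (rule LIMSEQ_ignore_initial_segment)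
  ultimately show ?thesis
    using CL_transform_eq_exp(1)[OF assms x0m] by (simp add: LIMSEQ_unique)
qed

lemma nn_integral_Phi_D:
  assumes "0 \<le> \<xi>"
  shows "(\<integral>\<^sup>+p. ennreal (1 - exp (- \<xi> * fst p)) \<partial>\<Phi>) = ennreal (\<Psi>\<^sub>D \<xi>)"
  unfolding Psi_D_eq using space_PhiD assms
  by (intro nn_integral_eq_integral integrable_Phi_D AE_I2) auto

abbreviation size_transform :: "real \<Rightarrow> (real \<times> ereal \<Rightarrow> bool) \<Rightarrow> ennreal" where
  "size_transform \<xi> Q \<equiv> (\<integral>\<^sup>+p. ennreal (1 - exp (- \<xi> * fst p)) * indicator {p. Q p} p \<partial>\<Phi>)"

abbreviation tail_mass :: "(real \<times> ereal \<Rightarrow> bool) \<Rightarrow> real \<Rightarrow> ennreal" where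
  "tail_mass Q r \<equiv> emeasure \<Phi> {p \<in> space \<Phi>. r < fst p \<and> Q p}"

text \<open>Subtracting the exponent at \<open>\<xi> = 0\<close> removes the jumps above the level \<open>y\<close>, which both exponents
  count with weight 1.\<close>

lemma nn_integral_Phi_le:
  assumes "0 \<le> \<xi>" "x\<^sub>0 < ereal y"
  shows "size_transform \<xi> (\<lambda>p. snd p \<le> ereal y) = ennreal (\<Psi> \<xi> y - \<Psi> 0 y)"
proof -
  have int: "integrable \<Phi> (CL_integrand x\<^sub>0 \<xi> (ereal y))" "integrable \<Phi> (CL_integrand x\<^sub>0 0 (ereal y))"
    using assms by (auto intro: CL_transform_eq_exp)
  have "size_transform \<xi> (\<lambda>p. snd p \<le> ereal y)
      = (\<integral>\<^sup>+p. ennreal (CL_integrand x\<^sub>0 \<xi> (ereal y) p - CL_integrand x\<^sub>0 0 (ereal y) p) \<partial>\<Phi>)"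
    by (intro nn_integral_cong) (auto simp: CL_integrand_eq split: split_indicator)
  also have "\<dots> = ennreal (\<integral>p. CL_integrand x\<^sub>0 \<xi> (ereal y) p - CL_integrand x\<^sub>0 0 (ereal y) p \<partial>\<Phi>)"
    using space_PhiD assms int by (intro nn_integral_eq_integral AE_I2)
      (auto simp: CL_integrand_eq split: split_indicator)
  also have "\<dots> = ennreal (\<Psi> \<xi> y - \<Psi> 0 y)"
    unfolding CL_exponent_def using int by simp
  finally show ?thesis .
qed

lemma Psi_D_scale: "0 < a \<Longrightarrow> 0 < \<xi> \<Longrightarrow> \<Psi>\<^sub>D (a * \<xi>) = a powr \<beta> * \<Psi>\<^sub>D \<xi>"
  using self_similar[of a \<xi>] by (simp add: laplace_D_eq_exp powr_def)

lemma Psi_D_pos: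
  assumes "0 < \<xi>"
  shows "0 < \<Psi>\<^sub>D \<xi>"
proof -
  have "0 < \<Psi>\<^sub>D 1" using nondegenerate by (simp add: laplace_D_eq_exp)
  then show ?thesis using Psi_D_scale[of \<xi> 1] assms by simp
qed

lemma Psi_D_le_Psi:
  assumes "0 \<le> \<xi>" "x\<^sub>0 < ereal y"
  shows "\<Psi>\<^sub>D \<xi> \<le> \<Psi> \<xi> y"
  unfolding Psi_D_eq CL_exponent_def using assms space_PhiD
  by (intro integral_mono integrable_Phi_D CL_transform_eq_exp)
    (auto simp: CL_integrand_eq split: split_indicator)

lemma Psi_pos: "0 < \<xi> \<Longrightarrow> x\<^sub>0 < ereal y \<Longrightarrow> 0 < \<Psi> \<xi> y"
  using Psi_D_pos[of \<xi>] Psi_D_le_Psi[of \<xi> y] by simp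

text \<open>\<open>\<Psi>\<^sub>D(\<xi>)\<close> is at most the mass of the jumps of \<open>D\<close>, but it grows like \<open>\<xi>\<^bsup>\<beta>\<^esup>\<close>.\<close>

lemma infinitely_many_jumps: "emeasure \<Phi> {p \<in> space \<Phi>. 0 < fst p} = \<infinity>"
proof (rule ccontr)
  assume "\<not> ?thesis"
  then obtain c where c: "emeasure \<Phi> {p \<in> space \<Phi>. 0 < fst p} = ennreal c" "0 \<le> c"
    by (cases "emeasure \<Phi> {p \<in> space \<Phi>. 0 < fst p}") auto
  have le: "\<Psi>\<^sub>D \<xi> \<le> c" if "0 < \<xi>" for \<xi>
  proof -
    have "ennreal (\<Psi>\<^sub>D \<xi>) = (\<integral>\<^sup>+p. ennreal (1 - exp (- \<xi> * fst p)) \<partial>\<Phi>)"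
      using that by (subst nn_integral_Phi_D) auto
    also have "\<dots> \<le> (\<integral>\<^sup>+p. indicator {p \<in> space \<Phi>. 0 < fst p} p \<partial>\<Phi>)"
      using space_PhiD that by (intro nn_integral_mono) (force split: split_indicator)
    also have "\<dots> = ennreal c" using c by simp
    finally show ?thesis using c by simp
  qed
  have "filterlim (\<lambda>a. a powr \<beta> * \<Psi>\<^sub>D 1) at_top at_top"
    using beta_pos Psi_D_pos[of 1] by real_asymp
  then have "eventually (\<lambda>a. c < a powr \<beta> * \<Psi>\<^sub>D 1) at_top"
    by (auto simp: filterlim_at_top_dense)
  then have "eventually (\<lambda>a. c < a powr \<beta> * \<Psi>\<^sub>D 1 \<and> 0 < a) at_top"
    using eventually_gt_at_top[of 0] by eventually_elim auto
  then obtain a where "c < a powr \<beta> * \<Psi>\<^sub>D 1" "0 < a"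
    by (auto simp: eventually_at_top_linorder)
  with le[of a] Psi_D_scale[of a 1] show False by simp
qed

subsection \<open>Potential measure\<close>

abbreviation time :: "real measure" where
  "time \<equiv> restrict_space lborel {0<..}"

sublocale time: sigma_finite_measure time
  by (rule sigma_finite_measure_restrict_space) (auto intro: lborel.sigma_finite_measure_axioms)

sublocale time_N: pair_sigma_finite time N ..

lemma space_time [simp]: "space time = {0<..}"
  by (simp add: space_restrict_space)

text \<open>A right-continuous process is the limit of the processes frozen at the next point of a dyadic grid.\<close>

lemma measurable_process:
  assumes meas: "\<And>t. 0 < t \<Longrightarrow> Y t \<in> borel_measurable N"
    and cont: "\<And>\<omega> t. \<omega> \<in> space N \<Longrightarrow> 0 < t \<Longrightarrow> ((\<lambda>t. Y t \<omega>) \<longlongrightarrow> (Y t \<omega> :: real)) (at_right t)"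
  shows "(\<lambda>p. Y (fst p) (snd p)) \<in> borel_measurable (time \<Otimes>\<^sub>M N)"
proof -
  define next_time where "next_time n t = (real (nat \<lfloor>t * 2 ^ n\<rfloor>) + 1) / 2 ^ n" for n :: nat and t :: real
  have next_gt: "t < next_time n t" and next_le: "next_time n t \<le> t + 1 / 2 ^ n" if "0 < t" for n t
  proof -
    have "real (nat \<lfloor>t * 2 ^ n\<rfloor>) = of_int \<lfloor>t * 2 ^ n\<rfloor>" using that by simp
    then have "t * 2 ^ n < real (nat \<lfloor>t * 2 ^ n\<rfloor>) + 1" "real (nat \<lfloor>t * 2 ^ n\<rfloor>) \<le> t * 2 ^ n" by linarith+
    then show "t < next_time n t" "next_time n t \<le> t + 1 / 2 ^ n"
      unfolding next_time_def by (simp_all add: field_simps)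
  qed
  show ?thesis
  proof (rule borel_measurable_LIMSEQ_real[where u = "\<lambda>n p. Y (next_time n (fst p)) (snd p)"])
    fix p assume "p \<in> space (time \<Otimes>\<^sub>M N)"
    then have p: "0 < fst p" "snd p \<in> space N" by (auto simp: space_pair_measure)
    have "(\<lambda>n. fst p + 1 / 2 ^ n) \<longlonglongrightarrow> fst p + 0"
      by (intro tendsto_add tendsto_const LIMSEQ_divide_realpow_zero) simp
    then have "(\<lambda>n. next_time n (fst p)) \<longlonglongrightarrow> fst p"
      using next_gt[OF p(1)] next_le[OF p(1)]
      by (intro real_tendsto_sandwich[OF _ _ tendsto_const, of "fst p" "\<lambda>n. next_time n (fst p)" _ "\<lambda>n. fst p + 1 / 2 ^ n"])
        (simp_all add: less_imp_le)
    moreover have "\<forall>\<^sub>F n in sequentially. next_time n (fst p) \<in> {fst p<..} \<and> next_time n (fst p) \<noteq> fst p"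
      using next_gt[OF p(1)] by (intro always_eventually) (simp add: less_imp_neq[THEN not_sym])
    ultimately have "filterlim (\<lambda>n. next_time n (fst p)) (at_right (fst p)) sequentially"
      unfolding filterlim_at by simp
    then show "(\<lambda>n. Y (next_time n (fst p)) (snd p)) \<longlonglongrightarrow> Y (fst p) (snd p)"
      by (rule filterlim_compose[OF cont[OF p(2,1)]])
  next
    fix n
    have "(\<lambda>p. (\<lambda>k p. Y ((real k + 1) / 2 ^ n) (snd p)) (nat \<lfloor>fst p * 2 ^ n\<rfloor>) p) \<in> borel_measurable (time \<Otimes>\<^sub>M N)"
    proof (rule measurable_compose_countable[where f = "\<lambda>k p. Y ((real k + 1) / 2 ^ n) (snd p)" and g = "\<lambda>p. nat \<lfloor>fst p * 2 ^ n\<rfloor>"])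
      fix k
      have [measurable]: "Y ((real k + 1) / 2 ^ n) \<in> borel_measurable N" by (intro meas) auto
      show "(\<lambda>p. Y ((real k + 1) / 2 ^ n) (snd p)) \<in> borel_measurable (time \<Otimes>\<^sub>M N)" by measurable
    next
      have [measurable]: "fst \<in> borel_measurable (time \<Otimes>\<^sub>M N)"
        by (rule measurable_compose[OF measurable_fst]) (simp add: measurable_restrict_space1)
      show "(\<lambda>p. nat \<lfloor>fst p * 2 ^ n\<rfloor>) \<in> measurable (time \<Otimes>\<^sub>M N) (count_space UNIV)" by measurable
    qed
    then show "(\<lambda>p. Y (next_time n (fst p)) (snd p)) \<in> borel_measurable (time \<Otimes>\<^sub>M N)"
      by (simp add: next_time_def)
  qed
qed

lemma measurable_process_D [measurable]: "(\<lambda>p. D (fst p) (snd p)) \<in> borel_measurable (time \<Otimes>\<^sub>M N)"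
  by (intro measurable_process D_right_continuous measurable_D)

lemma measurable_process_A [measurable]: "(\<lambda>p. A (fst p) (snd p)) \<in> borel_measurable (time \<Otimes>\<^sub>M N)"
  by (intro measurable_process A_right_continuous measurable_A)

lemma AE_time_N_nonneg: "AE p in time \<Otimes>\<^sub>M N. 0 \<le> D (fst p) (snd p)"
  by (intro AE_I2) (auto simp: space_pair_measure D_nonneg)

abbreviation start_transform :: "real \<Rightarrow> (real \<times> 'c \<Rightarrow> bool) \<Rightarrow> ennreal" where
  "start_transform \<xi> P \<equiv>
     (\<integral>\<^sup>+p. ennreal (exp (- \<xi> * D (fst p) (snd p))) * indicator {p. P p} p \<partial>(time \<Otimes>\<^sub>M N))"

text \<open>Under \<open>ds \<otimes> P\<close> the variable \<open>D(s)\<close> follows the potential measure of the subordinator, which is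
  infinite but has finite Laplace transform.\<close>

lemma laplace_potential:
  assumes "0 < \<xi>"
  shows "(\<integral>\<^sup>+p. ennreal (exp (- \<xi> * D (fst p) (snd p))) \<partial>(time \<Otimes>\<^sub>M N)) = ennreal (1 / \<Psi>\<^sub>D \<xi>)"
proof -
  have "(\<integral>\<^sup>+p. ennreal (exp (- \<xi> * D (fst p) (snd p))) \<partial>(time \<Otimes>\<^sub>M N))
      = (\<integral>\<^sup>+t. (\<integral>\<^sup>+\<omega>. ennreal (exp (- (\<xi> * D t \<omega>))) \<partial>N) \<partial>time)"
    by (subst nn_integral_fst[symmetric]) auto
  also have "\<dots> = (\<integral>\<^sup>+t. ennreal (laplace_D \<rho> \<xi> powr t) \<partial>time)"
    using assms D_nonneg by (intro nn_integral_cong) (simp add: nn_transform_bounded transform_D_1)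
  also have "\<dots> = ennreal (1 / \<Psi>\<^sub>D \<xi>)"
    using Psi_D_pos[OF assms] assms by (subst nn_integral_powr_halfline) (auto simp: laplace_D_eq_exp)
  finally show ?thesis .
qed

lemma laplace_potential_le:
  assumes "0 < \<xi>" "x\<^sub>0 < ereal y"
  shows "start_transform \<xi> (\<lambda>p. A (fst p) (snd p) \<le> y)
    = ennreal (1 / \<Psi> \<xi> y)"
proof -
  have "start_transform \<xi> (\<lambda>p. A (fst p) (snd p) \<le> y)
      = (\<integral>\<^sup>+t. (\<integral>\<^sup>+\<omega>. ennreal (exp (- (\<xi> * D t \<omega>)) * indicator {\<omega>. A t \<omega> \<le> y} \<omega>) \<partial>N) \<partial>time)"
    by (subst nn_integral_fst[symmetric]) (auto intro!: nn_integral_cong split: split_indicator)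
  also have "\<dots> = (\<integral>\<^sup>+t. ennreal (CL_transform \<rho> \<xi> y powr t) \<partial>time)"
  proof (intro nn_integral_cong)
    fix t assume "t \<in> space time"
    then have t: "0 < t" by simp
    show "(\<integral>\<^sup>+\<omega>. ennreal (exp (- (\<xi> * D t \<omega>)) * indicator {\<omega>. A t \<omega> \<le> y} \<omega>) \<partial>N) = ennreal (CL_transform \<rho> \<xi> y powr t)"
      using assms D_nonneg t measurable_A[OF t] measurable_D[OF t]
      by (subst nn_transform_bounded) (auto simp: transform_1 split: split_indicator)
  qed
  also have "\<dots> = ennreal (1 / \<Psi> \<xi> y)"
    using Psi_pos[OF assms] assms by (subst nn_integral_powr_halfline) (auto simp: CL_transform_eq_exp)
  finally show ?thesis .
qed

definition potential :: "real measure" where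
  "potential = distr (time \<Otimes>\<^sub>M N) borel (\<lambda>p. D (fst p) (snd p))"

lemma sets_potential [measurable_cong, simp]: "sets potential = sets borel"
  by (simp add: potential_def)

text \<open>Its Laplace transform \<open>1/\<Psi>\<^sub>D\<close> is homogeneous of degree \<open>-\<beta>\<close>, so the potential measure is homogeneous of
  degree \<open>\<beta>\<close>.\<close>

lemma potential_scale:
  assumes "0 < a"
  shows "potential = density (distr potential borel (\<lambda>\<tau>. a * \<tau>)) (\<lambda>_. ennreal (a powr \<beta>))"
proof (rule laplace_determines_measure)
  have lap: "(\<integral>\<^sup>+x. exp (- \<xi> * x) \<partial>potential) = ennreal (1 / \<Psi>\<^sub>D \<xi>)" if "0 < \<xi>" for \<xi>
    unfolding potential_def using laplace_potential[OF that] by (subst nn_integral_distr) auto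
  show "(\<integral>\<^sup>+x. exp (- \<xi> * x) \<partial>potential) = (\<integral>\<^sup>+x. exp (- \<xi> * x) \<partial>density (distr potential borel (\<lambda>\<tau>. a * \<tau>)) (\<lambda>_. ennreal (a powr \<beta>)))"
    if "0 < \<xi>" for \<xi>
  proof -
    have "(\<integral>\<^sup>+x. exp (- \<xi> * x) \<partial>density (distr potential borel (\<lambda>\<tau>. a * \<tau>)) (\<lambda>_. ennreal (a powr \<beta>)))
        = ennreal (a powr \<beta>) * (\<integral>\<^sup>+x. exp (- (a * \<xi>) * x) \<partial>potential)"
      by (subst nn_integral_density, simp, simp, subst nn_integral_cmult, simp, subst nn_integral_distr)
        (auto simp: mult_ac)
    also have "\<dots> = ennreal (1 / \<Psi>\<^sub>D \<xi>)"
      using assms that Psi_D_pos[OF that]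
      by (subst lap) (auto simp: Psi_D_scale ennreal_mult[symmetric] less_imp_le)
    finally show ?thesis using lap[OF that] by simp
  qed
  show "(\<integral>\<^sup>+x. exp (- x) \<partial>potential) < \<infinity>" using lap[of 1] by simp
  show ae: "AE x in potential. 0 \<le> x"
    unfolding potential_def using AE_time_N_nonneg by (subst AE_distr_iff) auto
  show "AE x in density (distr potential borel (\<lambda>\<tau>. a * \<tau>)) (\<lambda>_. ennreal (a powr \<beta>)). 0 \<le> x"
    using ae assms by (subst AE_density, simp, subst AE_distr_iff) auto
qed auto

text \<open>The measure \<open>\<Lambda>\<close> of the introduction: a point is an operational time, a path and a candidate jump.\<close>

definition jumps :: "((real \<times> 'c) \<times> (real \<times> ereal)) measure" where
  "jumps = (time \<Otimes>\<^sub>M N) \<Otimes>\<^sub>M \<Phi>"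

definition jump_start :: "(real \<times> 'c) \<times> (real \<times> ereal) \<Rightarrow> real" where
  "jump_start q = D (fst (fst q)) (snd (fst q))"

definition jump_size :: "(real \<times> 'c) \<times> (real \<times> ereal) \<Rightarrow> real" where
  "jump_size q = fst (snd q)"

sublocale time_N_Phi: pair_sigma_finite "time \<Otimes>\<^sub>M N" \<Phi> ..

lemma sigma_finite_jumps: "sigma_finite_measure jumps"
  unfolding jumps_def by (rule time_N_Phi.sigma_finite_measure_axioms)

lemma sets_jumps [measurable_cong]: "sets jumps = sets ((time \<Otimes>\<^sub>M N) \<Otimes>\<^sub>M \<Phi>)"
  by (simp add: jumps_def)

lemma measurable_jump [measurable]:
  "jump_start \<in> borel_measurable jumps" "jump_size \<in> borel_measurable jumps"
  unfolding jump_start_def jump_size_def by measurable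

lemma AE_jump_nonneg: "AE q in jumps. 0 \<le> jump_start q \<and> 0 \<le> jump_size q"
  by (intro AE_I2) (auto simp: jumps_def jump_start_def jump_size_def space_pair_measure D_nonneg dest: space_PhiD)

definition jump_tail :: "real \<Rightarrow> ennreal" where
  "jump_tail r = emeasure \<Phi> {p \<in> space \<Phi>. r < fst p}"

lemma measurable_emeasure_exceeding:
  assumes [measurable]: "Measurable.pred \<Phi> Q"
  shows "(\<lambda>r. tail_mass Q r) \<in> borel_measurable borel"
proof -
  have "(\<lambda>r. \<integral>\<^sup>+p. indicator {p \<in> space \<Phi>. r < fst p \<and> Q p} p \<partial>\<Phi>) \<in> borel_measurable borel"
    by measurable
  also have "(\<lambda>r. \<integral>\<^sup>+p. indicator {p \<in> space \<Phi>. r < fst p \<and> Q p} p \<partial>\<Phi>)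
      = (\<lambda>r. tail_mass Q r)"
    by (intro ext nn_integral_indicator) measurable
  finally show ?thesis .
qed

lemma measurable_jump_tail [measurable]: "jump_tail \<in> borel_measurable borel"
  using measurable_emeasure_exceeding[of "\<lambda>_. True"] by (simp add: jump_tail_def[abs_def])

lemma jump_tail_antimono: "r \<le> r' \<Longrightarrow> jump_tail r' \<le> jump_tail r"
  unfolding jump_tail_def by (intro emeasure_mono) auto

definition coverage :: "real \<Rightarrow> ennreal" where
  "coverage t = emeasure jumps {q \<in> space jumps. covers jump_start jump_size t q}"

lemma emeasure_jumps:
  assumes "Measurable.pred jumps R"
  shows "emeasure jumps {q \<in> space jumps. R q}
    = (\<integral>\<^sup>+p. emeasure \<Phi> {z \<in> space \<Phi>. R (p, z)} \<partial>(time \<Otimes>\<^sub>M N))"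
proof -
  have "{q \<in> space jumps. R q} \<in> sets jumps"
    using assms by measurable
  then have "emeasure jumps {q \<in> space jumps. R q}
    = (\<integral>\<^sup>+p. emeasure \<Phi> (Pair p -` {q \<in> space jumps. R q}) \<partial>(time \<Otimes>\<^sub>M N))"
    unfolding jumps_def by (rule Phi.emeasure_pair_measure_alt)
  also have "\<dots> = (\<integral>\<^sup>+p. emeasure \<Phi> {z \<in> space \<Phi>. R (p, z)} \<partial>(time \<Otimes>\<^sub>M N))"
    by (intro nn_integral_cong arg_cong[where f = "emeasure \<Phi>"]) (auto simp: jumps_def space_pair_measure)
  finally show ?thesis .
qed

lemma coverage_eq: "coverage t = (\<integral>\<^sup>+\<tau>. indicator {..t} \<tau> * jump_tail (t - \<tau>) \<partial>potential)"
proof -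
  have "coverage t = (\<integral>\<^sup>+p. emeasure \<Phi> {z \<in> space \<Phi>. covers jump_start jump_size t (p, z)} \<partial>(time \<Otimes>\<^sub>M N))"
    unfolding coverage_def by (rule emeasure_jumps) measurable
  also have "\<dots> = (\<integral>\<^sup>+p. indicator {..t} (D (fst p) (snd p)) * jump_tail (t - D (fst p) (snd p)) \<partial>(time \<Otimes>\<^sub>M N))"
    unfolding jump_tail_def covers_def jump_start_def jump_size_def
    by (intro nn_integral_cong) (auto split: split_indicator intro!: arg_cong[where f = "emeasure \<Phi>"])
  also have "\<dots> = (\<integral>\<^sup>+\<tau>. indicator {..t} \<tau> * jump_tail (t - \<tau>) \<partial>potential)"
    unfolding potential_def by (subst nn_integral_distr) auto
  finally show ?thesis .
qed

text \<open>Stretching the line by \<open>a \<ge> 1\<close> multiplies the potential measure by \<open>a\<^bsup>\<beta>\<^esup>\<close>, and it increases the distances that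
  a jump has to bridge, which can only lower the tails.\<close>

lemma coverage_scale_le:
  assumes "1 \<le> a"
  shows "coverage (a * t) \<le> ennreal (a powr \<beta>) * coverage t"
proof -
  have "coverage (a * t) = (\<integral>\<^sup>+\<tau>. indicator {..a * t} \<tau> * jump_tail (a * t - \<tau>) \<partial>density (distr potential borel (\<lambda>\<tau>. a * \<tau>)) (\<lambda>_. ennreal (a powr \<beta>)))"
    unfolding coverage_eq using potential_scale[of a] assms by simp
  also have "\<dots> = ennreal (a powr \<beta>) * (\<integral>\<^sup>+\<tau>. indicator {..a * t} (a * \<tau>) * jump_tail (a * t - a * \<tau>) \<partial>potential)"
    by (subst nn_integral_density, simp, simp, subst nn_integral_cmult, simp, subst nn_integral_distr) auto
  also have "\<dots> \<le> ennreal (a powr \<beta>) * (\<integral>\<^sup>+\<tau>. indicator {..t} \<tau> * jump_tail (t - \<tau>) \<partial>potential)"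
  proof (intro mult_left_mono nn_integral_mono)
    fix \<tau>
    have "t - \<tau> \<le> a * t - a * \<tau>" if "\<tau> \<le> t"
      using mult_right_mono[of 1 a "t - \<tau>"] that assms by (simp add: algebra_simps)
    then show "indicator {..a * t} (a * \<tau>) * jump_tail (a * t - a * \<tau>) \<le> indicator {..t} \<tau> * jump_tail (t - \<tau>)"
      using assms by (auto split: split_indicator intro: jump_tail_antimono)
  qed simp
  finally show ?thesis unfolding coverage_eq .
qed

lemma laplace_jumps:
  assumes "0 < \<xi>"
    and [measurable]: "Measurable.pred (time \<Otimes>\<^sub>M N) P" "Measurable.pred \<Phi> Q"
  shows "interval_transform jumps jump_start jump_size (\<lambda>q. P (fst q) \<and> Q (snd q)) \<xi>
    = start_transform \<xi> P
      * size_transform \<xi> Q * ennreal (1 / \<xi>)"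
proof -
  have "interval_transform jumps jump_start jump_size (\<lambda>q. P (fst q) \<and> Q (snd q)) \<xi>
    = (\<integral>\<^sup>+p. (\<integral>\<^sup>+z. ennreal (exp (- \<xi> * D (fst p) (snd p)) * (1 - exp (- \<xi> * fst z)) / \<xi>) * indicator {q. P (fst q) \<and> Q (snd q)} (p, z) \<partial>\<Phi>) \<partial>(time \<Otimes>\<^sub>M N))"
    unfolding jumps_def
    by (subst Phi.nn_integral_fst[symmetric]) (auto simp: jump_start_def jump_size_def)
  also have "\<dots> = (\<integral>\<^sup>+p. (ennreal (exp (- \<xi> * D (fst p) (snd p))) * indicator {p. P p} p) *
      (size_transform \<xi> Q * ennreal (1 / \<xi>)) \<partial>(time \<Otimes>\<^sub>M N))"
  proof (intro nn_integral_cong)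
    fix p
    have "(\<integral>\<^sup>+z. ennreal (exp (- \<xi> * D (fst p) (snd p)) * (1 - exp (- \<xi> * fst z)) / \<xi>) * indicator {q. P (fst q) \<and> Q (snd q)} (p, z) \<partial>\<Phi>)
      = (\<integral>\<^sup>+z. (ennreal (exp (- \<xi> * D (fst p) (snd p))) * indicator {p. P p} p * ennreal (1 / \<xi>)) * (ennreal (1 - exp (- \<xi> * fst z)) * indicator {p. Q p} z) \<partial>\<Phi>)"
      using \<open>0 < \<xi>\<close> space_PhiD
      by (intro nn_integral_cong) (auto split: split_indicator simp: ennreal_mult[symmetric] mult_ac divide_inverse)
    also have "\<dots> = (ennreal (exp (- \<xi> * D (fst p) (snd p))) * indicator {p. P p} p * ennreal (1 / \<xi>)) * size_transform \<xi> Q"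
      by (rule nn_integral_cmult) measurable
    finally show "(\<integral>\<^sup>+z. ennreal (exp (- \<xi> * D (fst p) (snd p)) * (1 - exp (- \<xi> * fst z)) / \<xi>) * indicator {q. P (fst q) \<and> Q (snd q)} (p, z) \<partial>\<Phi>)
      = (ennreal (exp (- \<xi> * D (fst p) (snd p))) * indicator {p. P p} p) *
      (size_transform \<xi> Q * ennreal (1 / \<xi>))"
      by (simp add: mult_ac)
  qed
  also have "\<dots> = start_transform \<xi> P *
      (size_transform \<xi> Q * ennreal (1 / \<xi>))"
    by (rule nn_integral_multc) measurable
  finally show ?thesis by (simp add: mult.assoc)
qed

text \<open>The factors \<open>1/\<Psi>\<^sub>D\<close> and \<open>\<Psi>\<^sub>D\<close> of the transform cancel.\<close>

lemma AE_coverage: "AE t in lborel. 0 < t \<longrightarrow> coverage t = 1"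
proof -
  have meas: "coverage \<in> borel_measurable borel"
    using measurable_emeasure_covers[OF sigma_finite_jumps, of jump_start jump_size "\<lambda>_. True"]
    by (simp add: coverage_def[abs_def])
  have lap: "laplace_nn \<xi> coverage = ennreal (1 / \<xi>)" if "0 < \<xi>" for \<xi>
  proof -
    have "laplace_nn \<xi> coverage
        = laplace_nn \<xi> (\<lambda>t. emeasure jumps {q \<in> space jumps. covers jump_start jump_size t q \<and> (True \<and> True)})"
      unfolding coverage_def simp_thms ..
    also have "\<dots> = interval_transform jumps jump_start jump_size (\<lambda>q. True \<and> True) \<xi>"
      by (rule laplace_covers[OF sigma_finite_jumps _ _ _ AE_jump_nonneg that]) measurable
    also have "\<dots> = start_transform \<xi> (\<lambda>_. True)
      * size_transform \<xi> (\<lambda>_. True) * ennreal (1 / \<xi>)"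
      by (rule laplace_jumps[OF that]) measurable
    also have "\<dots> = ennreal (1 / \<Psi>\<^sub>D \<xi>) * ennreal (\<Psi>\<^sub>D \<xi>) * ennreal (1 / \<xi>)"
    proof -
      have "start_transform \<xi> (\<lambda>_. True) = ennreal (1 / \<Psi>\<^sub>D \<xi>)"
        unfolding laplace_potential[OF that, symmetric] by (intro nn_integral_cong) (simp add: indicator_def)
      moreover have "size_transform \<xi> (\<lambda>_. True) = ennreal (\<Psi>\<^sub>D \<xi>)"
        unfolding nn_integral_Phi_D[OF less_imp_le[OF that], symmetric] by (intro nn_integral_cong) (simp add: indicator_def)
      ultimately show ?thesis by (simp only:)
    qed
    also have "\<dots> = ennreal (1 / \<xi>)"
      using Psi_D_pos[OF that] that by (simp add: ennreal_mult[symmetric])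
    finally show ?thesis .
  qed
  show ?thesis
  proof (rule laplace_determines_function[OF meas, of "\<lambda>_. 1"])
    fix \<xi> :: real assume "0 < \<xi>"
    show "laplace_nn \<xi> coverage = laplace_nn \<xi> (\<lambda>t. 1)"
      using lap[OF \<open>0 < \<xi>\<close>] nn_integral_exp_halfline[OF \<open>0 < \<xi>\<close>] by simp
    show "laplace_nn \<xi> coverage < \<infinity>"
      using lap[OF \<open>0 < \<xi>\<close>] by simp
  qed simp
qed

text \<open>Points with coverage 1 lie arbitrarily close to \<open>t\<close> on both sides, and scaling from one of them
  to \<open>t\<close> costs a factor that tends to 1.\<close>

lemma coverage_eq_1:
  assumes "0 < t"
  shows "coverage t = 1"
proof (rule antisym)
  \<comment> \<open>Scaling factors that decrease to 1.\<close>
  define a where "a n = 1 + 1 / real (Suc n)" for n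
  have a: "1 < a n" for n by (simp add: a_def)
  have lim: "(\<lambda>n. a n powr \<beta>) \<longlonglongrightarrow> 1"
    unfolding a_def using beta_pos by real_asymp
  have upper: "coverage t \<le> ennreal (a n powr \<beta>)" for n
  proof -
    have "t / a n < t" using a[of n] assms by (simp add: field_simps)
    then obtain u where u: "t / a n < u" "u < t" "0 < u \<longrightarrow> coverage u = 1"
      using AE_lborel_point_in_interval[OF AE_coverage] by blast
    have "0 < u" using u(1) assms a[of n] by (smt (verit) divide_pos_pos)
    have ratio: "1 \<le> t / u" "t / u \<le> a n" using u \<open>0 < u\<close> a[of n] by (auto simp: field_simps)
    have "coverage t = coverage ((t / u) * u)" using \<open>0 < u\<close> by simp
    also have "\<dots> \<le> ennreal ((t / u) powr \<beta>) * 1"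
      using coverage_scale_le[OF ratio(1), of u] u \<open>0 < u\<close> by simp
    also have "\<dots> \<le> ennreal (a n powr \<beta>)"
      using ratio beta_pos by (auto intro!: ennreal_leI powr_mono2)
    finally show ?thesis .
  qed
  have "coverage t \<le> ennreal 1"
    by (rule LIMSEQ_le_const[OF tendsto_ennrealI[OF lim]]) (intro exI allI impI upper)
  then show le_1: "coverage t \<le> 1" by simp
  then obtain c where c: "coverage t = ennreal c" "0 \<le> c" by (cases "coverage t") (auto simp: top_unique)
  have lower: "1 \<le> a n powr \<beta> * c" for n
  proof -
    have "t < t * a n" using a[of n] assms by simp
    then obtain u where u: "t < u" "u < t * a n" "0 < u \<longrightarrow> coverage u = 1"
      using AE_lborel_point_in_interval[OF AE_coverage] by blast
    have ratio: "1 \<le> u / t" "u / t \<le> a n" using u assms by (auto simp: field_simps)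
    have "1 = coverage ((u / t) * t)" using u assms by simp
    also have "\<dots> \<le> ennreal ((u / t) powr \<beta>) * ennreal c"
      using coverage_scale_le[OF ratio(1), of t] by (simp add: c)
    also have "\<dots> \<le> ennreal (a n powr \<beta>) * ennreal c"
      using ratio beta_pos by (intro mult_right_mono ennreal_leI powr_mono2) auto
    finally show ?thesis using c by (simp add: ennreal_mult[symmetric])
  qed
  have "(\<lambda>n. a n powr \<beta> * c) \<longlonglongrightarrow> 1 * c" by (intro tendsto_mult lim tendsto_const)
  then have "1 \<le> 1 * c" by (rule LIMSEQ_le_const) (use lower in auto)
  then show "1 \<le> coverage t" by (simp add: c)
qed

text \<open>If \<open>D(s) = t\<close> had positive mass, all of the infinitely many jumps starting there would cover \<open>t\<close>,
  although the total coverage is 1.\<close>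

lemma no_jump_starts_at:
  assumes "0 < t"
  shows "emeasure jumps {q \<in> space jumps. jump_start q = t \<and> 0 < jump_size q} = 0"
proof -
  let ?E = "{p \<in> space (time \<Otimes>\<^sub>M N). D (fst p) (snd p) = t}"
  let ?P = "{p \<in> space \<Phi>. 0 < fst p}"
  have eq: "{q \<in> space jumps. jump_start q = t \<and> 0 < jump_size q} = ?E \<times> ?P"
    by (auto simp: jumps_def jump_start_def jump_size_def space_pair_measure)
  have prod: "emeasure jumps (?E \<times> ?P) = emeasure (time \<Otimes>\<^sub>M N) ?E * emeasure \<Phi> ?P"
    unfolding jumps_def by (rule Phi.emeasure_pair_measure_Times) measurable
  have "emeasure jumps (?E \<times> ?P) \<le> coverage t"
    unfolding coverage_def eq[symmetric] by (intro emeasure_mono) (auto simp: covers_def)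
  then have "emeasure (time \<Otimes>\<^sub>M N) ?E * \<infinity> \<le> 1"
    unfolding prod infinitely_many_jumps coverage_eq_1[OF assms] .
  then have "emeasure (time \<Otimes>\<^sub>M N) ?E = 0"
    by (auto simp: ennreal_mult_top top_unique split: if_splits)
  then show ?thesis unfolding eq prod by simp
qed

text \<open>\<open>P\<close> restricts the time and the path, \<open>Q\<close> the jump.\<close>

definition jump_cover :: "(real \<times> 'c \<Rightarrow> bool) \<Rightarrow> (real \<times> ereal \<Rightarrow> bool) \<Rightarrow> real \<Rightarrow> ennreal" where
  "jump_cover P Q t = emeasure jumps
     {q \<in> space jumps. covers jump_start jump_size t q \<and> P (fst q) \<and> Q (snd q)}"

lemma antimono_eq_jump_cover:
  fixes g :: "real \<Rightarrow> real"
  assumes [measurable]: "Measurable.pred (time \<Otimes>\<^sub>M N) P" "Measurable.pred \<Phi> Q"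
    and g: "\<And>s t. 0 < s \<Longrightarrow> s \<le> t \<Longrightarrow> g t \<le> g s" "\<And>t. 0 < t \<Longrightarrow> 0 \<le> g t" "\<And>t. 0 < t \<Longrightarrow> g t \<le> 1"
    and laplace: "\<And>\<xi>. 0 < \<xi> \<Longrightarrow> laplace_nn \<xi> (\<lambda>t. ennreal (g t))
      = start_transform \<xi> P
      * size_transform \<xi> Q * ennreal (1 / \<xi>)"
    and "0 < t"
  shows "ennreal (g t) = jump_cover P Q t"
    and "(\<And>u. t < u \<Longrightarrow> g u \<le> b) \<Longrightarrow> g t \<le> b"
    and "(\<And>u. 0 < u \<Longrightarrow> u < t \<Longrightarrow> b \<le> g u) \<Longrightarrow> b \<le> g t"
proof -
  have pred: "Measurable.pred jumps (\<lambda>q. P (fst q) \<and> Q (snd q))" by measurable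
  have one: "emeasure jumps {p \<in> space jumps. covers jump_start jump_size t p} = 1" if "0 < t" for t
    using coverage_eq_1[OF that] by (simp add: coverage_def)
  have eq: "ennreal (g t) = cover_mass jumps jump_start jump_size (\<lambda>q. P (fst q) \<and> Q (snd q)) t" if "0 < t" for t
    by (rule antimono_eq_covers[OF sigma_finite_jumps _ _ pred AE_jump_nonneg one no_jump_starts_at g _ \<open>0 < t\<close>])
      (use laplace laplace_jumps in auto)
  show "ennreal (g t) = jump_cover P Q t"
    using eq[OF \<open>0 < t\<close>] by (simp add: jump_cover_def)
  note cont = antimono_covers_continuous[OF measurable_jump pred one no_jump_starts_at g(2,3) eq \<open>0 < t\<close>]
  show "g t \<le> b" if "\<And>u. t < u \<Longrightarrow> g u \<le> b" by (rule cont(1)) (assumption | rule that; assumption)+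
  show "b \<le> g t" if "\<And>u. 0 < u \<Longrightarrow> u < t \<Longrightarrow> b \<le> g u" by (rule cont(2)) (assumption | rule that; assumption)+
qed

abbreviation crossing_rate ::
    "(real \<times> 'c \<Rightarrow> bool) \<Rightarrow> (real \<times> ereal \<Rightarrow> bool) \<Rightarrow> real \<Rightarrow> real \<Rightarrow> ennreal" where
  "crossing_rate P Q t s \<equiv> (\<integral>\<^sup>+\<omega>. indicator {0..t} (D s \<omega>) * indicator {p. P p} (s, \<omega>) *
     tail_mass Q (t - D s \<omega>) \<partial>N)"

lemma jump_cover_eq:
  assumes [measurable]: "Measurable.pred (time \<Otimes>\<^sub>M N) P" "Measurable.pred \<Phi> Q"
  shows "jump_cover P Q t = (\<integral>\<^sup>+s\<in>{0<..}. crossing_rate P Q t s \<partial>lborel)"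
proof -
  have "jump_cover P Q t = (\<integral>\<^sup>+p. emeasure \<Phi> {z \<in> space \<Phi>. covers jump_start jump_size t (p, z) \<and> P p \<and> Q z} \<partial>(time \<Otimes>\<^sub>M N))"
    unfolding jump_cover_def by (subst emeasure_jumps) auto
  also have "\<dots> = (\<integral>\<^sup>+p. indicator {0..t} (D (fst p) (snd p)) * indicator {p. P p} p *
      tail_mass Q (t - D (fst p) (snd p)) \<partial>(time \<Otimes>\<^sub>M N))"
    unfolding covers_def jump_start_def jump_size_def
    by (intro nn_integral_cong)
      (auto simp: space_pair_measure D_nonneg split: split_indicator intro!: arg_cong[where f = "emeasure \<Phi>"])
  also have "\<dots> = (\<integral>\<^sup>+s. crossing_rate P Q t s \<partial>time)"
  proof (subst nn_integral_fst[symmetric])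
    have [measurable]: "(\<lambda>r. tail_mass Q r) \<in> borel_measurable borel"
      by (rule measurable_emeasure_exceeding) fact
    show "(\<lambda>p. indicator {0..t} (D (fst p) (snd p)) * indicator {p. P p} p *
      tail_mass Q (t - D (fst p) (snd p))) \<in> borel_measurable (time \<Otimes>\<^sub>M N)"
      by measurable
  qed simp
  also have "\<dots> = (\<integral>\<^sup>+s\<in>{0<..}. crossing_rate P Q t s \<partial>lborel)"
    by (rule nn_integral_restrict_space) simp
  finally show ?thesis .
qed

end

section \<open>First passage on dyadic grids\<close>

lemma unique_crossing_index:
  fixes d :: "nat \<Rightarrow> real"
  assumes mono: "\<And>k. d k \<le> d (Suc k)" and "d 0 \<le> t" and unbounded: "\<exists>k. t < d k"
  obtains k\<^sub>0 where "\<And>k. d k \<le> t \<longleftrightarrow> k \<le> k\<^sub>0"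
proof -
  have incr: "incseq d" by (rule incseq_SucI) (rule mono)
  define m where "m = (LEAST k. t < d k)"
  have m: "t < d m" using unbounded unfolding m_def by (rule LeastI_ex)
  with \<open>d 0 \<le> t\<close> have "m \<noteq> 0" by (cases m) auto
  then obtain k\<^sub>0 where k0: "m = Suc k\<^sub>0" by (cases m) auto
  have "d k \<le> t \<longleftrightarrow> k \<le> k\<^sub>0" for k
  proof
    assume "d k \<le> t"
    then have "\<not> m \<le> k" using m incseqD[OF incr, of m k] by auto
    then show "k \<le> k\<^sub>0" using k0 by simp
  next
    assume "k \<le> k\<^sub>0"
    then have "k < m" using k0 by simp
    then show "d k \<le> t" unfolding m_def by (metis not_less_Least not_le)
  qed
  then show ?thesis using that by blast
qed

lemma laplace_limit:
  fixes p :: "nat \<Rightarrow> real \<Rightarrow> ennreal"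
  assumes "0 < \<xi>"
    and [measurable]: "\<And>n. (\<lambda>t. p n t * indicator {0<..} t) \<in> borel_measurable borel"
    and le_1: "\<And>n t. 0 < t \<Longrightarrow> p n t \<le> 1"
    and lim: "\<And>t. 0 < t \<Longrightarrow> (\<lambda>n. p n t) \<longlonglongrightarrow> q t"
    and lap: "\<And>n. laplace_nn \<xi> (p n) = ennreal (c n)"
    and c: "c \<longlonglongrightarrow> c'"
  shows "laplace_nn \<xi> q = ennreal c'"
    and "(\<lambda>t. q t * indicator {0<..} t) \<in> borel_measurable borel"
proof -
  have lim': "(\<lambda>n. p n t * indicator {0<..} t) \<longlonglongrightarrow> q t * indicator {0<..} t" for t
    using lim[of t] by (auto split: split_indicator)
  then show meas [measurable]: "(\<lambda>t. q t * indicator {0<..} t) \<in> borel_measurable borel"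
    by (rule borel_measurable_LIMSEQ_order) measurable
  have "(\<lambda>n. \<integral>\<^sup>+t. exp (- \<xi> * t) * (p n t * indicator {0<..} t) \<partial>lborel)
      \<longlonglongrightarrow> (\<integral>\<^sup>+t. exp (- \<xi> * t) * (q t * indicator {0<..} t) \<partial>lborel)"
  proof (rule nn_integral_dominated_convergence[where w = "\<lambda>t. ennreal (exp (- \<xi> * t)) * indicator {0<..} t"])
    show "(\<integral>\<^sup>+t. ennreal (exp (- \<xi> * t)) * indicator {0<..} t \<partial>lborel) < \<infinity>"
      using nn_integral_exp_halfline[OF \<open>0 < \<xi>\<close>] by simp
    show "AE t in lborel. (\<lambda>n. ennreal (exp (- \<xi> * t)) * (p n t * indicator {0<..} t))
      \<longlonglongrightarrow> ennreal (exp (- \<xi> * t)) * (q t * indicator {0<..} t)"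
      using lim' by (intro AE_I2 ennreal_tendsto_cmult) auto
    show "AE t in lborel. ennreal (exp (- \<xi> * t)) * (p n t * indicator {0<..} t) \<le> ennreal (exp (- \<xi> * t)) * indicator {0<..} t" for n
      using le_1 by (intro AE_I2 mult_left_mono) (auto split: split_indicator)
  qed (use meas in \<open>simp_all\<close>)
  then have "(\<lambda>n. ennreal (c n)) \<longlonglongrightarrow> laplace_nn \<xi> q"
    by (simp add: lap[symmetric] mult.assoc)
  moreover have "(\<lambda>n. ennreal (c n)) \<longlonglongrightarrow> ennreal c'"
    by (rule tendsto_ennrealI) (rule c)
  ultimately show "laplace_nn \<xi> q = ennreal c'"
    by (rule LIMSEQ_unique)
qed

definition grid :: "nat \<Rightarrow> nat \<Rightarrow> real" where
  "grid n k = real k / 2 ^ n"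

lemma grid_pos: "0 < grid n (Suc k)"
  by (simp add: grid_def)

lemma grid_refine: "grid n k = grid (Suc n) (2 * k)"
  by (simp add: grid_def)

context stable_sum_max_setting
begin

text \<open>Almost every path has these properties. They make the first passage times positive and finite;
  \<open>D\<close> and \<open>A\<close> are only given for positive times, so the behaviour at 0 has to be part of the definition.\<close>

definition good_path :: "'c \<Rightarrow> bool" where
  "good_path \<omega> \<longleftrightarrow> \<omega> \<in> space N \<and> monotone_path (\<lambda>t. D t \<omega>) \<and> monotone_path (\<lambda>t. A t \<omega>) \<and>
     (\<forall>t. \<exists>k. t < D (real (Suc k)) \<omega>) \<and> (\<forall>t>0. \<exists>n. D (1 / 2 ^ n) \<omega> < t)"

lemma AE_good_path: "AE \<omega> in N. good_path \<omega>"
  using AE_space AE_monotone_D AE_monotone_A AE_D_unbounded[OF nondegenerate] AE_D_small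
  by eventually_elim (simp add: good_path_def)

text \<open>\<open>D\<close> on the grid, with the value 0 at time 0, where the process itself is unconstrained.\<close>

definition start :: "nat \<Rightarrow> nat \<Rightarrow> 'c \<Rightarrow> real" where
  "start n k \<omega> = (if k = 0 then 0 else D (grid n k) \<omega>)"

text \<open>\<open>A\<close> is at most \<open>x\<close> on the grid up to this point; nothing is required at time 0, where the maximum is that of the empty family.\<close>

definition below :: "real \<Rightarrow> nat \<Rightarrow> nat \<Rightarrow> 'c \<Rightarrow> bool" where
  "below x n k \<omega> \<longleftrightarrow> k = 0 \<or> A (grid n k) \<omega> \<le> x"

lemma start_Suc: "start n (Suc k) = D (grid n (Suc k))" and start_0: "start n 0 = (\<lambda>_. 0)"
  by (auto simp: start_def)

lemma below_Suc: "below x n (Suc k) \<omega> \<longleftrightarrow> A (grid n (Suc k)) \<omega> \<le> x" and below_0: "below x n 0 \<omega>"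
  by (auto simp: below_def)

lemma measurable_D_grid [measurable]: "D (grid n (Suc k)) \<in> borel_measurable N"
  and measurable_A_grid [measurable]: "A (grid n (Suc k)) \<in> borel_measurable N"
  by (intro measurable_D measurable_A grid_pos)+

lemma measurable_start [measurable]: "start n k \<in> borel_measurable N"
  by (cases k) (simp_all add: start_Suc start_0)

lemma measurable_below [measurable]: "Measurable.pred N (below x n k)"
proof (cases k)
  case (Suc j)
  then have "below x n k = (\<lambda>\<omega>. A (grid n (Suc j)) \<omega> \<le> x)" by (simp add: below_Suc fun_eq_iff)
  then show ?thesis by simp
next
  case 0
  then have "below x n k = (\<lambda>\<omega>. True)" by (simp add: below_0 fun_eq_iff)
  then show ?thesis by simp
qed

lemma start_mono: "good_path \<omega> \<Longrightarrow> start n k \<omega> \<le> start n (Suc k) \<omega>"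
  using D_nonneg[OF grid_pos, of \<omega> n 0]
  by (cases k) (auto simp: start_Suc start_0 good_path_def monotone_path_def grid_def divide_right_mono)

lemma below_antimono: "good_path \<omega> \<Longrightarrow> j \<le> k \<Longrightarrow> below x n k \<omega> \<Longrightarrow> below x n j \<omega>"
proof -
  assume *: "good_path \<omega>" "j \<le> k" "below x n k \<omega>"
  show "below x n j \<omega>"
  proof (cases "j = 0")
    case False
    then have "0 < grid n j" "grid n j \<le> grid n k" using *(2) by (auto simp: grid_def divide_right_mono)
    then have "A (grid n j) \<omega> \<le> A (grid n k) \<omega>" using *(1) by (simp add: good_path_def monotone_path_def)
    then show ?thesis using * False by (auto simp: below_def)
  qed (simp add: below_def)
qed

lemma start_unbounded:
  assumes "good_path \<omega>"
  shows "\<exists>k. t < start n k \<omega>"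
proof -
  obtain k where "t < D (real (Suc k)) \<omega>" using assms by (auto simp: good_path_def)
  moreover have "grid n (2 ^ n * Suc k) = real (Suc k)" by (simp add: grid_def add_divide_distrib)
  ultimately have "t < start n (2 ^ n * Suc k) \<omega>" by (simp add: start_def)
  then show ?thesis by blast
qed

definition crossing :: "nat \<Rightarrow> nat \<Rightarrow> real \<Rightarrow> 'c \<Rightarrow> bool" where
  "crossing n k t = covers (start n k) (\<lambda>\<omega>. start n (Suc k) \<omega> - start n k \<omega>) t"

lemma measurable_crossing [measurable]: "Measurable.pred N (crossing n k t)"
  unfolding crossing_def by measurable

lemma crossing_iff: "crossing n k t \<omega> \<longleftrightarrow> start n k \<omega> \<le> t \<and> t < start n (Suc k) \<omega>"
  by (simp add: crossing_def covers_def)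

abbreviation cell_mass :: "nat \<Rightarrow> nat \<Rightarrow> ('c \<Rightarrow> bool) \<Rightarrow> real \<Rightarrow> ennreal" where
  "cell_mass n k C t \<equiv> emeasure N {\<omega> \<in> space N. crossing n k t \<omega> \<and> C \<omega>}"

abbreviation start_weight :: "real \<Rightarrow> nat \<Rightarrow> nat \<Rightarrow> ('c \<Rightarrow> bool) \<Rightarrow> real" where
  "start_weight \<xi> n k C \<equiv> expectation (\<lambda>\<omega>. exp (- \<xi> * start n k \<omega>) * indicator {\<omega>. C \<omega>} \<omega>)"

definition before_grid :: "real \<Rightarrow> nat \<Rightarrow> real \<Rightarrow> 'c set" where
  "before_grid x n t = {\<omega> \<in> space N. \<forall>k. D (grid n (Suc k)) \<omega> \<le> t \<longrightarrow> A (grid n (Suc k)) \<omega> \<le> x}"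

definition after_grid :: "real \<Rightarrow> nat \<Rightarrow> real \<Rightarrow> 'c set" where
  "after_grid x n t = {\<omega> \<in> space N. \<exists>k. t < D (grid n (Suc k)) \<omega> \<and> A (grid n (Suc k)) \<omega> \<le> x}"

lemma sets_before_grid [measurable]: "before_grid x n t \<in> sets N"
  unfolding before_grid_def by measurable

lemma sets_after_grid [measurable]: "after_grid x n t \<in> sets N"
  unfolding after_grid_def by measurable

text \<open>The level \<open>t\<close> is crossed in exactly one grid cell, so an event that is decided by the index of
  that cell splits into disjoint pieces.\<close>

lemma emeasure_by_crossing:
  assumes [measurable]: "E \<in> sets N" "\<And>k. Measurable.pred N (C k)" and "0 < t"
    and iff: "\<And>\<omega> k\<^sub>0. good_path \<omega> \<Longrightarrow> (\<And>k. start n k \<omega> \<le> t \<longleftrightarrow> k \<le> k\<^sub>0) \<Longrightarrow> \<omega> \<in> E \<longleftrightarrow> C k\<^sub>0 \<omega>"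
  shows "emeasure N E = (\<Sum>k. cell_mass n k (C k) t)"
proof -
  have "emeasure N E = (\<integral>\<^sup>+\<omega>. indicator E \<omega> \<partial>N)" by simp
  also have "\<dots> = (\<integral>\<^sup>+\<omega>. (\<Sum>k. indicator {\<omega> \<in> space N. crossing n k t \<omega> \<and> C k \<omega>} \<omega>) \<partial>N)"
  proof (rule nn_integral_cong_AE)
    show "AE \<omega> in N. indicator E \<omega> = (\<Sum>k. indicator {\<omega> \<in> space N. crossing n k t \<omega> \<and> C k \<omega>} \<omega> :: ennreal)"
      using AE_good_path
    proof eventually_elim
      case (elim \<omega>)
      obtain k\<^sub>0 where k0: "\<And>k. start n k \<omega> \<le> t \<longleftrightarrow> k \<le> k\<^sub>0"
        using unique_crossing_index[of "\<lambda>k. start n k \<omega>" t] start_mono[OF elim] start_unbounded[OF elim] \<open>0 < t\<close>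
        by (auto simp: start_0)
      have "crossing n k t \<omega> \<longleftrightarrow> k = k\<^sub>0" for k
        unfolding crossing_iff not_le[symmetric] k0 by auto
      then have "(\<lambda>k. indicator {\<omega> \<in> space N. crossing n k t \<omega> \<and> C k \<omega>} \<omega> :: ennreal)
          = (\<lambda>k. if k = k\<^sub>0 then indicator E \<omega> else 0)"
        using iff[OF elim k0] elim by (auto simp: fun_eq_iff good_path_def split: split_indicator)
      then show ?case using sums_single[of k\<^sub>0 "\<lambda>_. indicator E \<omega> :: ennreal"] by (simp add: sums_iff)
    qed
  qed
  also have "\<dots> = (\<Sum>k. cell_mass n k (C k) t)"
    by (subst nn_integral_suminf) auto
  finally show ?thesis .
qed

lemma emeasure_before_grid:
  assumes "0 < t"
  shows "emeasure N (before_grid x n t) = (\<Sum>k. cell_mass n k (below x n k) t)"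
proof (rule emeasure_by_crossing[OF _ _ assms])
  fix \<omega> k\<^sub>0 assume good: "good_path \<omega>" and k0: "\<And>k. start n k \<omega> \<le> t \<longleftrightarrow> k \<le> k\<^sub>0"
  have "\<omega> \<in> before_grid x n t \<longleftrightarrow> (\<forall>k. start n (Suc k) \<omega> \<le> t \<longrightarrow> below x n (Suc k) \<omega>)"
    using good by (simp add: before_grid_def start_Suc below_Suc good_path_def)
  also have "\<dots> \<longleftrightarrow> (\<forall>k. Suc k \<le> k\<^sub>0 \<longrightarrow> below x n (Suc k) \<omega>)" by (simp only: k0)
  also have "\<dots> \<longleftrightarrow> below x n k\<^sub>0 \<omega>"
    using below_antimono[OF good] below_0 by (metis not0_implies_Suc order_refl)
  finally show "\<omega> \<in> before_grid x n t \<longleftrightarrow> below x n k\<^sub>0 \<omega>" .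
qed auto

lemma emeasure_after_grid:
  assumes "0 < t"
  shows "emeasure N (after_grid x n t) = (\<Sum>k. cell_mass n k (below x n (Suc k)) t)"
proof (rule emeasure_by_crossing[OF _ _ assms])
  fix \<omega> k\<^sub>0 assume good: "good_path \<omega>" and k0: "\<And>k. start n k \<omega> \<le> t \<longleftrightarrow> k \<le> k\<^sub>0"
  have "\<omega> \<in> after_grid x n t \<longleftrightarrow> (\<exists>k. \<not> start n (Suc k) \<omega> \<le> t \<and> below x n (Suc k) \<omega>)"
    using good by (simp add: after_grid_def start_Suc below_Suc good_path_def not_le)
  also have "\<dots> \<longleftrightarrow> (\<exists>k. k\<^sub>0 \<le> k \<and> below x n (Suc k) \<omega>)" by (simp add: k0 not_less_eq_eq)
  also have "\<dots> \<longleftrightarrow> below x n (Suc k\<^sub>0) \<omega>"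
    using below_antimono[OF good] by (meson Suc_le_mono order_refl)
  finally show "\<omega> \<in> after_grid x n t \<longleftrightarrow> below x n (Suc k\<^sub>0) \<omega>" .
qed auto

text \<open>Within one cell the interval to be covered is \<open>[D(kh), D((k+1)h))\<close>; the transforms of the cells
  form a geometric series.\<close>

lemma laplace_crossing_sum:
  assumes \<xi>: "0 < \<xi>" and [measurable]: "\<And>k. Measurable.pred N (C k)"
    and e: "\<And>k. start_weight \<xi> n k (C k)
              - start_weight \<xi> n (Suc k) (C k) = e * q ^ k"
    and q: "0 \<le> q" "q < 1"
  shows "laplace_nn \<xi> (\<lambda>t. (\<Sum>k. cell_mass n k (C k) t))
    = ennreal (e / (\<xi> * (1 - q)))"
    and "(\<lambda>t. \<Sum>k. cell_mass n k (C k) t) \<in> borel_measurable borel"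
proof -
  have meas [measurable]: "(\<lambda>t. cell_mass n k (C k) t) \<in> borel_measurable borel" for k
    unfolding crossing_def by (rule measurable_emeasure_covers) (auto intro: sigma_finite_measure_axioms)
  then show "(\<lambda>t. \<Sum>k. cell_mass n k (C k) t) \<in> borel_measurable borel"
    by measurable
  have start_nonneg: "\<omega> \<in> space N \<Longrightarrow> 0 \<le> start n k \<omega>" for \<omega> k
    by (cases k) (auto simp: start_Suc start_0 intro: D_nonneg grid_pos)
  have int: "integrable N (\<lambda>\<omega>. exp (- \<xi> * start n j \<omega>) * indicator {\<omega>. C k \<omega>} \<omega>)" for j k
  proof (rule integrable_const_bound[where B = 1])
    show "AE \<omega> in N. norm (exp (- \<xi> * start n j \<omega>) * indicator {\<omega>. C k \<omega>} \<omega>) \<le> 1"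
      using start_nonneg \<xi> by (intro AE_I2) (auto split: split_indicator)
    have "(\<lambda>\<omega>. exp (- \<xi> * start n j \<omega>) * indicator {\<omega> \<in> space N. C k \<omega>} \<omega>) \<in> borel_measurable N" by measurable
    then show "(\<lambda>\<omega>. exp (- \<xi> * start n j \<omega>) * indicator {\<omega>. C k \<omega>} \<omega>) \<in> borel_measurable N"
      by (rule measurable_cong[THEN iffD1, rotated]) (auto split: split_indicator)
  qed
  have ae: "AE \<omega> in N. 0 \<le> start n k \<omega> \<and> 0 \<le> start n (Suc k) \<omega> - start n k \<omega>" for k
    using AE_good_path by eventually_elim (auto simp: start_mono intro: start_nonneg simp: good_path_def)
  have summand: "laplace_nn \<xi> (\<lambda>t. cell_mass n k (C k) t)
      = ennreal (e * q ^ k / \<xi>) \<and> 0 \<le> e * q ^ k / \<xi>" for k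
  proof -
    let ?d = "\<lambda>\<omega>. (exp (- \<xi> * start n k \<omega>) * indicator {\<omega>. C k \<omega>} \<omega> - exp (- \<xi> * start n (Suc k) \<omega>) * indicator {\<omega>. C k \<omega>} \<omega>) / \<xi>"
    have int_d: "(\<integral>\<omega>. ?d \<omega> \<partial>N) = e * q ^ k / \<xi>"
      unfolding e[symmetric] using int by simp
    have ae_d: "AE \<omega> in N. 0 \<le> ?d \<omega>"
      using ae[of k] by eventually_elim (use \<xi> in \<open>auto split: split_indicator\<close>)
    have "laplace_nn \<xi> (\<lambda>t. cell_mass n k (C k) t)
      = (\<integral>\<^sup>+\<omega>. ennreal (exp (- \<xi> * start n k \<omega>) * (1 - exp (- \<xi> * (start n (Suc k) \<omega> - start n k \<omega>))) / \<xi>) * indicator {\<omega>. C k \<omega>} \<omega> \<partial>N)"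
      unfolding crossing_def using ae[of k] \<xi>
      by (intro laplace_covers) (auto intro: sigma_finite_measure_axioms)
    also have "\<dots> = (\<integral>\<^sup>+\<omega>. ennreal (?d \<omega>) \<partial>N)"
      by (intro nn_integral_cong) (auto simp: right_diff_distrib exp_add[symmetric] split: split_indicator)
    also have "\<dots> = ennreal (\<integral>\<omega>. ?d \<omega> \<partial>N)"
      using int ae_d by (intro nn_integral_eq_integral) auto
    finally show ?thesis using integral_nonneg_AE[OF ae_d] unfolding int_d by blast
  qed
  have sums: "(\<lambda>k. e * q ^ k / \<xi>) sums (e / (\<xi> * (1 - q)))"
  proof -
    have "(\<lambda>k. (e / \<xi>) * q ^ k) sums ((e / \<xi>) * (1 / (1 - q)))"
      using q by (intro sums_mult geometric_sums) auto
    then show ?thesis by (simp add: field_simps)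
  qed
  have "laplace_nn \<xi> (\<lambda>t. (\<Sum>k. cell_mass n k (C k) t))
      = (\<integral>\<^sup>+t. (\<Sum>k. exp (- \<xi> * t) * cell_mass n k (C k) t * indicator {0<..} t) \<partial>lborel)"
    by (intro nn_integral_cong) (simp add: ennreal_suminf_cmult ennreal_suminf_multc)
  also have "\<dots> = (\<Sum>k. laplace_nn \<xi> (\<lambda>t. cell_mass n k (C k) t))"
    by (rule nn_integral_suminf) measurable
  also have "\<dots> = (\<Sum>k. ennreal (e * q ^ k / \<xi>))" using summand by simp
  also have "\<dots> = ennreal (e / (\<xi> * (1 - q)))"
    using summand sums by (intro suminf_ennreal_eq) auto
  finally show "laplace_nn \<xi> (\<lambda>t. (\<Sum>k. cell_mass n k (C k) t))
    = ennreal (e / (\<xi> * (1 - q)))" .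
qed

lemma CL_powr: "0 \<le> \<xi> \<Longrightarrow> x\<^sub>0 < ereal x \<Longrightarrow> CL_transform \<rho> \<xi> x powr h = exp (- h * \<Psi> \<xi> x)"
  by (simp add: CL_transform_eq_exp powr_def)

lemma laplace_D_powr: "0 \<le> \<xi> \<Longrightarrow> laplace_D \<rho> \<xi> powr h = exp (- h * \<Psi>\<^sub>D \<xi>)"
  by (simp add: laplace_D_eq_exp powr_def)

lemma grid_Suc_diff: "grid n (Suc k) - grid n k = 1 / 2 ^ n"
  by (simp add: grid_def field_simps)

lemma grid_less: "grid n k < grid n (Suc k)"
  by (simp add: grid_def divide_strict_right_mono)

lemma exp_grid: "exp (- grid n k * y) = exp (- y / 2 ^ n) ^ k"
  by (simp add: grid_def exp_of_nat_mult[symmetric])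

lemma transform_start_below:
  assumes "0 < \<xi>" "x\<^sub>0 < ereal x"
  shows "start_weight \<xi> n k (below x n k) = exp (- \<Psi> \<xi> x / 2 ^ n) ^ k"
proof (cases k)
  case 0
  then show ?thesis by (simp add: start_0 below_0 prob_space)
next
  case (Suc j)
  have "(\<integral>\<omega>. exp (- (\<xi> * D (grid n (Suc j)) \<omega>)) * indicator {\<omega>. A (grid n (Suc j)) \<omega> \<le> x} \<omega> \<partial>N) = exp (- grid n (Suc j) * \<Psi> \<xi> x)"
    using assms grid_pos by (subst transform_1) (auto simp: CL_powr)
  then show ?thesis unfolding Suc exp_grid by (simp add: start_Suc below_Suc)
qed

text \<open>The increment over the cell is free of the constraint, hence the extra factor with \<open>\<Psi>\<^sub>D\<close>.\<close>

lemma transform_next_start_below: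
  assumes "0 < \<xi>" "x\<^sub>0 < ereal x"
  shows "start_weight \<xi> n (Suc k) (below x n k)
    = exp (- \<Psi> \<xi> x / 2 ^ n) ^ k * exp (- \<Psi>\<^sub>D \<xi> / 2 ^ n)"
proof (cases k)
  case 0
  have "(\<integral>\<omega>. exp (- (\<xi> * D (grid n (Suc 0)) \<omega>)) \<partial>N) = exp (- grid n (Suc 0) * \<Psi>\<^sub>D \<xi>)"
    using assms by (subst transform_D_1[OF grid_pos]) (auto simp: laplace_D_powr)
  then show ?thesis unfolding 0 exp_grid by (simp add: start_Suc below_0)
next
  case (Suc j)
  have "(\<integral>\<omega>. exp (- (0 * D (grid n (Suc j)) \<omega> + \<xi> * D (grid n (Suc (Suc j))) \<omega>)) * indicator {\<omega>. A (grid n (Suc j)) \<omega> \<le> x} \<omega> \<partial>N)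
      = exp (- grid n (Suc j) * \<Psi> \<xi> x) * exp (- (1 / 2 ^ n) * \<Psi>\<^sub>D \<xi>)"
    using assms by (subst transform_2_marginal[OF grid_pos grid_less]) (auto simp: CL_powr laplace_D_powr grid_Suc_diff)
  then show ?thesis unfolding Suc exp_grid by (simp add: start_Suc below_Suc)
qed

text \<open>Here the last cell contributes a constraint on the maximum but no weight for \<open>D\<close>, hence the
  extra factor with \<open>\<Psi>(0, x)\<close>.\<close>

lemma transform_start_next_below:
  assumes "0 < \<xi>" "x\<^sub>0 < ereal x"
  shows "start_weight \<xi> n k (below x n (Suc k))
    = exp (- \<Psi> \<xi> x / 2 ^ n) ^ k * exp (- \<Psi> 0 x / 2 ^ n)"
proof (cases k)
  case 0
  have "(\<integral>\<omega>. exp (- (0 * D (grid n (Suc 0)) \<omega>)) * indicator {\<omega>. A (grid n (Suc 0)) \<omega> \<le> x} \<omega> \<partial>N) = exp (- grid n (Suc 0) * \<Psi> 0 x)"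
    using assms by (subst transform_1[OF grid_pos]) (auto simp: CL_powr)
  then show ?thesis unfolding 0 exp_grid by (simp add: start_0 below_Suc)
next
  case (Suc j)
  \<comment> \<open>The constraint at the later time implies the one at the earlier time, which \<open>transform_2\<close> also asks for.\<close>
  have mono: "AE \<omega> in N. A (grid n (Suc (Suc j))) \<omega> \<le> x \<longrightarrow> A (grid n (Suc j)) \<omega> \<le> x"
    using AE_A_mono[OF grid_pos grid_less, of n j] by eventually_elim auto
  have "start_weight \<xi> n k (below x n (Suc k))
    = (\<integral>\<omega>. exp (- (\<xi> * D (grid n (Suc j)) \<omega> + 0 * D (grid n (Suc (Suc j))) \<omega>)) * indicator {\<omega>. A (grid n (Suc j)) \<omega> \<le> x \<and> A (grid n (Suc (Suc j))) \<omega> \<le> x} \<omega> \<partial>N)"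
  proof (rule integral_cong_AE)
    show "AE \<omega> in N. exp (- \<xi> * start n k \<omega>) * indicator {\<omega>. below x n (Suc k) \<omega>} \<omega>
      = exp (- (\<xi> * D (grid n (Suc j)) \<omega> + 0 * D (grid n (Suc (Suc j))) \<omega>)) * indicator {\<omega>. A (grid n (Suc j)) \<omega> \<le> x \<and> A (grid n (Suc (Suc j))) \<omega> \<le> x} \<omega>"
      using mono by eventually_elim (auto simp: Suc start_Suc below_Suc split: split_indicator)
  qed (auto simp: Suc start_Suc below_Suc)
  also have "\<dots> = exp (- grid n (Suc j) * \<Psi> \<xi> x) * exp (- (1 / 2 ^ n) * \<Psi> 0 x)"
    using assms by (subst transform_2[OF grid_pos grid_less]) (auto simp: CL_powr grid_Suc_diff)
  finally show ?thesis unfolding Suc exp_grid by simp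
qed

lemma laplace_before_grid:
  assumes "0 < \<xi>" "x\<^sub>0 < ereal x"
  shows "laplace_nn \<xi> (\<lambda>t. emeasure N (before_grid x n t))
    = ennreal ((1 - exp (- \<Psi>\<^sub>D \<xi> / 2 ^ n)) / (\<xi> * (1 - exp (- \<Psi> \<xi> x / 2 ^ n))))" (is ?lap)
    and "(\<lambda>t. emeasure N (before_grid x n t) * indicator {0<..} t) \<in> borel_measurable borel" (is ?meas)
proof -
  let ?p = "\<lambda>t. \<Sum>k. cell_mass n k (below x n k) t"
  have q: "0 \<le> exp (- \<Psi> \<xi> x / 2 ^ n)" "exp (- \<Psi> \<xi> x / 2 ^ n) < 1"
    using Psi_pos[OF assms] by auto
  have summand: "start_weight \<xi> n k (below x n k)
      - start_weight \<xi> n (Suc k) (below x n k)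
      = (1 - exp (- \<Psi>\<^sub>D \<xi> / 2 ^ n)) * exp (- \<Psi> \<xi> x / 2 ^ n) ^ k" for k
    unfolding transform_start_below[OF assms] transform_next_start_below[OF assms]
    by (simp add: left_diff_distrib)
  note sum = laplace_crossing_sum[where n = n and C = "below x n", OF assms(1) measurable_below summand q]
  have "laplace_nn \<xi> (\<lambda>t. emeasure N (before_grid x n t)) = laplace_nn \<xi> ?p"
    by (intro nn_integral_cong) (auto simp: emeasure_before_grid split: split_indicator)
  then show ?lap
    unfolding sum(1) .
  have "(\<lambda>t. emeasure N (before_grid x n t) * indicator {0<..} t) = (\<lambda>t. ?p t * indicator {0<..} t)"
    by (auto simp: fun_eq_iff emeasure_before_grid split: split_indicator)
  then show ?meas using sum(2) by simp
qed

lemma laplace_after_grid: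
  assumes "0 < \<xi>" "x\<^sub>0 < ereal x"
  shows "laplace_nn \<xi> (\<lambda>t. emeasure N (after_grid x n t))
    = ennreal ((exp (- \<Psi> 0 x / 2 ^ n) - exp (- \<Psi> \<xi> x / 2 ^ n)) / (\<xi> * (1 - exp (- \<Psi> \<xi> x / 2 ^ n))))" (is ?lap)
    and "(\<lambda>t. emeasure N (after_grid x n t) * indicator {0<..} t) \<in> borel_measurable borel" (is ?meas)
proof -
  let ?p = "\<lambda>t. \<Sum>k. cell_mass n k (below x n (Suc k)) t"
  have q: "0 \<le> exp (- \<Psi> \<xi> x / 2 ^ n)" "exp (- \<Psi> \<xi> x / 2 ^ n) < 1"
    using Psi_pos[OF assms] by auto
  have summand: "start_weight \<xi> n k (below x n (Suc k))
      - start_weight \<xi> n (Suc k) (below x n (Suc k))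
      = (exp (- \<Psi> 0 x / 2 ^ n) - exp (- \<Psi> \<xi> x / 2 ^ n)) * exp (- \<Psi> \<xi> x / 2 ^ n) ^ k" for k
    unfolding transform_start_below[OF assms] transform_start_next_below[OF assms]
    by (simp add: left_diff_distrib)
  note sum = laplace_crossing_sum[where n = n and C = "\<lambda>k. below x n (Suc k)", OF assms(1) measurable_below summand q]
  have "laplace_nn \<xi> (\<lambda>t. emeasure N (after_grid x n t)) = laplace_nn \<xi> ?p"
    by (intro nn_integral_cong) (auto simp: emeasure_after_grid split: split_indicator)
  then show ?lap
    unfolding sum(1) .
  have "(\<lambda>t. emeasure N (after_grid x n t) * indicator {0<..} t) = (\<lambda>t. ?p t * indicator {0<..} t)"
    by (auto simp: fun_eq_iff emeasure_after_grid split: split_indicator)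
  then show ?meas using sum(2) by simp
qed

text \<open>As long as \<open>D\<close> has not exceeded \<open>t\<close>, the maximum has not exceeded \<open>x\<close>: up to
  the treatment of equality, the event \<open>A(E(t)-)\<^sup>+ \<le> x\<close>.\<close>

definition before :: "real \<Rightarrow> real \<Rightarrow> 'c set" where
  "before x t = (\<Inter>n. before_grid x n t)"

text \<open>At some time at which \<open>D\<close> has exceeded \<open>t\<close>, the maximum has not exceeded \<open>x\<close>: up to
  the treatment of equality, the event \<open>A(E(t)) \<le> x\<close>.\<close>

definition after :: "real \<Rightarrow> real \<Rightarrow> 'c set" where
  "after x t = (\<Union>n. after_grid x n t)"

lemma sets_before [measurable]: "before x t \<in> sets N"
  and sets_after [measurable]: "after x t \<in> sets N"
  unfolding before_def after_def by auto

lemma before_grid_decseq: "decseq (\<lambda>n. before_grid x n t)"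
proof (rule decseq_SucI, rule subsetI)
  fix n \<omega> assume \<omega>: "\<omega> \<in> before_grid x (Suc n) t"
  have "D (grid n (Suc k)) \<omega> \<le> t \<longrightarrow> A (grid n (Suc k)) \<omega> \<le> x" for k
    using \<omega> unfolding before_grid_def grid_refine[of n "Suc k"] by simp
  then show "\<omega> \<in> before_grid x n t" using \<omega> by (simp add: before_grid_def)
qed

lemma after_grid_incseq: "incseq (\<lambda>n. after_grid x n t)"
proof (rule incseq_SucI, rule subsetI)
  fix n \<omega> assume \<omega>: "\<omega> \<in> after_grid x n t"
  then obtain k where "t < D (grid n (Suc k)) \<omega>" "A (grid n (Suc k)) \<omega> \<le> x"
    by (auto simp: after_grid_def)
  then have "t < D (grid (Suc n) (Suc (2 * k + 1))) \<omega>" "A (grid (Suc n) (Suc (2 * k + 1))) \<omega> \<le> x"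
    using grid_refine[of n "Suc k"] by simp_all
  then show "\<omega> \<in> after_grid x (Suc n) t" using \<omega> unfolding after_grid_def by blast
qed

lemma exp_quotient_limit:
  fixes u v w :: real
  assumes "0 < w"
  shows "(\<lambda>n. (exp (- u / 2 ^ n) - exp (- v / 2 ^ n)) / (\<xi> * (1 - exp (- w / 2 ^ n)))) \<longlonglongrightarrow> (v - u) / (\<xi> * w)"
proof -
  have slope: "(\<lambda>n. (1 - exp (- c / 2 ^ n)) * 2 ^ n) \<longlonglongrightarrow> c" for c :: real
    by real_asymp
  have "(\<lambda>n. ((1 - exp (- v / 2 ^ n)) * 2 ^ n - (1 - exp (- u / 2 ^ n)) * 2 ^ n) / ((1 - exp (- w / 2 ^ n)) * 2 ^ n) / \<xi>)
      \<longlonglongrightarrow> (v - u) / w / \<xi>"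
    using assms by (cases "\<xi> = 0") (auto intro!: tendsto_intros slope[simplified])
  moreover have "((1 - exp (- v / 2 ^ n)) * 2 ^ n - (1 - exp (- u / 2 ^ n)) * 2 ^ n) / ((1 - exp (- w / 2 ^ n)) * 2 ^ n) / \<xi>
      = (exp (- u / 2 ^ n) - exp (- v / 2 ^ n)) / (\<xi> * (1 - exp (- w / 2 ^ n)))" for n :: nat
    unfolding left_diff_distrib[symmetric] by (simp add: mult.commute[of \<xi>])
  ultimately show ?thesis by (simp add: mult.commute)
qed

lemma laplace_before:
  assumes "0 < \<xi>" "x\<^sub>0 < ereal x"
  shows "laplace_nn \<xi> (\<lambda>t. emeasure N (before x t)) = ennreal (\<Psi>\<^sub>D \<xi> / (\<xi> * \<Psi> \<xi> x))"
proof (rule laplace_limit(1)[OF assms(1), where p = "\<lambda>n t. emeasure N (before_grid x n t)"])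
  show "(\<lambda>n. emeasure N (before_grid x n t)) \<longlonglongrightarrow> emeasure N (before x t)" for t
    unfolding before_def using before_grid_decseq by (intro Lim_emeasure_decseq) auto
  show "(\<lambda>n. (1 - exp (- \<Psi>\<^sub>D \<xi> / 2 ^ n)) / (\<xi> * (1 - exp (- \<Psi> \<xi> x / 2 ^ n)))) \<longlonglongrightarrow> \<Psi>\<^sub>D \<xi> / (\<xi> * \<Psi> \<xi> x)"
    using exp_quotient_limit[OF Psi_pos[OF assms], of 0 "\<Psi>\<^sub>D \<xi>" \<xi>] by simp
qed (use laplace_before_grid[OF assms] in \<open>auto intro: emeasure_le_1\<close>)

lemma laplace_after:
  assumes "0 < \<xi>" "x\<^sub>0 < ereal x"
  shows "laplace_nn \<xi> (\<lambda>t. emeasure N (after x t)) = ennreal ((\<Psi> \<xi> x - \<Psi> 0 x) / (\<xi> * \<Psi> \<xi> x))"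
    and "(\<lambda>t. emeasure N (after x t) * indicator {0<..} t) \<in> borel_measurable borel"
proof -
  have lim: "(\<lambda>n. emeasure N (after_grid x n t)) \<longlonglongrightarrow> emeasure N (after x t)" for t
    unfolding after_def using after_grid_incseq by (intro Lim_emeasure_incseq) auto
  note limit = laplace_limit[OF assms(1) laplace_after_grid(2)[OF assms] emeasure_le_1 lim laplace_after_grid(1)[OF assms]
      exp_quotient_limit[OF Psi_pos[OF assms]]]
  show "laplace_nn \<xi> (\<lambda>t. emeasure N (after x t)) = ennreal ((\<Psi> \<xi> x - \<Psi> 0 x) / (\<xi> * \<Psi> \<xi> x))"
    by (rule limit(1))
  show "(\<lambda>t. emeasure N (after x t) * indicator {0<..} t) \<in> borel_measurable borel"
    by (rule limit(2))
qed

text \<open>An upper bound for the event \<open>A(E(t)) \<le> x\<close>, which allows the maximum to rise above \<open>x\<close> immediately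
  after \<open>E(t)\<close>.\<close>

definition after_limit :: "real \<Rightarrow> real \<Rightarrow> 'c set" where
  "after_limit x t = (\<Inter>j. after (x + 1 / real (Suc j)) t)"

lemma sets_after_limit [measurable]: "after_limit x t \<in> sets N"
  unfolding after_limit_def by auto

lemma Psi_right_continuous:
  assumes "0 \<le> \<xi>" "x\<^sub>0 < ereal x"
  shows "(\<lambda>j. \<Psi> \<xi> (x + 1 / real (Suc j))) \<longlonglongrightarrow> \<Psi> \<xi> x"
proof -
  have above: "x\<^sub>0 < ereal (x + 1 / real (Suc j))" for j
    by (rule less_le_trans[OF assms(2)]) simp
  have eq: "\<Psi> \<xi> y = - ln (CL_transform \<rho> \<xi> y)" if "x\<^sub>0 < ereal y" for y
    using CL_transform_eq_exp(1)[OF assms(1) that] by simp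
  have "(\<lambda>j. - ln (CL_transform \<rho> \<xi> (x + 1 / real (Suc j)))) \<longlonglongrightarrow> - ln (CL_transform \<rho> \<xi> x)"
    using CL_transform_eq_exp(1)[OF assms]
    by (intro tendsto_minus tendsto_ln CL_right_continuous assms) auto
  then show ?thesis unfolding eq[OF assms(2)] eq[OF above] .
qed

lemma laplace_after_limit:
  assumes "0 < \<xi>" "x\<^sub>0 < ereal x"
  shows "laplace_nn \<xi> (\<lambda>t. emeasure N (after_limit x t)) = ennreal ((\<Psi> \<xi> x - \<Psi> 0 x) / (\<xi> * \<Psi> \<xi> x))"
proof (rule laplace_limit(1)[OF assms(1), where p = "\<lambda>j t. emeasure N (after (x + 1 / real (Suc j)) t)"])
  have above: "x\<^sub>0 < ereal (x + 1 / real (Suc j))" for j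
    by (rule less_le_trans[OF assms(2)]) simp
  show "(\<lambda>j. emeasure N (after (x + 1 / real (Suc j)) t)) \<longlonglongrightarrow> emeasure N (after_limit x t)" for t
    unfolding after_limit_def
  proof (intro Lim_emeasure_decseq)
    show "decseq (\<lambda>j. after (x + 1 / real (Suc j)) t)"
    proof (rule decseq_SucI)
      fix j
      have "1 / real (Suc (Suc j)) \<le> 1 / real (Suc j)" by (simp add: frac_le)
      then show "after (x + 1 / real (Suc (Suc j))) t \<subseteq> after (x + 1 / real (Suc j)) t"
        unfolding after_def after_grid_def by fastforce
    qed
  qed auto
  show "laplace_nn \<xi> (\<lambda>t. emeasure N (after (x + 1 / real (Suc j)) t))
      = ennreal ((\<Psi> \<xi> (x + 1 / real (Suc j)) - \<Psi> 0 (x + 1 / real (Suc j))) / (\<xi> * \<Psi> \<xi> (x + 1 / real (Suc j))))"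
    "(\<lambda>t. emeasure N (after (x + 1 / real (Suc j)) t) * indicator {0<..} t) \<in> borel_measurable borel" for j
    by (rule laplace_after[OF assms(1) above])+
  show "(\<lambda>j. (\<Psi> \<xi> (x + 1 / real (Suc j)) - \<Psi> 0 (x + 1 / real (Suc j))) / (\<xi> * \<Psi> \<xi> (x + 1 / real (Suc j))))
      \<longlonglongrightarrow> (\<Psi> \<xi> x - \<Psi> 0 x) / (\<xi> * \<Psi> \<xi> x)"
    using assms Psi_pos[OF assms] by (intro tendsto_intros Psi_right_continuous) auto
qed (rule emeasure_le_1)

lemma before_antimono: "s \<le> t \<Longrightarrow> before x t \<subseteq> before x s"
  unfolding before_def before_grid_def by (auto intro: order_trans)

lemma after_antimono: "s \<le> t \<Longrightarrow> after x t \<subseteq> after x s"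
  unfolding after_def after_grid_def by (auto intro: order.strict_trans1)

lemma laplace_jump_cover_before:
  assumes "0 < \<xi>" "x\<^sub>0 < ereal x"
  shows "start_transform \<xi> (\<lambda>p. A (fst p) (snd p) \<le> x)
      * size_transform \<xi> (\<lambda>_. True) * ennreal (1 / \<xi>)
      = ennreal (\<Psi>\<^sub>D \<xi> / (\<xi> * \<Psi> \<xi> x))"
proof -
  have "size_transform \<xi> (\<lambda>_. True) = ennreal (\<Psi>\<^sub>D \<xi>)"
    unfolding nn_integral_Phi_D[OF less_imp_le[OF assms(1)], symmetric] by (intro nn_integral_cong) (simp add: indicator_def)
  then show ?thesis
    unfolding laplace_potential_le[OF assms] using Psi_pos[OF assms] Psi_D_pos[OF assms(1)] assms(1)
    by (simp add: ennreal_mult'[symmetric] ennreal_mult''[symmetric] field_simps)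
qed

lemma laplace_jump_cover_after:
  assumes "0 < \<xi>" "x\<^sub>0 < ereal x"
  shows "start_transform \<xi> (\<lambda>p. A (fst p) (snd p) \<le> x)
      * size_transform \<xi> (\<lambda>p. snd p \<le> ereal x) * ennreal (1 / \<xi>)
      = ennreal ((\<Psi> \<xi> x - \<Psi> 0 x) / (\<xi> * \<Psi> \<xi> x))"
  unfolding laplace_potential_le[OF assms] nn_integral_Phi_le[OF less_imp_le[OF assms(1)] assms(2)]
  using Psi_pos[OF assms] assms(1)
  by (simp add: ennreal_mult'[symmetric] ennreal_mult''[symmetric] field_simps)

text \<open>The last two parts express continuity in \<open>t\<close>.\<close>

lemma prob_before:
  assumes "x\<^sub>0 < ereal x" "0 < t"
  shows "ennreal (prob (before x t)) = jump_cover (\<lambda>p. A (fst p) (snd p) \<le> x) (\<lambda>_. True) t"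
    and "(\<And>u. t < u \<Longrightarrow> prob (before x u) \<le> b) \<Longrightarrow> prob (before x t) \<le> b"
    and "(\<And>u. 0 < u \<Longrightarrow> u < t \<Longrightarrow> b \<le> prob (before x u)) \<Longrightarrow> b \<le> prob (before x t)"
proof -
  have lap: "laplace_nn \<xi> (\<lambda>t. ennreal (prob (before x t)))
      = start_transform \<xi> (\<lambda>p. A (fst p) (snd p) \<le> x)
      * size_transform \<xi> (\<lambda>_. True) * ennreal (1 / \<xi>)" if "0 < \<xi>" for \<xi>
    unfolding laplace_jump_cover_before[OF that assms(1)] laplace_before[OF that assms(1), symmetric]
    by (simp add: emeasure_eq_measure)
  have mono: "prob (before x t) \<le> prob (before x s)" if "s \<le> t" for s t
    using before_antimono[OF that] by (intro finite_measure_mono) auto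
  note * = antimono_eq_jump_cover[where g = "\<lambda>t. prob (before x t)", OF _ _ mono measure_nonneg prob_le_1 lap \<open>0 < t\<close>]
  show "ennreal (prob (before x t)) = jump_cover (\<lambda>p. A (fst p) (snd p) \<le> x) (\<lambda>_. True) t"
    by (rule *(1)) auto
  show "prob (before x t) \<le> b" if "\<And>u. t < u \<Longrightarrow> prob (before x u) \<le> b"
    by (rule *(2)) (use that in auto)
  show "b \<le> prob (before x t)" if "\<And>u. 0 < u \<Longrightarrow> u < t \<Longrightarrow> b \<le> prob (before x u)"
    by (rule *(3)) (use that in auto)
qed

text \<open>The exponents are right-continuous in \<open>x\<close>, so the enlarged event \<open>after_limit x t\<close> has the same transform as
  \<open>after x t\<close>, and hence the same probability.\<close>

lemma prob_after:
  assumes "x\<^sub>0 < ereal x" "0 < t" and E: "E = after x \<or> E = after_limit x"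
  shows "ennreal (prob (E t)) = jump_cover (\<lambda>p. A (fst p) (snd p) \<le> x) (\<lambda>p. snd p \<le> ereal x) t"
proof (rule antimono_eq_jump_cover(1)[where g = "\<lambda>t. prob (E t)"])
  show "laplace_nn \<xi> (\<lambda>t. ennreal (prob (E t)))
      = start_transform \<xi> (\<lambda>p. A (fst p) (snd p) \<le> x) * size_transform \<xi> (\<lambda>p. snd p \<le> ereal x) * ennreal (1 / \<xi>)"
    if "0 < \<xi>" for \<xi>
    using E laplace_after(1)[OF that assms(1)] laplace_after_limit[OF that assms(1)]
    unfolding laplace_jump_cover_after[OF that assms(1)] by (auto simp: emeasure_eq_measure)
  have "E t \<subseteq> E s" if "s \<le> t" for s t
  proof -
    have "after_limit x t \<subseteq> after_limit x s"
      unfolding after_limit_def using after_antimono[OF that] by blast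
    then show ?thesis using E after_antimono[OF that] by blast
  qed
  moreover have [measurable]: "E t \<in> sets N" for t using E by auto
  ultimately show "prob (E t) \<le> prob (E s)" if "s \<le> t" for s t
    using that by (intro finite_measure_mono) auto
qed (use assms in auto)

end

section \<open>The limit processes at first passage\<close>

lemma grid_dense:
  assumes "0 \<le> a" "a < b"
  obtains n k where "a < grid n (Suc k)" "grid n (Suc k) < b"
proof -
  obtain n where n: "(1 / 2 :: real) ^ n < b - a"
    using real_arch_pow_inv[of "b - a" "1 / 2"] assms by auto
  define k where "k = nat \<lfloor>a * 2 ^ n\<rfloor>"
  have "real k = of_int \<lfloor>a * 2 ^ n\<rfloor>" using assms by (simp add: k_def)
  then have k: "a * 2 ^ n < real k + 1" "real k \<le> a * 2 ^ n" by linarith+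
  have "grid n (Suc k) \<le> a + 1 / 2 ^ n" using k(2) by (simp add: grid_def field_simps)
  moreover have "a < grid n (Suc k)" using k(1) by (simp add: grid_def field_simps)
  ultimately show ?thesis using n that by (force simp: power_one_over)
qed

text \<open>Two measurable events of equal probability enclose \<open>{X \<le> x}\<close> up to null sets, which makes this
  set measurable for the completion.\<close>

lemma (in prob_space) dist_fun_sandwich:
  assumes [measurable]: "U \<in> sets M" "V \<in> sets M"
    and lower: "AE \<omega> in M. \<omega> \<in> U \<longrightarrow> X \<omega> \<le> x" and upper: "AE \<omega> in M. X \<omega> \<le> x \<longrightarrow> \<omega> \<in> V"
    and eq: "prob U = prob V"
  shows "dist_fun M X x = prob U"
proof -
  have ae_UV: "AE \<omega> in M. \<omega> \<in> U \<longrightarrow> \<omega> \<in> V" using lower upper by eventually_elim auto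
  have "prob (U \<inter> V) = prob U"
    using ae_UV by (intro finite_measure_eq_AE) (auto elim: eventually_mono)
  then have "prob (V - U) = 0"
    using eq by (subst finite_measure_Diff') (auto simp: Int_commute)
  then have null: "emeasure M (V - U) = 0" by (simp add: emeasure_eq_measure)
  have ae_VU: "AE \<omega> in M. \<omega> \<in> V \<longrightarrow> \<omega> \<in> U"
    using sets.sets_into_space[OF assms(2)]
    by (subst AE_iff_measurable[where N = "V - U"]) (use null in auto)
  have "AE \<omega> in M. \<omega> \<in> U \<longleftrightarrow> \<omega> \<in> {\<omega> \<in> space M. X \<omega> \<le> x}"
    using lower upper ae_VU AE_space by eventually_elim auto
  then have ae: "AE \<omega> in completion M. \<omega> \<in> U \<longleftrightarrow> \<omega> \<in> {\<omega> \<in> space M. X \<omega> \<le> x}"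
    by (rule AE_completion)
  have "{\<omega> \<in> space M. X \<omega> \<le> x} \<in> sets (completion M)"
    by (rule completion.in_sets_AE[OF ae]) auto
  then have "measure (completion M) {\<omega> \<in> space M. X \<omega> \<le> x} = measure (completion M) U"
    using ae by (intro measure_eq_AE) (auto elim: eventually_mono)
  then show ?thesis by (simp add: dist_fun_def)
qed

context stable_sum_max_setting
begin

subsection \<open>First passage\<close>

lemma good_path_D_mono: "good_path \<omega> \<Longrightarrow> 0 < u \<Longrightarrow> u \<le> s \<Longrightarrow> D u \<omega> \<le> D s \<omega>"
  by (auto simp: good_path_def monotone_path_def)

lemma good_path_A_mono: "good_path \<omega> \<Longrightarrow> 0 < u \<Longrightarrow> u \<le> s \<Longrightarrow> A u \<omega> \<le> A s \<omega>"
  by (auto simp: good_path_def monotone_path_def)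

lemma good_path_space: "good_path \<omega> \<Longrightarrow> \<omega> \<in> space N"
  by (auto simp: good_path_def)

lemma first_passage_le: "0 < s \<Longrightarrow> t < D s \<omega> \<Longrightarrow> first_passage D t \<omega> \<le> s"
  unfolding first_passage_def by (intro cInf_lower bdd_belowI[where m = 0]) auto

lemma passage_set_nonempty: "good_path \<omega> \<Longrightarrow> {s. 0 < s \<and> t < D s \<omega>} \<noteq> {}"
proof -
  assume "good_path \<omega>"
  then obtain k where "t < D (real (Suc k)) \<omega>" by (auto simp: good_path_def)
  then have "real (Suc k) \<in> {s. 0 < s \<and> t < D s \<omega>}" by simp
  then show ?thesis by blast
qed

lemma first_passage_pos:
  assumes "good_path \<omega>" "0 < t"
  shows "0 < first_passage D t \<omega>"
proof -
  obtain n where n: "D (1 / 2 ^ n) \<omega> < t" using assms by (auto simp: good_path_def)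
  have "1 / 2 ^ n \<le> first_passage D t \<omega>"
    unfolding first_passage_def
  proof (rule cInf_greatest[OF passage_set_nonempty[OF assms(1)]])
    fix s assume s: "s \<in> {s. 0 < s \<and> t < D s \<omega>}"
    show "1 / 2 ^ n \<le> s"
      using good_path_D_mono[OF assms(1), of s "1 / 2 ^ n"] s n by (cases "1 / 2 ^ n \<le> s") auto
  qed
  then show ?thesis by (rule less_le_trans[rotated]) simp
qed

lemma passed_after_first_passage:
  assumes "good_path \<omega>" "first_passage D t \<omega> < s"
  shows "t < D s \<omega>"
proof -
  obtain u where u: "0 < u" "t < D u \<omega>" "u < s"
    using cInf_lessD[OF passage_set_nonempty[OF assms(1)], of t s] assms(2) by (auto simp: first_passage_def)
  then show ?thesis using good_path_D_mono[OF assms(1), of u s] by auto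
qed

lemma less_first_passage:
  assumes "good_path \<omega>" "0 < q" "D q \<omega> < t"
  shows "q < first_passage D t \<omega>"
proof -
  have "eventually (\<lambda>r. D r \<omega> < t) (at_right q)"
    using D_right_continuous[OF good_path_space[OF assms(1)] assms(2)] assms(3) by (rule order_tendstoD)
  then obtain b where b: "q < b" "\<And>r. q < r \<Longrightarrow> r < b \<Longrightarrow> D r \<omega> < t"
    by (auto simp: eventually_at_right_field)
  obtain r where r: "q < r" "r < b" using dense[OF b(1)] by blast
  have "\<not> first_passage D t \<omega> < r"
    using passed_after_first_passage[OF assms(1), of t r] b(2)[OF r] by auto
  then show ?thesis using r by simp
qed

lemma first_passage_mono:
  assumes "good_path \<omega>" "t \<le> r"
  shows "first_passage D t \<omega> \<le> first_passage D r \<omega>"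
  unfolding first_passage_def using assms(2)
  by (intro cInf_superset_mono passage_set_nonempty[OF assms(1)] bdd_belowI[where m = 0]) auto

subsection \<open>The limit processes on a good path\<close>

lemma left_limit_tendsto:
  assumes "good_path \<omega>" "0 < s"
  shows "((\<lambda>r. A r \<omega>) \<longlongrightarrow> left_limit A s \<omega>) (at_left s)"
proof -
  obtain l where "((\<lambda>t. (D t \<omega>, A t \<omega>)) \<longlongrightarrow> l) (at_left s)"
    using path_cadlag[OF good_path_space[OF assms(1)]] assms(2) unfolding cadlag_def by blast
  then have "((\<lambda>t. A t \<omega>) \<longlongrightarrow> snd l) (at_left s)" using tendsto_snd by fastforce
  moreover from this have "left_limit A s \<omega> = snd l"
    unfolding left_limit_def by (intro tendsto_Lim) auto
  ultimately show ?thesis by simp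
qed

lemma A_le_left_limit:
  assumes "good_path \<omega>" "0 < q" "q < s"
  shows "A q \<omega> \<le> left_limit A s \<omega>"
proof (rule tendsto_lowerbound[OF left_limit_tendsto[OF assms(1)]])
  show "\<forall>\<^sub>F r in at_left s. A q \<omega> \<le> A r \<omega>"
    using eventually_at_left_real[OF assms(3)] by eventually_elim (use good_path_A_mono[OF assms(1,2)] in auto)
qed (use assms in auto)

lemma left_limit_le:
  assumes "good_path \<omega>" "0 < s" and bound: "\<And>q. 0 < q \<Longrightarrow> q < s \<Longrightarrow> A q \<omega> \<le> b"
  shows "left_limit A s \<omega> \<le> b"
proof (rule tendsto_upperbound[OF left_limit_tendsto[OF assms(1,2)]])
  show "\<forall>\<^sub>F r in at_left s. A r \<omega> \<le> b"
    using eventually_at_left_real[OF assms(2)] by eventually_elim (use bound in auto)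
qed simp

text \<open>The left limits of \<open>A\<close> at \<open>E(r)\<close> increase with \<open>r\<close>, so the limit from the right exists and is an infimum.\<close>

lemma CTRM_limit_eq_Inf:
  assumes "good_path \<omega>" "0 < t"
  shows "CTRM_limit D A t \<omega> = Inf ((\<lambda>r. left_limit A (first_passage D r \<omega>) \<omega>) ` {t<..})"
    and "bdd_below ((\<lambda>r. left_limit A (first_passage D r \<omega>) \<omega>) ` {t<..})"
proof -
  let ?f = "\<lambda>r. left_limit A (first_passage D r \<omega>) \<omega>"
  have mono: "?f r \<le> ?f r'" if "t \<le> r" "r \<le> r'" for r r'
  proof (rule left_limit_le[OF assms(1)])
    show "0 < first_passage D r \<omega>" using that assms by (intro first_passage_pos) auto
    show "A q \<omega> \<le> ?f r'" if "0 < q" "q < first_passage D r \<omega>" for q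
      using that first_passage_mono[OF assms(1) \<open>r \<le> r'\<close>] by (intro A_le_left_limit[OF assms(1)]) auto
  qed
  show bdd: "bdd_below (?f ` {t<..})" by (rule bdd_belowI[where m = "?f t"]) (auto intro: mono)
  have "(?f \<longlongrightarrow> Inf (?f ` {t<..})) (at_right t)"
  proof (rule order_tendstoI)
    fix a assume a: "a < Inf (?f ` {t<..})"
    have "a < ?f r" if "t < r" for r
      by (rule less_le_trans[OF a cInf_lower[OF _ bdd]]) (use that in auto)
    then show "\<forall>\<^sub>F r in at_right t. a < ?f r"
      by (auto simp: eventually_at_filter intro!: always_eventually)
  next
    fix a assume "Inf (?f ` {t<..}) < a"
    then obtain r where r: "t < r" "?f r < a" using cInf_lessD[of "?f ` {t<..}" a] by auto
    show "\<forall>\<^sub>F r' in at_right t. ?f r' < a"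
      using eventually_at_right_real[OF r(1)]
    proof eventually_elim
      case (elim r')
      then have "?f r' \<le> ?f r" by (intro mono) auto
      then show ?case using r(2) by simp
    qed
  qed
  then show "CTRM_limit D A t \<omega> = Inf (?f ` {t<..})"
    unfolding CTRM_limit_def by (intro tendsto_Lim) auto
qed

lemma before_iff:
  "\<omega> \<in> before x t \<longleftrightarrow> \<omega> \<in> space N \<and> (\<forall>n k. D (grid n (Suc k)) \<omega> \<le> t \<longrightarrow> A (grid n (Suc k)) \<omega> \<le> x)"
  by (auto simp: before_def before_grid_def)

lemma after_iff:
  "\<omega> \<in> after x t \<longleftrightarrow> \<omega> \<in> space N \<and> (\<exists>n k. t < D (grid n (Suc k)) \<omega> \<and> A (grid n (Suc k)) \<omega> \<le> x)"
  by (auto simp: after_def after_grid_def)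

text \<open>Some room between \<open>t\<close> and \<open>r\<close> is needed, as the limit is taken over levels strictly above \<open>t\<close>.\<close>

lemma CTRM_limit_le_if_before:
  assumes "good_path \<omega>" "0 < t" "t < r" "\<omega> \<in> before x r"
  shows "CTRM_limit D A t \<omega> \<le> x"
proof -
  have "0 < r" using assms by simp
  have "CTRM_limit D A t \<omega> \<le> left_limit A (first_passage D r \<omega>) \<omega>"
    unfolding CTRM_limit_eq_Inf(1)[OF assms(1,2)] using assms(3)
    by (intro cInf_lower CTRM_limit_eq_Inf(2)[OF assms(1,2)]) auto
  also have "\<dots> \<le> x"
  proof (rule left_limit_le[OF assms(1) first_passage_pos[OF assms(1) \<open>0 < r\<close>]])
    fix q assume q: "0 < q" "q < first_passage D r \<omega>"
    obtain n k where g: "q < grid n (Suc k)" "grid n (Suc k) < first_passage D r \<omega>"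
      using grid_dense[OF less_imp_le[OF q(1)] q(2)] by blast
    have "\<not> r < D (grid n (Suc k)) \<omega>"
      using first_passage_le[OF grid_pos, of r n k \<omega>] g(2) by auto
    then have "A (grid n (Suc k)) \<omega> \<le> x" using assms(4) by (auto simp: before_iff)
    then show "A q \<omega> \<le> x" using good_path_A_mono[OF assms(1) q(1) less_imp_le[OF g(1)]] by simp
  qed
  finally show ?thesis .
qed

lemma before_if_CTRM_limit_le:
  assumes "good_path \<omega>" "0 < t" "s < t" "CTRM_limit D A t \<omega> \<le> x"
  shows "\<omega> \<in> before x s"
  unfolding before_iff
proof (intro conjI allI impI good_path_space[OF assms(1)])
  fix n k assume "D (grid n (Suc k)) \<omega> \<le> s"
  then have q: "grid n (Suc k) < first_passage D t \<omega>"
    using assms by (intro less_first_passage[OF assms(1) grid_pos]) auto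
  have "A (grid n (Suc k)) \<omega> \<le> CTRM_limit D A t \<omega>"
    unfolding CTRM_limit_eq_Inf(1)[OF assms(1,2)]
  proof (rule cInf_greatest)
    fix y assume "y \<in> (\<lambda>r. left_limit A (first_passage D r \<omega>) \<omega>) ` {t<..}"
    then obtain r where r: "t < r" "y = left_limit A (first_passage D r \<omega>) \<omega>" by auto
    have "grid n (Suc k) < first_passage D r \<omega>"
      using q first_passage_mono[OF assms(1), of t r] r(1) by simp
    then show "A (grid n (Suc k)) \<omega> \<le> y"
      unfolding r(2) by (intro A_le_left_limit[OF assms(1) grid_pos])
  qed auto
  then show "A (grid n (Suc k)) \<omega> \<le> x" using assms(4) by simp
qed

lemma OCTRM_limit_le_if_after:
  assumes "good_path \<omega>" "0 < t" "\<omega> \<in> after x t"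
  shows "OCTRM_limit D A t \<omega> \<le> x"
proof -
  obtain n k where g: "t < D (grid n (Suc k)) \<omega>" "A (grid n (Suc k)) \<omega> \<le> x"
    using assms(3) by (auto simp: after_iff)
  have "first_passage D t \<omega> \<le> grid n (Suc k)" by (rule first_passage_le[OF grid_pos g(1)])
  then have "A (first_passage D t \<omega>) \<omega> \<le> A (grid n (Suc k)) \<omega>"
    by (intro good_path_A_mono first_passage_pos assms)
  then show ?thesis using g(2) by (simp add: OCTRM_limit_def)
qed

text \<open>The grid need not contain \<open>E(t)\<close>, but by right continuity the maximum is still below \<open>y\<close> at grid
  points shortly after it.\<close>

lemma after_if_OCTRM_limit_less:
  assumes "good_path \<omega>" "0 < t" "OCTRM_limit D A t \<omega> < y"
  shows "\<omega> \<in> after y t"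
proof -
  have pos: "0 < first_passage D t \<omega>" by (rule first_passage_pos[OF assms(1,2)])
  have "eventually (\<lambda>r. A r \<omega> < y) (at_right (first_passage D t \<omega>))"
    using A_right_continuous[OF good_path_space[OF assms(1)] pos] assms(3)
    unfolding OCTRM_limit_def by (rule order_tendstoD)
  then obtain b where b: "first_passage D t \<omega> < b" "\<And>r. first_passage D t \<omega> < r \<Longrightarrow> r < b \<Longrightarrow> A r \<omega> < y"
    by (auto simp: eventually_at_right_field)
  obtain n k where g: "first_passage D t \<omega> < grid n (Suc k)" "grid n (Suc k) < b"
    using grid_dense[OF less_imp_le[OF pos] b(1)] by blast
  then have "t < D (grid n (Suc k)) \<omega>" "A (grid n (Suc k)) \<omega> \<le> y"
    using passed_after_first_passage[OF assms(1) g(1)] b(2)[OF g] by auto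
  then show ?thesis using good_path_space[OF assms(1)] by (auto simp: after_iff)
qed

subsection \<open>Distribution functions of the limit processes\<close>

text \<open>The event lies between \<open>before x r\<close> for \<open>r > t\<close> and \<open>before x s\<close> for \<open>s < t\<close>, whose probabilities
  have the common limit given by continuity.\<close>

lemma dist_fun_CTRM_limit:
  assumes "x\<^sub>0 < ereal x" "0 < t"
  shows "dist_fun N (CTRM_limit D A t) x = prob (before x t)"
proof -
  \<comment> \<open>The events that enclose the one in question; the step \<open>t / (j + 2)\<close> keeps the levels
    on the left positive.\<close>
  define U where "U = (\<Union>j. before x (t + 1 / real (Suc j)))"
  define V where "V = (\<Inter>j. before x (t - t / real (Suc (Suc j))))"
  have [measurable]: "U \<in> sets N" "V \<in> sets N" unfolding U_def V_def by auto
  have left_less: "t - t / real (Suc (Suc j)) < t" "0 < t - t / real (Suc (Suc j))" for j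
    using assms(2) by (simp_all add: field_simps add_pos_nonneg)
  have "prob U \<le> prob (before x t)"
  proof (rule finite_measure_mono)
    show "U \<subseteq> before x t" unfolding U_def by (intro UN_least before_antimono) simp
  qed auto
  moreover have "prob (before x t) \<le> prob U"
  proof (rule prob_before(2)[OF assms])
    fix u assume "t < u"
    then obtain j where "1 / real (Suc j) < u - t" using nat_approx_posE[of "u - t"] by auto
    then have "before x u \<subseteq> U" unfolding U_def
      using before_antimono[of "t + 1 / real (Suc j)" u x] by fastforce
    then show "prob (before x u) \<le> prob U" by (intro finite_measure_mono) auto
  qed
  moreover have "prob (before x t) \<le> prob V"
  proof (rule finite_measure_mono)
    show "before x t \<subseteq> V" unfolding V_def using left_less(1) by (intro INT_greatest before_antimono less_imp_le)
  qed auto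
  moreover have "prob V \<le> prob (before x t)"
  proof (rule prob_before(3)[OF assms])
    fix u assume u: "0 < u" "u < t"
    then obtain j where "1 / real (Suc j) < (t - u) / t" using nat_approx_posE[of "(t - u) / t"] by auto
    then have "t / real (Suc j) < t - u" using assms(2) by (simp add: field_simps)
    moreover have "t / real (Suc (Suc j)) \<le> t / real (Suc j)" using assms(2) by (intro divide_left_mono) auto
    ultimately have "before x (t - t / real (Suc (Suc j))) \<subseteq> before x u" by (intro before_antimono) linarith
    then have "V \<subseteq> before x u" unfolding V_def by blast
    then show "prob V \<le> prob (before x u)" by (intro finite_measure_mono) auto
  qed
  ultimately have eq: "prob U = prob (before x t)" "prob U = prob V" by auto
  have "dist_fun N (CTRM_limit D A t) x = prob U"
  proof (rule dist_fun_sandwich[OF _ _ _ _ eq(2)])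
    show "AE \<omega> in N. \<omega> \<in> U \<longrightarrow> CTRM_limit D A t \<omega> \<le> x"
      using AE_good_path
    proof eventually_elim
      case (elim \<omega>)
      have "CTRM_limit D A t \<omega> \<le> x" if "\<omega> \<in> before x (t + 1 / real (Suc j))" for j
        by (rule CTRM_limit_le_if_before[OF elim assms(2) _ that]) simp
      then show ?case unfolding U_def by blast
    qed
    show "AE \<omega> in N. CTRM_limit D A t \<omega> \<le> x \<longrightarrow> \<omega> \<in> V"
      using AE_good_path
    proof eventually_elim
      case (elim \<omega>)
      then show ?case unfolding V_def using before_if_CTRM_limit_le[OF elim assms(2) left_less(1)] by auto
    qed
  qed auto
  then show ?thesis using eq(1) by simp
qed

lemma dist_fun_OCTRM_limit:
  assumes "x\<^sub>0 < ereal x" "0 < t"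
  shows "dist_fun N (OCTRM_limit D A t) x = prob (after x t)"
proof (rule dist_fun_sandwich)
  show "AE \<omega> in N. \<omega> \<in> after x t \<longrightarrow> OCTRM_limit D A t \<omega> \<le> x"
    using AE_good_path by eventually_elim (auto intro: OCTRM_limit_le_if_after[OF _ assms(2)])
  show "AE \<omega> in N. OCTRM_limit D A t \<omega> \<le> x \<longrightarrow> \<omega> \<in> after_limit x t"
    using AE_good_path
  proof eventually_elim
    case (elim \<omega>)
    have "\<omega> \<in> after (x + 1 / real (Suc j)) t" if "OCTRM_limit D A t \<omega> \<le> x" for j
      by (rule after_if_OCTRM_limit_less[OF elim assms(2)]) (rule le_less_trans[OF that], simp)
    then show ?case unfolding after_limit_def by auto
  qed
  have "ennreal (prob (after x t)) = ennreal (prob (after_limit x t))"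
    using prob_after[OF assms, of "after x"] prob_after[OF assms, of "after_limit x"] by simp
  then show "prob (after x t) = prob (after_limit x t)" by simp
qed auto

lemma AE_A_above:
  assumes "CL_transform \<rho> 0 x = 0" "0 < s"
  shows "AE \<omega> in N. x < A s \<omega>"
proof -
  note [measurable] = measurable_A[OF assms(2)]
  have "prob {\<omega> \<in> space N. A s \<omega> \<le> x} = 0"
    using assms by (simp add: prob_A_le)
  then show ?thesis
    by (subst AE_iff_measurable[OF _ refl]) (auto simp: not_less emeasure_eq_measure)
qed

text \<open>If \<open>F(x) = 0\<close>, then \<open>A\<close> exceeds \<open>x\<close> at arbitrarily small times, hence before \<open>t\<close> is reached.\<close>

lemma dist_fun_below_support:
  assumes "CL_transform \<rho> 0 x = 0" "0 < t"
  shows "dist_fun N (CTRM_limit D A t) x = 0" "dist_fun N (OCTRM_limit D A t) x = 0"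
proof -
  have ae: "AE \<omega> in N. good_path \<omega> \<and> (\<forall>n. x < A (grid n (Suc 0)) \<omega>)"
    using AE_A_above[OF assms(1) grid_pos] by (intro AE_conjI AE_good_path) (simp add: AE_all_countable)
  have small: "\<exists>n. D (grid n (Suc 0)) \<omega> < s" if "good_path \<omega>" "0 < s" for \<omega> s
    using that by (simp add: good_path_def grid_def)
  have "dist_fun N (CTRM_limit D A t) x = prob {}"
  proof (rule dist_fun_sandwich)
    show "AE \<omega> in N. CTRM_limit D A t \<omega> \<le> x \<longrightarrow> \<omega> \<in> {}"
      using ae
    proof eventually_elim
      case (elim \<omega>)
      obtain n where n: "D (grid n (Suc 0)) \<omega> < t / 2" using small[of \<omega> "t / 2"] elim assms(2) by auto
      have "\<not> CTRM_limit D A t \<omega> \<le> x"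
      proof
        assume "CTRM_limit D A t \<omega> \<le> x"
        then have "\<omega> \<in> before x (t / 2)"
          using elim assms(2) by (intro before_if_CTRM_limit_le[of \<omega> t]) auto
        then have "A (grid n (Suc 0)) \<omega> \<le> x" using n by (simp add: before_iff)
        moreover have "x < A (grid n (Suc 0)) \<omega>" using elim by blast
        ultimately show False by simp
      qed
      then show ?case by simp
    qed
  qed auto
  then show "dist_fun N (CTRM_limit D A t) x = 0" by simp
  have "dist_fun N (OCTRM_limit D A t) x = prob {}"
  proof (rule dist_fun_sandwich)
    show "AE \<omega> in N. OCTRM_limit D A t \<omega> \<le> x \<longrightarrow> \<omega> \<in> {}"
      using ae
    proof eventually_elim
      case (elim \<omega>)
      obtain n where n: "D (grid n (Suc 0)) \<omega> < t" using small[of \<omega> t] elim assms(2) by auto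
      have "grid n (Suc 0) < first_passage D t \<omega>"
        using elim n by (intro less_first_passage grid_pos) auto
      then have "A (grid n (Suc 0)) \<omega> \<le> OCTRM_limit D A t \<omega>"
        unfolding OCTRM_limit_def using elim by (intro good_path_A_mono grid_pos) auto
      moreover have "x < A (grid n (Suc 0)) \<omega>" using elim by blast
      ultimately show ?case by simp
    qed
  qed auto
  then show "dist_fun N (OCTRM_limit D A t) x = 0" by simp
qed

text \<open>For \<open>r \<ge> 0\<close> the product sets avoid the excluded point \<open>(0, x\<^sub>0)\<close>.\<close>

lemma jump_tails_eq:
  assumes "0 \<le> r"
  shows "levy_measure_D x\<^sub>0 \<Phi> {r<..} = tail_mass (\<lambda>_. True) r"
    and "emeasure \<Phi> ({r<..} \<times> {x\<^sub>0..ereal x}) = tail_mass (\<lambda>p. snd p \<le> ereal x) r"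
proof -
  have "{r<..} \<times> {x\<^sub>0..<\<infinity>} = {p \<in> space \<Phi>. r < fst p \<and> True}"
    using assms unfolding space_Phi CL_space_def by auto
  then show "levy_measure_D x\<^sub>0 \<Phi> {r<..} = tail_mass (\<lambda>_. True) r"
    by (simp add: levy_measure_D_def)
  have "y < \<infinity>" if "y \<le> ereal x" for y
    using that by (rule le_less_trans) simp
  then have "{r<..} \<times> {x\<^sub>0..ereal x} = {p \<in> space \<Phi>. r < fst p \<and> snd p \<le> ereal x}"
    using assms unfolding space_Phi CL_space_def by auto
  then show "emeasure \<Phi> ({r<..} \<times> {x\<^sub>0..ereal x}) = tail_mass (\<lambda>p. snd p \<le> ereal x) r"
    by simp
qed

lemma iterated_integral_eq:
  assumes [measurable]: "Measurable.pred \<Phi> Q"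
    and tail: "\<And>r. 0 \<le> r \<Longrightarrow> K r = tail_mass Q r"
  shows "(\<integral>\<^sup>+s\<in>{0<..}. (\<integral>\<^sup>+(\<tau>, u). indicator {0..t} \<tau> * indicator {..x} u * K (t - \<tau>)
           \<partial>distr N borel (\<lambda>\<omega>. (D s \<omega>, A s \<omega>))) \<partial>lborel)
    = jump_cover (\<lambda>p. A (fst p) (snd p) \<le> x) Q t"
proof -
  have [measurable]: "(\<lambda>r. tail_mass Q r) \<in> borel_measurable borel"
    by (rule measurable_emeasure_exceeding) fact
  have inner: "(\<integral>\<^sup>+(\<tau>, u). indicator {0..t} \<tau> * indicator {..x} u * K (t - \<tau>) \<partial>distr N borel (\<lambda>\<omega>. (D s \<omega>, A s \<omega>)))
      = crossing_rate (\<lambda>p. A (fst p) (snd p) \<le> x) Q t s" if "0 < s" for s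
  proof -
    note [measurable] = measurable_D[OF that] measurable_A[OF that]
    have "(\<integral>\<^sup>+(\<tau>, u). indicator {0..t} \<tau> * indicator {..x} u * K (t - \<tau>) \<partial>distr N borel (\<lambda>\<omega>. (D s \<omega>, A s \<omega>)))
      = (\<integral>\<^sup>+p. indicator {0..t} (fst p) * indicator {..x} (snd p) * tail_mass Q (t - fst p) \<partial>distr N borel (\<lambda>\<omega>. (D s \<omega>, A s \<omega>)))"
      by (intro nn_integral_cong) (auto simp: tail split: split_indicator)
    also have "\<dots> = (\<integral>\<^sup>+\<omega>. indicator {0..t} (D s \<omega>) * indicator {..x} (A s \<omega>) * tail_mass Q (t - D s \<omega>) \<partial>N)"
      by (subst nn_integral_distr) (simp_all add: borel_prod[symmetric])
    also have "\<dots> = crossing_rate (\<lambda>p. A (fst p) (snd p) \<le> x) Q t s"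
      by (intro nn_integral_cong) (auto split: split_indicator)
    finally show ?thesis .
  qed
  have "jump_cover (\<lambda>p. A (fst p) (snd p) \<le> x) Q t = (\<integral>\<^sup>+s\<in>{0<..}. crossing_rate (\<lambda>p. A (fst p) (snd p) \<le> x) Q t s \<partial>lborel)"
    by (rule jump_cover_eq) measurable
  also have "\<dots> = (\<integral>\<^sup>+s\<in>{0<..}. (\<integral>\<^sup>+(\<tau>, u). indicator {0..t} \<tau> * indicator {..x} u * K (t - \<tau>)
           \<partial>distr N borel (\<lambda>\<omega>. (D s \<omega>, A s \<omega>))) \<partial>lborel)"
  proof (intro nn_integral_cong)
    fix s :: real
    show "crossing_rate (\<lambda>p. A (fst p) (snd p) \<le> x) Q t s * indicator {0<..} s
      = (\<integral>\<^sup>+(\<tau>, u). indicator {0..t} \<tau> * indicator {..x} u * K (t - \<tau>)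
           \<partial>distr N borel (\<lambda>\<omega>. (D s \<omega>, A s \<omega>))) * indicator {0<..} s"
      by (cases "0 < s") (simp_all only: inner, simp)
  qed
  finally show ?thesis by simp
qed

lemma jump_cover_below_support:
  assumes "CL_transform \<rho> 0 x = 0" and [measurable]: "Measurable.pred \<Phi> Q"
  shows "jump_cover (\<lambda>p. A (fst p) (snd p) \<le> x) Q t = 0"
proof -
  have "crossing_rate (\<lambda>p. A (fst p) (snd p) \<le> x) Q t s = 0" if "0 < s" for s
  proof -
    have "crossing_rate (\<lambda>p. A (fst p) (snd p) \<le> x) Q t s = (\<integral>\<^sup>+\<omega>. 0 \<partial>N)"
    proof (rule nn_integral_cong_AE)
      show "AE \<omega> in N. indicator {0..t} (D s \<omega>) * indicator {p. A (fst p) (snd p) \<le> x} (s, \<omega>) *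
        tail_mass Q (t - D s \<omega>) = 0"
        using AE_A_above[OF assms(1) that] by eventually_elim simp
    qed
    then show ?thesis by simp
  qed
  then have "(\<integral>\<^sup>+s\<in>{0<..}. crossing_rate (\<lambda>p. A (fst p) (snd p) \<le> x) Q t s \<partial>lborel) = (\<integral>\<^sup>+s. 0 \<partial>(lborel :: real measure))"
    by (intro nn_integral_cong) (auto split: split_indicator)
  then show ?thesis by (subst jump_cover_eq) auto
qed

theorem CTRM_limit_distribution:
  assumes "0 < t" "x\<^sub>0 < ereal x \<or> CL_transform \<rho> 0 x = 0"
  shows "ennreal (dist_fun N (CTRM_limit D A t) x) =
        (\<integral>\<^sup>+s\<in>{0<..}. (\<integral>\<^sup>+(\<tau>, u). indicator {0..t} \<tau> * indicator {..x} u *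
             levy_measure_D x\<^sub>0 \<Phi> {t - \<tau><..}
           \<partial>distr N borel (\<lambda>\<omega>. (D s \<omega>, A s \<omega>))) \<partial>lborel)"
proof -
  have "(\<integral>\<^sup>+s\<in>{0<..}. (\<integral>\<^sup>+(\<tau>, u). indicator {0..t} \<tau> * indicator {..x} u *
             levy_measure_D x\<^sub>0 \<Phi> {t - \<tau><..}
           \<partial>distr N borel (\<lambda>\<omega>. (D s \<omega>, A s \<omega>))) \<partial>lborel) = jump_cover (\<lambda>p. A (fst p) (snd p) \<le> x) (\<lambda>_. True) t"
    by (rule iterated_integral_eq[where K = "\<lambda>r. levy_measure_D x\<^sub>0 \<Phi> {r<..}"]) (auto simp: jump_tails_eq(1))
  moreover have "ennreal (dist_fun N (CTRM_limit D A t) x) = jump_cover (\<lambda>p. A (fst p) (snd p) \<le> x) (\<lambda>_. True) t"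
    using assms(2)
  proof
    assume "x\<^sub>0 < ereal x"
    then show ?thesis using assms(1) by (simp add: dist_fun_CTRM_limit prob_before(1))
  next
    assume "CL_transform \<rho> 0 x = 0"
    then show ?thesis using assms(1) by (simp add: dist_fun_below_support jump_cover_below_support)
  qed
  ultimately show ?thesis by simp
qed

theorem OCTRM_limit_distribution:
  assumes "0 < t" "x\<^sub>0 < ereal x \<or> CL_transform \<rho> 0 x = 0"
  shows "ennreal (dist_fun N (OCTRM_limit D A t) x) =
        (\<integral>\<^sup>+s\<in>{0<..}. (\<integral>\<^sup>+(\<tau>, u). indicator {0..t} \<tau> * indicator {..x} u *
             emeasure \<Phi> ({t - \<tau><..} \<times> {x\<^sub>0..ereal x})
           \<partial>distr N borel (\<lambda>\<omega>. (D s \<omega>, A s \<omega>))) \<partial>lborel)"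
proof -
  have "(\<integral>\<^sup>+s\<in>{0<..}. (\<integral>\<^sup>+(\<tau>, u). indicator {0..t} \<tau> * indicator {..x} u *
             emeasure \<Phi> ({t - \<tau><..} \<times> {x\<^sub>0..ereal x})
           \<partial>distr N borel (\<lambda>\<omega>. (D s \<omega>, A s \<omega>))) \<partial>lborel)
      = jump_cover (\<lambda>p. A (fst p) (snd p) \<le> x) (\<lambda>p. snd p \<le> ereal x) t"
    by (rule iterated_integral_eq[where K = "\<lambda>r. emeasure \<Phi> ({r<..} \<times> {x\<^sub>0..ereal x})"]) (auto simp: jump_tails_eq(2))
  moreover have "ennreal (dist_fun N (OCTRM_limit D A t) x) = jump_cover (\<lambda>p. A (fst p) (snd p) \<le> x) (\<lambda>p. snd p \<le> ereal x) t"
    using assms(2)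
  proof
    assume "x\<^sub>0 < ereal x"
    then show ?thesis using assms(1) by (simp add: dist_fun_OCTRM_limit prob_after)
  next
    assume "CL_transform \<rho> 0 x = 0"
    then show ?thesis using assms(1) by (simp add: dist_fun_below_support jump_cover_below_support)
  qed
  ultimately show ?thesis by simp
qed

lemma laplace_antimono_real:
  fixes g :: "real \<Rightarrow> real"
  assumes antimono: "\<And>s t. 0 < s \<Longrightarrow> s \<le> t \<Longrightarrow> g t \<le> g s" and nonneg: "\<And>t. 0 < t \<Longrightarrow> 0 \<le> g t"
    and lap: "laplace_nn \<xi> (\<lambda>t. ennreal (g t)) = ennreal c" and "0 \<le> c"
  shows "(LBINT t:{0<..}. exp (- \<xi> * t) * g t) = c"
proof -
  have meas: "(\<lambda>t. g t * indicator {0<..} t) \<in> borel_measurable borel"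
    using antimono by (rule borel_measurable_antimono_halfline)
  have "(\<lambda>t. exp (- \<xi> * t) * (g t * indicator {0<..} t)) \<in> borel_measurable borel"
    using meas by measurable
  then have meas': "(\<lambda>t. indicator {0<..} t *\<^sub>R (exp (- \<xi> * t) * g t)) \<in> borel_measurable lborel"
    by (simp add: mult_ac)
  have "(LBINT t:{0<..}. exp (- \<xi> * t) * g t) = enn2real (\<integral>\<^sup>+t. ennreal (indicator {0<..} t *\<^sub>R (exp (- \<xi> * t) * g t)) \<partial>lborel)"
    unfolding set_lebesgue_integral_def using meas' nonneg
    by (intro integral_eq_nn_integral) (auto split: split_indicator)
  also have "(\<integral>\<^sup>+t. ennreal (indicator {0<..} t *\<^sub>R (exp (- \<xi> * t) * g t)) \<partial>lborel) = ennreal c"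
    unfolding lap[symmetric]
    by (intro nn_integral_cong) (auto simp: ennreal_mult nonneg split: split_indicator)
  finally show ?thesis using \<open>0 \<le> c\<close> by simp
qed

theorem laplace_CTRM_limit:
  assumes "0 < \<xi>" "x\<^sub>0 < ereal x"
  shows "(LBINT t:{0<..}. exp (- \<xi> * t) * dist_fun N (CTRM_limit D A t) x) = 1 / \<xi> * (\<Psi>\<^sub>D \<xi> / \<Psi> \<xi> x)"
proof -
  have "(LBINT t:{0<..}. exp (- \<xi> * t) * dist_fun N (CTRM_limit D A t) x) = (LBINT t:{0<..}. exp (- \<xi> * t) * prob (before x t))"
    by (intro set_lebesgue_integral_cong) (auto simp: dist_fun_CTRM_limit[OF assms(2)])
  also have "\<dots> = \<Psi>\<^sub>D \<xi> / (\<xi> * \<Psi> \<xi> x)"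
  proof (rule laplace_antimono_real)
    show "laplace_nn \<xi> (\<lambda>t. ennreal (prob (before x t))) = ennreal (\<Psi>\<^sub>D \<xi> / (\<xi> * \<Psi> \<xi> x))"
      using laplace_before[OF assms] by (simp add: emeasure_eq_measure)
    show "prob (before x t) \<le> prob (before x s)" if "s \<le> t" for s t
      using before_antimono[OF that] by (intro finite_measure_mono) auto
    show "0 \<le> \<Psi>\<^sub>D \<xi> / (\<xi> * \<Psi> \<xi> x)"
      using Psi_pos[OF assms] Psi_D_pos[OF assms(1)] assms(1) by simp
  qed auto
  finally show ?thesis by simp
qed

theorem laplace_OCTRM_limit:
  assumes "0 < \<xi>" "x\<^sub>0 < ereal x"
  shows "(LBINT t:{0<..}. exp (- \<xi> * t) * dist_fun N (OCTRM_limit D A t) x)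
    = 1 / \<xi> * ((\<Psi> \<xi> x + ln (CL_transform \<rho> 0 x)) / \<Psi> \<xi> x)"
proof -
  have "(LBINT t:{0<..}. exp (- \<xi> * t) * dist_fun N (OCTRM_limit D A t) x) = (LBINT t:{0<..}. exp (- \<xi> * t) * prob (after x t))"
    by (intro set_lebesgue_integral_cong) (auto simp: dist_fun_OCTRM_limit[OF assms(2)])
  also have "\<dots> = (\<Psi> \<xi> x - \<Psi> 0 x) / (\<xi> * \<Psi> \<xi> x)"
  proof (rule laplace_antimono_real)
    show "laplace_nn \<xi> (\<lambda>t. ennreal (prob (after x t))) = ennreal ((\<Psi> \<xi> x - \<Psi> 0 x) / (\<xi> * \<Psi> \<xi> x))"
      using laplace_after(1)[OF assms] by (simp add: emeasure_eq_measure)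
    show "prob (after x t) \<le> prob (after x s)" if "s \<le> t" for s t
      using after_antimono[OF that] by (intro finite_measure_mono) auto
    have "\<Psi> 0 x \<le> \<Psi> \<xi> x"
      unfolding CL_exponent_def using assms space_PhiD
      by (intro integral_mono CL_transform_eq_exp) (auto simp: CL_integrand_eq split: split_indicator)
    then show "0 \<le> (\<Psi> \<xi> x - \<Psi> 0 x) / (\<xi> * \<Psi> \<xi> x)"
      using Psi_pos[OF assms] assms(1) by simp
  qed auto
  finally show ?thesis using CL_transform_eq_exp(1)[of 0 x] assms(2) by simp
qed

end

section \<open>Stability\<close>

text \<open>Monotonicity replaces continuity in passing from rational to real factors.\<close>

lemma mono_rationally_homogeneous:
  fixes g :: "real \<Rightarrow> real"
  assumes mono: "\<And>a b. 0 < a \<Longrightarrow> a \<le> b \<Longrightarrow> g a \<le> g b"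
    and rational: "\<And>q. q \<in> \<rat> \<Longrightarrow> 0 < q \<Longrightarrow> g q = q * g 1"
    and "0 \<le> g 1" "0 < b"
  shows "g b = b * g 1"
proof (cases "g 1 = 0")
  case True
  obtain q where "q \<in> \<rat>" "b < q" using Rats_dense_in_real[of b "b + 1"] by auto
  obtain p where p: "p \<in> \<rat>" "0 < p" "p < b" using Rats_dense_in_real[OF \<open>0 < b\<close>] by blast
  show ?thesis
    using mono[of p b] mono[of b q] rational[of p] rational[of q] p \<open>q \<in> \<rat>\<close> \<open>b < q\<close> \<open>0 < b\<close> True by auto
next
  case False
  then have g1: "0 < g 1" using assms(3) by simp
  show ?thesis
  proof (rule antisym; rule ccontr)
    assume "\<not> g b \<le> b * g 1"
    then have "b < g b / g 1" using g1 by (simp add: field_simps)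
    then obtain q where q: "q \<in> \<rat>" "b < q" "q < g b / g 1" using Rats_dense_in_real by blast
    then have "g b \<le> q * g 1" using mono[of b q] rational[of q] \<open>0 < b\<close> by auto
    with q(3) g1 show False by (simp add: field_simps)
  next
    assume "\<not> b * g 1 \<le> g b"
    then have "g b / g 1 < b" using g1 by (simp add: field_simps)
    then have "max 0 (g b / g 1) < b" using \<open>0 < b\<close> by simp
    then obtain q where q: "q \<in> \<rat>" "max 0 (g b / g 1) < q" "q < b" using Rats_dense_in_real by blast
    then have "q * g 1 \<le> g b" using mono[of q b] rational[of q] by auto
    with q(2) g1 show False by (simp add: field_simps)
  qed
qed

text \<open>Sums of \<open>n\<close> copies give \<open>\<phi>(n\<^bsup>1/\<beta>\<^esup> s) = \<phi>(s)\<^bsup>n\<^esup>\<close>, which determines \<open>b \<mapsto> -ln \<phi>(b\<^bsup>1/\<beta>\<^esup> s)\<close> at rational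
  \<open>b\<close>. As point masses are excluded, the law is not concentrated at 0.\<close>

lemma strictly_stable_laplace:
  fixes \<nu> :: "real measure"
  assumes "prob_space \<nu>" and sets [measurable_cong]: "sets \<nu> = sets borel" and nonneg: "AE x in \<nu>. 0 \<le> x"
    and stable: "strictly_stable \<beta> \<nu>" and "0 < \<beta>"
  defines "\<phi> \<equiv> \<lambda>s. \<integral>x. exp (- s * x) \<partial>\<nu>"
  shows "\<phi> 1 < 1" "0 < a \<Longrightarrow> 0 < s \<Longrightarrow> \<phi> (a * s) = \<phi> s powr (a powr \<beta>)"
proof -
  interpret prob_space \<nu> by fact
  have bound: "AE x in \<nu>. norm (exp (- s * x)) \<le> 1" if "0 \<le> s" for s
    using nonneg by eventually_elim (use that in simp)
  have int: "integrable \<nu> (\<lambda>x. exp (- s * x))" if "0 \<le> s" for s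
    by (rule integrable_const_bound[OF bound[OF that]]) simp
  have le_1: "\<phi> s \<le> 1" if "0 \<le> s" for s
    using integral_mono_AE[OF int[OF that] integrable_const[of 1]] bound[OF that] by (simp add: \<phi>_def prob_space)
  have pos: "0 < \<phi> s" if "0 \<le> s" for s
  proof -
    have "\<phi> s \<noteq> 0"
    proof
      assume "\<phi> s = 0"
      then have "AE x in \<nu>. exp (- s * x) = 0"
        unfolding \<phi>_def by (subst (asm) integral_nonneg_eq_0_iff_AE[OF int[OF that]]) auto
      then show False by simp
    qed
    moreover have "0 \<le> \<phi> s" unfolding \<phi>_def by simp
    ultimately show ?thesis by simp
  qed
  show "\<phi> 1 < 1"
  proof (rule ccontr)
    assume "\<not> ?thesis"
    then have "\<phi> 1 = 1" using le_1[of 1] by simp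
    then have "(\<integral>x. 1 - exp (- 1 * x) \<partial>\<nu>) = 0"
      unfolding \<phi>_def using int[of 1] by (subst Bochner_Integration.integral_diff) (auto simp: prob_space)
    moreover have "AE x in \<nu>. 0 \<le> 1 - exp (- 1 * x)"
      using nonneg by eventually_elim simp
    moreover have "integrable \<nu> (\<lambda>x. 1 - exp (- 1 * x))"
      using int[of 1] by (intro Bochner_Integration.integrable_diff) auto
    ultimately have ae: "AE x in \<nu>. x = 0"
      using integral_nonneg_eq_0_iff_AE[of \<nu> "\<lambda>x. 1 - exp (- 1 * x)"] by simp
    have "\<nu> = return borel 0"
    proof (rule measure_eqI)
      fix B assume [measurable]: "B \<in> sets \<nu>"
      have "emeasure \<nu> B = emeasure \<nu> {x \<in> space \<nu>. 0 \<in> B}"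
        using ae AE_space by (intro emeasure_eq_AE) (auto elim: eventually_elim2)
      then show "emeasure \<nu> B = emeasure (return borel 0) B"
        using sets \<open>B \<in> sets \<nu>\<close> by (cases "0 \<in> B") (auto simp: emeasure_space_1)
    qed (simp add: sets)
    moreover have "\<nu> \<noteq> return borel 0" using stable unfolding strictly_stable_def by blast
    ultimately show False by blast
  qed
  have power: "\<phi> (real n powr (1 / \<beta>) * s) = \<phi> s ^ n" if "1 \<le> n" "0 \<le> s" for n s
  proof -
    interpret P: product_prob_space "\<lambda>_. \<nu>" "{..<n}" ..
    have "\<phi> (real n powr (1 / \<beta>) * s) = (\<integral>x. exp (- s * x) \<partial>distr \<nu> borel (\<lambda>x. real n powr (1 / \<beta>) * x))"
      unfolding \<phi>_def by (subst integral_distr) (auto simp: mult_ac)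
    also have "\<dots> = (\<integral>x. exp (- s * x) \<partial>distr (Pi\<^sub>M {..<n} (\<lambda>_. \<nu>)) borel (\<lambda>x. \<Sum>i<n. x i))"
      using stable that(1) by (simp add: strictly_stable_def)
    also have "\<dots> = (\<integral>x. (\<Prod>i<n. exp (- s * x i)) \<partial>Pi\<^sub>M {..<n} (\<lambda>_. \<nu>))"
      by (subst integral_distr) (auto simp: exp_sum sum_distrib_left sum_negf[symmetric])
    also have "\<dots> = (\<Prod>i<n. \<integral>x. exp (- s * x) \<partial>\<nu>)"
      using int[OF that(2)] by (intro P.product_integral_prod) auto
    finally show ?thesis by (simp add: \<phi>_def)
  qed
  show "\<phi> (a * s) = \<phi> s powr (a powr \<beta>)" if "0 < a" "0 < s"
  proof -
    define g where "g b = - ln (\<phi> (b powr (1 / \<beta>) * s))" for b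
    have g1: "g 1 = - ln (\<phi> s)" by (simp add: g_def)
    have "g (a powr \<beta>) = a powr \<beta> * g 1"
    proof (rule mono_rationally_homogeneous)
      fix b c :: real assume "0 < b" "b \<le> c"
      then have "b powr (1 / \<beta>) * s \<le> c powr (1 / \<beta>) * s"
        using \<open>0 < \<beta>\<close> \<open>0 < s\<close> by (intro mult_right_mono powr_mono2) auto
      then have "\<phi> (c powr (1 / \<beta>) * s) \<le> \<phi> (b powr (1 / \<beta>) * s)"
        unfolding \<phi>_def using nonneg \<open>0 < s\<close>
        by (intro integral_mono_AE int) (auto elim!: eventually_mono intro: mult_right_mono)
      then show "g b \<le> g c"
        unfolding g_def using pos[of "c powr (1 / \<beta>) * s"] pos[of "b powr (1 / \<beta>) * s"] \<open>0 < s\<close> by simp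
    next
      fix q :: real assume "q \<in> \<rat>" "0 < q"
      then obtain m n :: nat where q: "q = real m / real n" "n \<noteq> 0"
        using Rats_abs_nat_div_natE[of q] by (metis abs_of_pos)
      have "m \<noteq> 0" using q \<open>0 < q\<close> by (metis div_0 less_irrefl of_nat_0)
      \<comment> \<open>With \<open>q = m / n\<close>, compute \<open>\<phi>(m\<^bsup>1/\<beta>\<^esup> s)\<close> once from \<open>m\<close> copies and once from \<open>n\<close> copies.\<close>
      have "\<phi> s ^ m = \<phi> (real m powr (1 / \<beta>) * s)"
        using power[of m s] \<open>m \<noteq> 0\<close> \<open>0 < s\<close> by simp
      also have "real m powr (1 / \<beta>) * s = real n powr (1 / \<beta>) * (q powr (1 / \<beta>) * s)"
        using q by (simp add: powr_mult[symmetric])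
      also have "\<phi> \<dots> = \<phi> (q powr (1 / \<beta>) * s) ^ n"
        using power[of n "q powr (1 / \<beta>) * s"] q \<open>0 < s\<close> by simp
      finally have "real m * ln (\<phi> s) = real n * ln (\<phi> (q powr (1 / \<beta>) * s))"
        using pos[of s] pos[of "q powr (1 / \<beta>) * s"] \<open>0 < s\<close> by (metis ln_realpow less_imp_le mult_nonneg_nonneg powr_ge_zero)
      moreover have "real m = q * real n" using q by simp
      ultimately have "real n * (q * ln (\<phi> s)) = real n * ln (\<phi> (q powr (1 / \<beta>) * s))"
        by (simp only: mult_ac)
      then have "q * ln (\<phi> s) = ln (\<phi> (q powr (1 / \<beta>) * s))"
        using q(2) by simp
      then show "g q = q * g 1" unfolding g1 g_def by simp
    next
      show "0 \<le> g 1" unfolding g1 using pos[of s] le_1[of s] \<open>0 < s\<close> by simp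
    qed (use \<open>0 < a\<close> in simp)
    then have "ln (\<phi> (a * s)) = a powr \<beta> * ln (\<phi> s)"
      using \<open>0 < a\<close> \<open>0 < \<beta>\<close> unfolding g1 unfolding g_def by (simp add: powr_powr)
    then show ?thesis
      using pos[of s] pos[of "a * s"] that by (simp add: powr_def) (metis exp_ln)
  qed
qed

text \<open>Only the Frechet family vanishes anywhere, and it does so on a closed half-line. This settles the
  level \<open>x = x\<^sub>0\<close>, at which the exponent is not defined.\<close>

lemma extreme_value_cdf_zero:
  assumes "extreme_value_cdf F" and zero: "\<And>y. y < x \<Longrightarrow> F y = 0"
  shows "F x = 0"
proof -
  obtain G c d where G: "(\<exists>\<alpha>>0. G = frechet_cdf \<alpha>) \<or> (\<exists>\<alpha>>0. G = weibull_cdf \<alpha>) \<or> G = gumbel_cdf"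
    and c: "0 < c" and F: "F = (\<lambda>x. G (c * x + d))"
    using assms(1) unfolding extreme_value_cdf_def by blast
  have "F (x - 1) = 0" using zero by simp
  then obtain \<alpha> where \<alpha>: "G = frechet_cdf \<alpha>"
    using G by (auto simp: F weibull_cdf_def gumbel_cdf_def split: if_splits)
  have "c * x + d \<le> 0"
  proof (rule ccontr)
    assume "\<not> ?thesis"
    then have "- d / c < x" using c by (simp add: field_simps)
    then obtain y where "- d / c < y" "y < x" using dense by blast
    then have "0 < c * y + d" using c by (simp add: field_simps)
    then have "F y \<noteq> 0" by (simp add: F \<alpha> frechet_cdf_def)
    then show False using zero[OF \<open>y < x\<close>] by simp
  qed
  then show ?thesis by (simp add: F \<alpha> frechet_cdf_def)
qed

section \<open>The distribution of the limits\<close>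

theorem theorem4p1:
  fixes M :: "'a measure" and M\<^sub>0 :: "'b measure" and N :: "'c measure"
    and W J :: "nat \<Rightarrow> 'a \<Rightarrow> real"
    and a b d :: "nat \<Rightarrow> real"
    and D\<^sub>0 A\<^sub>0 :: "'b \<Rightarrow> real"
    and D A :: "real \<Rightarrow> 'c \<Rightarrow> real"
    and \<rho> :: "(real \<times> real) measure"
    and \<beta> :: real
    and F :: "real \<Rightarrow> real"
    and x\<^sub>0 x\<^sub>F :: ereal
    and \<Phi> :: "(real \<times> ereal) measure"
  assumes "prob_space M"
    and W_nonneg: "\<And>i \<omega>. \<omega> \<in> space M \<Longrightarrow> 0 \<le> W i \<omega>"
    and iid: "iid M (\<lambda>i \<omega>. (W i \<omega>, J i \<omega>))"
    and scaling: "\<And>n. n \<ge> 1 \<Longrightarrow> 0 < a n" "\<And>n. n \<ge> 1 \<Longrightarrow> 0 < b n"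
    and "prob_space M\<^sub>0"
    and limit_rv: "D\<^sub>0 \<in> borel_measurable M\<^sub>0" "A\<^sub>0 \<in> borel_measurable M\<^sub>0"
    and D\<^sub>0_nonneg: "\<And>\<omega>. \<omega> \<in> space M\<^sub>0 \<Longrightarrow> 0 \<le> D\<^sub>0 \<omega>"
    and \<rho>_def: "\<rho> = distr M\<^sub>0 borel (\<lambda>\<omega>. (D\<^sub>0 \<omega>, A\<^sub>0 \<omega>))"
    and convergence: "converges_weakly
          (\<lambda>n. distr M borel (\<lambda>\<omega>. (a n * (\<Sum>i=1..n. W i \<omega>),
                                   b n * (Max ((\<lambda>i. J i \<omega>) ` {1..n}) - d n)))) \<rho>"
    and \<beta>: "0 < \<beta>" "\<beta> < 1"
    and stable: "strictly_stable \<beta> (distr M\<^sub>0 borel D\<^sub>0)"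
    and F_def: "F = cdf (distr M\<^sub>0 borel A\<^sub>0)"
    and extreme_value: "extreme_value_cdf F"
    and x\<^sub>0_def: "x\<^sub>0 = left_endpoint F"
    and x\<^sub>F_def: "x\<^sub>F = right_endpoint F"
    and \<Phi>: "levy_exponent_measure \<rho> x\<^sub>0 \<Phi>"
    and "prob_space N"
    and process: "sum_max_process N \<rho> D A"
  shows
    "(\<forall>t>0. \<forall>x. ennreal (dist_fun N (CTRM_limit D A t) x) =
        (\<integral>\<^sup>+s\<in>{0<..}. (\<integral>\<^sup>+(\<tau>, u). indicator {0..t} \<tau> * indicator {..x} u *
             levy_measure_D x\<^sub>0 \<Phi> {t - \<tau><..}
           \<partial>distr N borel (\<lambda>\<omega>. (D s \<omega>, A s \<omega>))) \<partial>lborel)) \<and>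
     (\<forall>\<xi>>0. \<forall>x. x\<^sub>0 < ereal x \<and> ereal x < x\<^sub>F \<longrightarrow>
        (LBINT t:{0<..}. exp (- \<xi> * t) * dist_fun N (CTRM_limit D A t) x) =
          1 / \<xi> * (CL_exponent_D x\<^sub>0 \<Phi> \<xi> / CL_exponent x\<^sub>0 \<Phi> \<xi> (ereal x))) \<and>
     (\<forall>t>0. \<forall>x. ennreal (dist_fun N (OCTRM_limit D A t) x) =
        (\<integral>\<^sup>+s\<in>{0<..}. (\<integral>\<^sup>+(\<tau>, u). indicator {0..t} \<tau> * indicator {..x} u *
             emeasure \<Phi> ({t - \<tau><..} \<times> {x\<^sub>0..ereal x})
           \<partial>distr N borel (\<lambda>\<omega>. (D s \<omega>, A s \<omega>))) \<partial>lborel)) \<and>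
     (\<forall>\<xi>>0. \<forall>x. x\<^sub>0 < ereal x \<and> ereal x < x\<^sub>F \<longrightarrow>
        (LBINT t:{0<..}. exp (- \<xi> * t) * dist_fun N (OCTRM_limit D A t) x) =
          1 / \<xi> * ((CL_exponent x\<^sub>0 \<Phi> \<xi> (ereal x) + ln (F x)) / CL_exponent x\<^sub>0 \<Phi> \<xi> (ereal x)))"
proof -
  interpret M0: prob_space M\<^sub>0 by fact
  interpret N: prob_space N by fact
  note [measurable] = limit_rv
  have pair [measurable]: "(\<lambda>\<omega>. (D\<^sub>0 \<omega>, A\<^sub>0 \<omega>)) \<in> borel_measurable M\<^sub>0"
    by measurable
  have fst_rho: "(\<integral>p. f (fst p) \<partial>\<rho>) = (\<integral>x. f x \<partial>distr M\<^sub>0 borel D\<^sub>0)"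
    if [measurable]: "f \<in> borel_measurable borel" for f :: "real \<Rightarrow> real"
  proof -
    have "(\<integral>p. f (fst p) \<partial>\<rho>) = (\<integral>\<omega>. f (D\<^sub>0 \<omega>) \<partial>M\<^sub>0)"
      unfolding \<rho>_def by (subst integral_distr) (auto simp: borel_prod[symmetric])
    then show ?thesis by (simp add: integral_distr)
  qed
  have laplace_D_eq: "laplace_D \<rho> s = (\<integral>x. exp (- s * x) \<partial>distr M\<^sub>0 borel D\<^sub>0)" for s
    unfolding laplace_D_def by (rule fst_rho) simp
  have law_D: "prob_space (distr M\<^sub>0 borel D\<^sub>0)" "AE x in distr M\<^sub>0 borel D\<^sub>0. 0 \<le> x"
    using D\<^sub>0_nonneg by (auto simp: AE_distr_iff intro: M0.prob_space_distr)
  note stable_laplace = strictly_stable_laplace[OF law_D(1) sets_distr law_D(2) stable \<beta>(1), folded laplace_D_eq]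
  interpret law_A: real_distribution "distr M\<^sub>0 borel A\<^sub>0"
    by (rule M0.real_distribution_distr) simp
  have F_eq: "CL_transform \<rho> 0 y = F y" for y
  proof -
    have "CL_transform \<rho> 0 y = (\<integral>p. indicator {..y} (snd p) \<partial>\<rho>)"
      by (simp add: CL_transform_def case_prod_beta')
    also have "\<dots> = (\<integral>\<omega>. indicator {..y} (A\<^sub>0 \<omega>) \<partial>M\<^sub>0)"
      unfolding \<rho>_def by (subst integral_distr) (auto simp: borel_prod[symmetric])
    also have "\<dots> = (\<integral>u. indicator {..y} u \<partial>distr M\<^sub>0 borel A\<^sub>0)"
      by (subst integral_distr) auto
    also have "\<dots> = F y" by (simp add: F_def cdf_def)
    finally show ?thesis .
  qed
  have x0_le: "x\<^sub>0 \<le> ereal y" if "0 < F y" for y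
    unfolding x\<^sub>0_def left_endpoint_def using that by (intro Inf_lower) auto
  interpret process: stable_sum_max_setting N \<rho> D A x\<^sub>0 \<Phi> \<beta>
  proof (intro stable_sum_max_setting.intro sum_max_setting.intro sum_max_setting_axioms.intro stable_sum_max_setting_axioms.intro)
    show "prob_space N" by fact
    show "prob_space \<rho>" "sets \<rho> = sets borel"
      unfolding \<rho>_def by (auto intro: M0.prob_space_distr)
    show "AE p in \<rho>. 0 \<le> fst p"
      unfolding \<rho>_def using D\<^sub>0_nonneg by (subst AE_distr_iff) (auto simp: borel_prod[symmetric])
    have "eventually (\<lambda>y. 0 < F y) at_top"
      unfolding F_def using law_A.cdf_lim_at_top_prob by (rule order_tendstoD) simp
    then obtain y where "0 < F y" by (auto simp: eventually_at_top_linorder)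
    from x0_le[OF this] show "x\<^sub>0 < \<infinity>" by (rule le_less_trans) simp
    show "laplace_D \<rho> (u * s) = laplace_D \<rho> s powr (u powr \<beta>)" if "0 < u" "0 < s" for u s
      using stable_laplace(2)[OF that] .
    show "laplace_D \<rho> 1 < 1" by (rule stable_laplace(1))
  qed (use process \<Phi> \<beta> in auto)
  have support: "x\<^sub>0 < ereal x \<or> CL_transform \<rho> 0 x = 0" for x
  proof (cases "x\<^sub>0 < ereal x")
    case False
    have "F y = 0" if "y < x" for y
    proof (rule ccontr)
      assume "F y \<noteq> 0"
      then have "0 < F y" unfolding F_def by (simp add: less_le law_A.cdf_nonneg)
      then have "x\<^sub>0 \<le> ereal y" by (rule x0_le)
      also have "ereal y < ereal x" using that by simp
      finally show False using False by simp
    qed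
    then show ?thesis unfolding F_eq using extreme_value_cdf_zero[OF extreme_value] by blast
  qed simp
  show ?thesis
    using process.CTRM_limit_distribution[OF _ support] process.OCTRM_limit_distribution[OF _ support]
      process.laplace_CTRM_limit process.laplace_OCTRM_limit[unfolded F_eq]
    by (intro conjI allI impI) (simp_all only:)
qed

end
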